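(* Let $\Omega\subset\mathbb{R}^2$ be a bounded domain with Lipschitz boundary. Let $\beta_i\ge0$ for $i=1,\dots,4$ and let at most one of them vanish. Set ${\bm\beta}=(\sqrt{\beta_1},\dots,\sqrt{\beta_4})$, ${\bf B}=\mathrm{diag}(\sqrt{\beta_1},\dots,\sqrt{\beta_4})$ and, for $t>0$, ${\bm\beta}^t=t{\bm\beta}$. Then, for any $1\le p<2$, the functionals $R_{{\bm\beta}^t}$ $\Gamma$-converge to $\mathrm{TV}_{\mathrm B}$ with respect to the strong topology of $L^p(\Omega)$ as $t\to\infty$, where $$\mathrm{TV}_{\mathrm B}(u)=\inf_{\overline w\in\mathcal{M}(\Omega,\mathbb{R}^2),\ {\bf B}\nabla_N\overline w=0}\|\nabla u-\overline w\|_{\mathcal{M}(\Omega,\mathbb{R}^2)}$$ and both functionals are extended by $+\infty$ on $L^p(\Omega)\setminus BV(\Omega)$.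
   Context: $\mathcal{M}(\Omega,\mathbb{R}^d)$ is the space of finite $\mathbb{R}^d$-valued Radon measures on $\Omega$ with the dual norm $\|\mu\|_{\mathcal{M}(\Omega,\mathbb{R}^d)}=\sup\{\sum_{i=1}^d\int_\Omega\varphi_i\,d\mu_i:\varphi\in C_0(\Omega,\mathbb{R}^d),\ \|\varphi\|_\infty\le1\}$, where $\|\varphi\|_\infty$ is the supremum of the pointwise Euclidean norm. The norm is set to $+\infty$ for distributions that are not finite Radon measures. $\nabla u$ is the distributional gradient. For $w=(w_1,w_2)\in\mathcal{M}(\Omega,\mathbb{R}^2)$, with derivatives in the sense of distributions, $\mathrm{curl}(w)=\partial_{x_1}w_2-\partial_{x_2}w_1$, $\mathrm{div}(w)=\partial_{x_1}w_1+\partial_{x_2}w_2$, $\mathrm{sh}_1(w)=\partial_{x_2}w_2-\partial_{x_1}w_1$, $\mathrm{sh}_2(w)=\partial_{x_2}w_1+\partial_{x_1}w_2$, and $\nabla_Nw=(\mathrm{curl}(w),\mathrm{div}(w),\mathrm{sh}_1(w),\mathrm{sh}_2(w))^\top$. For a vector ${\bm\beta}\in[0,\infty)^4$, $$R_{\bm\beta}(u)=\inf_{w\in\mathcal{M}(\Omega,\mathbb{R}^2)}\|\nabla u-w\|_{\mathcal{M}(\Omega,\mathbb{R}^2)}+\|\mathrm{diag}({\bm\beta})\nabla_Nw\|_{\mathcal{M}(\Omega,\mathbb{R}^4)}.$$ *)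

theory Defs
  imports "HOL-Analysis.Analysis"
begin

section \<open>Lipschitz domains in the plane\<close>

text \<open>Near each boundary point, and in suitable orthonormal coordinates \<open>Q x\<close>, the set is the
  strict epigraph of a Lipschitz function of one variable.\<close>

definition lipschitz_boundary :: "(real^2) set \<Rightarrow> bool" where
  "lipschitz_boundary \<Omega> \<longleftrightarrow>
    (\<forall>z\<in>frontier \<Omega>. \<exists>r>0. \<exists>Q::real^2 \<Rightarrow> real^2. orthogonal_transformation Q \<and>
      (\<exists>L \<gamma>. L-lipschitz_on (UNIV::real set) \<gamma> \<and>
        \<Omega> \<inter> ball z r = {x \<in> ball z r. \<gamma> (Q x $ 1) < Q x $ 2}))"

definition bounded_lipschitz_domain :: "(real^2) set \<Rightarrow> bool" where
  "bounded_lipschitz_domain \<Omega> \<longleftrightarrow>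
    \<Omega> \<noteq> {} \<and> open \<Omega> \<and> connected \<Omega> \<and> bounded \<Omega> \<and> lipschitz_boundary \<Omega>"


section \<open>Test functions and distributions\<close>

definition partial :: "2 \<Rightarrow> (real^2 \<Rightarrow> real) \<Rightarrow> real^2 \<Rightarrow> real" where
  "partial j f x = frechet_derivative f (at x) (axis j 1)"

fun C_k :: "nat \<Rightarrow> (real^2 \<Rightarrow> real) \<Rightarrow> bool" where
  "C_k 0 f \<longleftrightarrow> continuous_on UNIV f"
| "C_k (Suc k) f \<longleftrightarrow> (\<forall>x. f differentiable (at x)) \<and> (\<forall>j. C_k k (partial j f))"

definition test_functions :: "(real^2) set \<Rightarrow> (real^2 \<Rightarrow> real) set" where
  "test_functions \<Omega> = {\<phi>. (\<forall>k. C_k k \<phi>) \<and>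
     compact (closure {x. \<phi> x \<noteq> 0}) \<and> closure {x. \<phi> x \<noteq> 0} \<subseteq> \<Omega>}"

text \<open>Distributions on \<open>\<Omega>\<close> are represented by functionals whose values matter only on
  \<open>test_functions \<Omega>\<close>; equality of distributions is therefore \<open>distr_eq \<Omega>\<close> and not HOL equality.
  Every functional used below is a distribution, so linearity and continuity are not built into
  the type.\<close>

type_synonym distribution = "(real^2 \<Rightarrow> real) \<Rightarrow> real"
type_synonym 'd vector_distribution = "(real^2 \<Rightarrow> real) \<Rightarrow> real^'d"

definition distr_eq :: "(real^2) set \<Rightarrow> 'd::finite vector_distribution \<Rightarrow> 'd vector_distribution \<Rightarrow> bool" where
  "distr_eq \<Omega> S T \<longleftrightarrow> (\<forall>\<phi>\<in>test_functions \<Omega>. S \<phi> = T \<phi>)"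

definition component :: "'d \<Rightarrow> 'd::finite vector_distribution \<Rightarrow> distribution" where
  "component i T \<phi> = T \<phi> $ i"

definition distr_partial :: "2 \<Rightarrow> distribution \<Rightarrow> distribution" where
  "distr_partial j T \<phi> = - T (partial j \<phi>)"

definition regular_distr :: "(real^2) set \<Rightarrow> (real^2 \<Rightarrow> real) \<Rightarrow> distribution" where
  "regular_distr \<Omega> u \<phi> = (\<integral>x. u x * \<phi> x \<partial>(lebesgue_on \<Omega>))"

definition grad :: "(real^2) set \<Rightarrow> (real^2 \<Rightarrow> real) \<Rightarrow> 2 vector_distribution" where
  "grad \<Omega> u \<phi> = (\<chi> j. distr_partial j (regular_distr \<Omega> u) \<phi>)"

definition curl :: "2 vector_distribution \<Rightarrow> distribution" where
  "curl T \<phi> = distr_partial 1 (component 2 T) \<phi> - distr_partial 2 (component 1 T) \<phi>"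

definition divergence :: "2 vector_distribution \<Rightarrow> distribution" where
  "divergence T \<phi> = distr_partial 1 (component 1 T) \<phi> + distr_partial 2 (component 2 T) \<phi>"

definition sh1 :: "2 vector_distribution \<Rightarrow> distribution" where
  "sh1 T \<phi> = distr_partial 2 (component 2 T) \<phi> - distr_partial 1 (component 1 T) \<phi>"

definition sh2 :: "2 vector_distribution \<Rightarrow> distribution" where
  "sh2 T \<phi> = distr_partial 2 (component 1 T) \<phi> + distr_partial 1 (component 2 T) \<phi>"

definition nabla_N :: "2 vector_distribution \<Rightarrow> 4 vector_distribution" where
  "nabla_N T \<phi> = vector [curl T \<phi>, divergence T \<phi>, sh1 T \<phi>, sh2 T \<phi>]"

lemma nabla_N_nth:
  "nabla_N T \<phi> $ 1 = curl T \<phi>" "nabla_N T \<phi> $ 2 = divergence T \<phi>"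
  "nabla_N T \<phi> $ 3 = sh1 T \<phi>" "nabla_N T \<phi> $ 4 = sh2 T \<phi>"
  by (simp_all add: nabla_N_def vector_def)

definition diag :: "real^'d \<Rightarrow> real^'d^'d::finite" where
  "diag b = (\<chi> i j. if i = j then b $ i else 0)"


section \<open>Finite vector-valued Radon measures\<close>

text \<open>A finite \<open>\<real>\<^sup>d\<close>-valued Radon measure on an open \<open>\<Omega>\<close> is a countably additive
  \<open>\<real>\<^sup>d\<close>-valued set function on the Borel subsets of \<open>\<Omega>\<close>; regularity and finite total variation
  are then automatic. Values on other sets are irrelevant.\<close>

definition radon_measures :: "(real^2) set \<Rightarrow> ((real^2) set \<Rightarrow> real^'d::finite) set" where
  "radon_measures \<Omega> = {\<mu>. \<forall>A::nat \<Rightarrow> (real^2) set.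
     range A \<subseteq> sets (restrict_space borel \<Omega>) \<longrightarrow> disjoint_family A \<longrightarrow>
       (\<lambda>n. \<mu> (A n)) sums \<mu> (\<Union>n. A n)}"

text \<open>The positive part of the Jordan decomposition of a finite signed measure \<open>\<nu>\<close>,
  \<open>\<nu>\<^sup>+(A) = sup {\<nu>(B) | B \<subseteq> A}\<close>; the negative part is the positive part of \<open>-\<nu>\<close>. The lemma
  \<open>emeasure_pos_part\<close> below shows that the set function passed to \<^const>\<open>measure_of\<close> is a measure.\<close>

definition pos_variation :: "(real^2) set \<Rightarrow> ((real^2) set \<Rightarrow> real) \<Rightarrow> (real^2) set \<Rightarrow> ennreal" where
  "pos_variation \<Omega> \<nu> A =
     (SUP B \<in> {B \<in> sets (restrict_space borel \<Omega>). B \<subseteq> A}. ennreal (\<nu> B))"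

definition pos_part :: "(real^2) set \<Rightarrow> ((real^2) set \<Rightarrow> real) \<Rightarrow> (real^2) measure" where
  "pos_part \<Omega> \<nu> = measure_of \<Omega> (sets (restrict_space borel \<Omega>)) (pos_variation \<Omega> \<nu>)"

lemma pos_variation_disjoint_le:
  assumes \<nu>: "\<And>C::nat \<Rightarrow> (real^2) set. range C \<subseteq> sets (restrict_space borel \<Omega>) \<Longrightarrow>
      disjoint_family C \<Longrightarrow> (\<lambda>n. \<nu> (C n)) sums \<nu> (\<Union>n. C n)"
    and dj: "A \<inter> B = {}"
  shows "pos_variation \<Omega> \<nu> A + pos_variation \<Omega> \<nu> B \<le> pos_variation \<Omega> \<nu> (A \<union> B)"
proof -
  let ?S = "sets (restrict_space borel \<Omega>)"
  have empty: "\<nu> {} = 0"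
  proof -
    have "(\<lambda>n::nat. \<nu> {}) sums \<nu> (\<Union>n::nat. {})"
      by (rule \<nu>) (auto simp: disjoint_family_on_def)
    then have "summable (\<lambda>n::nat. \<nu> {})" by (rule sums_summable)
    then show ?thesis by (simp add: summable_const_iff)
  qed
  have add: "\<nu> (C \<union> D) = \<nu> C + \<nu> D" if "C \<in> ?S" "D \<in> ?S" "C \<inter> D = {}" for C D
  proof -
    have "(\<lambda>n. \<nu> (binaryset C D n)) sums \<nu> (\<Union>n. binaryset C D n)"
      using that by (intro \<nu>) (auto simp: binaryset_def disjoint_family_on_def)
    moreover have "(\<lambda>n. \<nu> (binaryset C D n)) sums (\<nu> C + \<nu> D)"
      using empty by (rule binaryset_sums)
    ultimately show ?thesis
      by (simp add: UN_binaryset_eq sums_iff)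
  qed
  have le: "ennreal (\<nu> C) + ennreal (\<nu> D) \<le> pos_variation \<Omega> \<nu> (A \<union> B)"
    if CD: "C \<in> ?S" "C \<subseteq> A" "D \<in> ?S" "D \<subseteq> B" for C D
  proof -
    define C' where "C' = (if 0 \<le> \<nu> C then C else {})"
    define D' where "D' = (if 0 \<le> \<nu> D then D else {})"
    have "ennreal (\<nu> C) + ennreal (\<nu> D) = ennreal (\<nu> C') + ennreal (\<nu> D')"
      by (auto simp: C'_def D'_def empty ennreal_neg)
    also have "\<dots> = ennreal (\<nu> C' + \<nu> D')"
      by (subst ennreal_plus) (auto simp: C'_def D'_def empty)
    also have "\<nu> C' + \<nu> D' = \<nu> (C' \<union> D')"
      using CD dj by (intro add[symmetric]) (auto simp: C'_def D'_def)
    also have "ennreal (\<nu> (C' \<union> D')) \<le> pos_variation \<Omega> \<nu> (A \<union> B)"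
      unfolding pos_variation_def using CD
      by (intro SUP_upper) (auto simp: C'_def D'_def)
    finally show ?thesis .
  qed
  have ne: "{C \<in> ?S. C \<subseteq> X} \<noteq> {}" for X by blast
  have "pos_variation \<Omega> \<nu> A + ennreal (\<nu> D) \<le> pos_variation \<Omega> \<nu> (A \<union> B)"
    if "D \<in> ?S" "D \<subseteq> B" for D
    unfolding pos_variation_def[of \<Omega> \<nu> A]
    using that le by (subst ennreal_SUP_add_left[symmetric, OF ne]) (auto intro!: SUP_least)
  then show ?thesis
    unfolding pos_variation_def[of \<Omega> \<nu> B]
    by (subst ennreal_SUP_add_right[OF ne]) (auto intro!: SUP_least)
qed

lemma emeasure_pos_part:
  fixes \<mu> :: "(real^2) set \<Rightarrow> real^'d::finite"
  assumes \<mu>: "\<mu> \<in> radon_measures \<Omega>" and A: "A \<in> sets (restrict_space borel \<Omega>)"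
  shows "emeasure (pos_part \<Omega> (\<lambda>A. \<mu> A $ i)) A = pos_variation \<Omega> (\<lambda>A. \<mu> A $ i) A"
proof -
  let ?S = "sets (restrict_space borel \<Omega>)"
  let ?\<nu> = "\<lambda>A. \<mu> A $ i"
  let ?P = "pos_variation \<Omega> ?\<nu>"
  have \<nu>: "(\<lambda>n. ?\<nu> (C n)) sums ?\<nu> (\<Union>n. C n)"
    if "range C \<subseteq> ?S" "disjoint_family C" for C :: "nat \<Rightarrow> (real^2) set"
  proof -
    have "(\<lambda>n. \<mu> (C n)) sums \<mu> (\<Union>n. C n)"
      using \<mu> that unfolding radon_measures_def by blast
    then show ?thesis by (rule bounded_linear.sums[OF bounded_linear_vec_nth])
  qed
  have sa: "sigma_algebra \<Omega> ?S"
    using sets.sigma_algebra_axioms[of "restrict_space borel \<Omega>"]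
    by (simp add: space_restrict_space)
  have empty: "?\<nu> {} = 0"
  proof -
    have "(\<lambda>n::nat. ?\<nu> {}) sums ?\<nu> (\<Union>n::nat. {})"
      by (rule \<nu>) (auto simp: disjoint_family_on_def)
    then have "summable (\<lambda>n::nat. ?\<nu> {})" by (rule sums_summable)
    then show ?thesis by (simp add: summable_const_iff)
  qed
  have pos: "positive ?S ?P"
    unfolding positive_def pos_variation_def
    by (auto simp: empty intro!: antisym SUP_least)
  have mono: "?P X \<le> ?P Y" if "X \<subseteq> Y" for X Y
    unfolding pos_variation_def using that by (intro SUP_subset_mono) auto
  have "countably_additive ?S ?P"
    unfolding countably_additive_def
  proof (intro allI impI antisym)
    fix C :: "nat \<Rightarrow> (real^2) set"
    assume C: "range C \<subseteq> ?S" "disjoint_family C"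
    have fin: "(\<Sum>k<n. ?P (C k)) \<le> ?P (\<Union>k<n. C k)" for n
    proof (induction n)
      case (Suc n)
      have "(\<Union>k<n. C k) \<inter> C n = {}"
      proof -
        have "C k \<inter> C n = {}" if "k < n" for k
          using that by (intro disjoint_family_onD[OF C(2)]) auto
        then show ?thesis by blast
      qed
      then have *: "?P (\<Union>k<n. C k) + ?P (C n) \<le> ?P ((\<Union>k<n. C k) \<union> C n)"
        by (rule pos_variation_disjoint_le[OF \<nu>, rotated 2])
      have "(\<Sum>k<Suc n. ?P (C k)) \<le> ?P (\<Union>k<n. C k) + ?P (C n)"
        unfolding sum.lessThan_Suc by (rule add_right_mono[OF Suc])
      also note *
      also have "(\<Union>k<n. C k) \<union> C n = (\<Union>k<Suc n. C k)"
        unfolding lessThan_Suc by blast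
      finally show ?case .
    next
      case 0
      then show ?case by simp
    qed
    have "(\<Sum>k<n. ?P (C k)) \<le> ?P (\<Union>k. C k)" for n
      by (rule order_trans[OF fin mono]) auto
    then show "(\<Sum>n. ?P (C n)) \<le> ?P (\<Union>n. C n)"
      by (intro suminf_le_const) auto
    show "?P (\<Union>n. C n) \<le> (\<Sum>n. ?P (C n))"
      unfolding pos_variation_def[of \<Omega> ?\<nu> "\<Union>n. C n"]
    proof (intro SUP_least)
      fix B assume B: "B \<in> {B \<in> ?S. B \<subseteq> (\<Union>n. C n)}"
      have "(\<lambda>n. ?\<nu> (B \<inter> C n)) sums ?\<nu> (\<Union>n. B \<inter> C n)"
        using B C by (intro \<nu>) (auto simp: disjoint_family_on_def)
      moreover have "(\<Union>n. B \<inter> C n) = B" using B by auto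
      ultimately have "(\<lambda>n. \<Sum>k<n. ?\<nu> (B \<inter> C k)) \<longlonglongrightarrow> ?\<nu> B" by (simp add: sums_def)
      then have lim: "(\<lambda>n. ennreal (\<Sum>k<n. ?\<nu> (B \<inter> C k))) \<longlonglongrightarrow> ennreal (?\<nu> B)"
        by (intro tendsto_ennrealI)
      have "ennreal (\<Sum>k<n. ?\<nu> (B \<inter> C k)) \<le> (\<Sum>n. ?P (C n))" for n
      proof -
        have "ennreal (\<Sum>k<n. ?\<nu> (B \<inter> C k)) \<le> ennreal (\<Sum>k<n. max 0 (?\<nu> (B \<inter> C k)))"
          by (intro ennreal_leI sum_mono) auto
        also have "\<dots> = (\<Sum>k<n. ennreal (?\<nu> (B \<inter> C k)))"
        proof -
          have "ennreal (max 0 x) = ennreal x" for x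
            by (cases "0 \<le> x") (auto simp: max_def ennreal_neg)
          then show ?thesis by (simp flip: sum_ennreal)
        qed
        also have "\<dots> \<le> (\<Sum>k<n. ?P (C k))"
          unfolding pos_variation_def using B C(1) by (intro sum_mono SUP_upper) auto
        also have "\<dots> \<le> (\<Sum>n. ?P (C n))" by (intro sum_le_suminf) auto
        finally show ?thesis .
      qed
      with lim show "ennreal (?\<nu> B) \<le> (\<Sum>n. ?P (C n))"
        by (intro LIMSEQ_le_const2) auto
    qed
  qed
  with pos sa A show ?thesis
    unfolding pos_part_def by (intro emeasure_measure_of_sigma)
qed

definition signed_integral ::
    "(real^2) set \<Rightarrow> ((real^2) set \<Rightarrow> real) \<Rightarrow> (real^2 \<Rightarrow> real) \<Rightarrow> real" where
  "signed_integral \<Omega> \<nu> f =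
     (\<integral>x. f x \<partial>(pos_part \<Omega> \<nu>)) - (\<integral>x. f x \<partial>(pos_part \<Omega> (\<lambda>A. - \<nu> A)))"

definition C0_functions :: "(real^2) set \<Rightarrow> (real^2 \<Rightarrow> real^'d::finite) set" where
  "C0_functions \<Omega> =
     {\<phi>. continuous_on \<Omega> \<phi> \<and> (\<forall>\<epsilon>>0. compact {x \<in> \<Omega>. \<epsilon> \<le> norm (\<phi> x)})}"

definition dual_norm :: "(real^2) set \<Rightarrow> ((real^2) set \<Rightarrow> real^'d::finite) \<Rightarrow> ereal" where
  "dual_norm \<Omega> \<mu> =
     (SUP \<phi> \<in> {\<phi> \<in> C0_functions \<Omega>. \<forall>x\<in>\<Omega>. norm (\<phi> x) \<le> 1}.
        ereal (\<Sum>i\<in>UNIV. signed_integral \<Omega> (\<lambda>A. \<mu> A $ i) (\<lambda>x. \<phi> x $ i)))"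

definition measure_distr ::
    "(real^2) set \<Rightarrow> ((real^2) set \<Rightarrow> real^'d::finite) \<Rightarrow> 'd vector_distribution" where
  "measure_distr \<Omega> \<mu> \<phi> = (\<chi> i. signed_integral \<Omega> (\<lambda>A. \<mu> A $ i) \<phi>)"

text \<open>The norm of a distribution: at most one finite Radon measure represents it, so the infimum
  is the norm of that measure if it exists and, as an infimum over the empty set, \<open>\<infinity>\<close>
  otherwise.\<close>

definition radon_norm :: "(real^2) set \<Rightarrow> 'd::finite vector_distribution \<Rightarrow> ereal" where
  "radon_norm \<Omega> T =
     (INF \<mu> \<in> {\<mu> \<in> radon_measures \<Omega>. distr_eq \<Omega> T (measure_distr \<Omega> \<mu>)}. dual_norm \<Omega> \<mu>)"

section \<open>Lebesgue spaces and functions of bounded variation\<close>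

text \<open>Elements of \<open>L\<^sup>p(\<Omega>)\<close> are represented by functions; all functionals below are invariant under
  changes on null sets.\<close>

definition Lp :: "real \<Rightarrow> (real^2) set \<Rightarrow> (real^2 \<Rightarrow> real) set" where
  "Lp p \<Omega> = {u \<in> borel_measurable (lebesgue_on \<Omega>).
     integrable (lebesgue_on \<Omega>) (\<lambda>x. \<bar>u x\<bar> powr p)}"

definition Lp_dist :: "real \<Rightarrow> (real^2) set \<Rightarrow> (real^2 \<Rightarrow> real) \<Rightarrow> (real^2 \<Rightarrow> real) \<Rightarrow> real" where
  "Lp_dist p \<Omega> u v = (\<integral>x. \<bar>u x - v x\<bar> powr p \<partial>(lebesgue_on \<Omega>)) powr (1 / p)"

definition BV :: "(real^2) set \<Rightarrow> (real^2 \<Rightarrow> real) set" where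
  "BV \<Omega> = {u \<in> Lp 1 \<Omega>. \<exists>\<mu>\<in>radon_measures \<Omega>. distr_eq \<Omega> (grad \<Omega> u) (measure_distr \<Omega> \<mu>)}"

definition extend_BV ::
    "(real^2) set \<Rightarrow> ((real^2 \<Rightarrow> real) \<Rightarrow> ereal) \<Rightarrow> (real^2 \<Rightarrow> real) \<Rightarrow> ereal" where
  "extend_BV \<Omega> F u = (if u \<in> BV \<Omega> then F u else \<infinity>)"


section \<open>The functionals and \<open>\<Gamma>\<close>-convergence\<close>

definition R_functional :: "(real^2) set \<Rightarrow> real^4 \<Rightarrow> (real^2 \<Rightarrow> real) \<Rightarrow> ereal" where
  "R_functional \<Omega> b u =
     (INF w \<in> radon_measures \<Omega>.
        radon_norm \<Omega> (\<lambda>\<phi>. grad \<Omega> u \<phi> - measure_distr \<Omega> w \<phi>)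
        + radon_norm \<Omega> (\<lambda>\<phi>. diag b *v nabla_N (measure_distr \<Omega> w) \<phi>))"

definition TV_functional :: "(real^2) set \<Rightarrow> real^4^4 \<Rightarrow> (real^2 \<Rightarrow> real) \<Rightarrow> ereal" where
  "TV_functional \<Omega> B u =
     (INF w \<in> {w \<in> radon_measures \<Omega>.
                 distr_eq \<Omega> (\<lambda>\<phi>. B *v nabla_N (measure_distr \<Omega> w) \<phi>) (\<lambda>_. 0)}.
        radon_norm \<Omega> (\<lambda>\<phi>. grad \<Omega> u \<phi> - measure_distr \<Omega> w \<phi>))"

definition Gamma_converges_seq ::
    "'a set \<Rightarrow> ('a \<Rightarrow> 'a \<Rightarrow> real) \<Rightarrow> (nat \<Rightarrow> 'a \<Rightarrow> ereal) \<Rightarrow> ('a \<Rightarrow> ereal) \<Rightarrow> bool" where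
  "Gamma_converges_seq X d F G \<longleftrightarrow>
    (\<forall>x\<in>X.
      (\<forall>y. range y \<subseteq> X \<longrightarrow> (\<lambda>n. d (y n) x) \<longlonglongrightarrow> 0 \<longrightarrow> G x \<le> liminf (\<lambda>n. F n (y n))) \<and>
      (\<exists>y. range y \<subseteq> X \<and> (\<lambda>n. d (y n) x) \<longlonglongrightarrow> 0 \<and> limsup (\<lambda>n. F n (y n)) \<le> G x))"

text \<open>Convergence of a family indexed by \<open>t > 0\<close> as \<open>t \<rightarrow> \<infinity>\<close> means convergence along every sequence
  of parameters tending to \<open>\<infinity>\<close>.\<close>

definition Gamma_converges_at_top ::
    "'a set \<Rightarrow> ('a \<Rightarrow> 'a \<Rightarrow> real) \<Rightarrow> (real \<Rightarrow> 'a \<Rightarrow> ereal) \<Rightarrow> ('a \<Rightarrow> ereal) \<Rightarrow> bool" where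
  "Gamma_converges_at_top X d F G \<longleftrightarrow>
    (\<forall>t::nat \<Rightarrow> real. (\<forall>n. 0 < t n) \<longrightarrow> filterlim t at_top sequentially \<longrightarrow>
       Gamma_converges_seq X d (\<lambda>n. F (t n)) G)"

end

theory Submission
  imports Defs "HOL-Probability.Probability"
begin

text \<open>The upper bound is witnessed by the constant sequence: every \<open>w\<close> that competes in
\<open>TV_functional\<close> makes the second term of \<open>R_functional\<close> vanish, whatever the parameter \<open>t\<close>.

For the lower bound let \<open>u\<^sub>n \<rightarrow> u\<close> in \<open>L\<^sup>p\<close> with energies below \<open>c\<close> along a subsequence, and let
\<open>w\<^sub>n\<close> be almost optimal. The residuals \<open>\<mu>\<^sub>n = \<nabla>u\<^sub>n - w\<^sub>n\<close> are then measures of norm at most \<open>c\<close>,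
so a subsequence converges weakly to a measure \<open>\<mu>\<close> of norm at most \<open>c\<close>. As \<open>\<nabla>u\<^sub>n\<close> converges to
\<open>\<nabla>u\<close> as a distribution, so does \<open>w\<^sub>n\<close> to \<open>T = \<nabla>u - \<mu>\<close>. The penalty forces \<open>B \<nabla>\<^sub>N w\<^sub>n\<close> to be of
order \<open>1/t\<^sub>n\<close>, hence \<open>B \<nabla>\<^sub>N T = 0\<close>, where \<open>B\<close> is the diagonal matrix of the weights. It remains
to see that the distribution \<open>T\<close> is a finite measure. Any three of the four components of \<open>\<nabla>\<^sub>N\<close>,
differentiated once more, determine all second derivatives of \<open>T\<close>, which therefore vanish
(\<open>kernel_second_derivatives\<close>). On a connected open set \<open>T\<close> is then an affine vector field
(\<open>affine_functional\<close>), which is a finite measure because \<open>\<Omega>\<close> is bounded. So \<open>T\<close> competes in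
\<open>TV_functional\<close> with value at most \<open>c\<close>, and \<open>\<nabla>u = T + \<mu>\<close> shows that \<open>u\<close> is of bounded variation
(\<open>limit_of_decompositions\<close>).

Two tools carry this argument. The first is that a linear functional on test functions which
annihilates all derivatives is a multiple of the integral (\<open>gradient_free_functional\<close>): on a
box, a test function equals a multiple of a fixed bump up to derivatives of test functions,
obtained by integrating along coordinate lines; boxes are glued by connectedness and smooth
cutoffs.

The second is weak compactness of bounded sequences of measures
(\<open>radon_measures_weak_compactness\<close>). It is reduced to Helly's theorem on the real line: a
plane-filling curve \<open>g\<close> that covers \<open>\<Omega>\<close> has a Borel right inverse \<open>s\<close>; positive measures on \<open>\<Omega>\<close>
are carried to \<open>[0,1]\<close> by \<open>s\<close>, a weak limit is taken there, and \<open>g\<close> carries it back. Since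
\<open>g \<circ> s\<close> is the identity and \<open>f \<circ> g\<close> is continuous for continuous \<open>f\<close>, integrals are preserved in
both directions. Signed and vector measures follow through the Jordan decomposition of their
components.\<close>

section \<open>Smooth functions on the plane\<close>

lemma partial_has_derivative: "(f has_derivative D) (at x) \<Longrightarrow> partial j f x = D (axis j 1)"
  by (metis frechet_derivative_at partial_def)

lemma has_derivative_partials:
  fixes f :: "real^2 \<Rightarrow> real"
  assumes "f differentiable (at x)"
  shows "(f has_derivative (\<lambda>h. \<Sum>j\<in>UNIV. h $ j * partial j f x)) (at x)"
proof -
  let ?D = "frechet_derivative f (at x)"
  have D: "(f has_derivative ?D) (at x)" using assms by (simp add: frechet_derivative_works)
  then have lin: "linear ?D" by (simp add: has_derivative_linear)
  have "?D h = (\<Sum>j\<in>UNIV. h $ j * partial j f x)" for h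
  proof -
    have "?D h = ?D (\<Sum>j\<in>UNIV. h $ j *\<^sub>R axis j 1)" 
      by (simp add: basis_expansion flip: scalar_mult_eq_scaleR)
    also have "\<dots> = (\<Sum>j\<in>UNIV. h $ j * partial j f x)"
      using lin by (simp add: linear_sum linear_cmul partial_def)
    finally show ?thesis .
  qed
  then have "?D = (\<lambda>h. \<Sum>j\<in>UNIV. h $ j * partial j f x)" by blast
  then show ?thesis using D by metis
qed

lemma C_k_Suc_imp: "C_k (Suc k) f \<Longrightarrow> C_k k f"
proof (induction k arbitrary: f)
  case 0
  then show ?case
    by (auto simp: continuous_on_eq_continuous_within intro: differentiable_imp_continuous_within)
next
  case (Suc k)
  then show ?case by auto
qed

lemma partial_const: "partial j (\<lambda>x. c) = (\<lambda>x. 0)"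
  by (rule ext) (rule partial_has_derivative, auto)

lemma C_k_const: "C_k k (\<lambda>x. c)"
  by (induction k arbitrary: c) (auto simp: partial_const)

lemma partial_add:
  assumes "\<forall>x. f differentiable (at x)" "\<forall>x. g differentiable (at x)"
  shows "partial j (\<lambda>x. f x + g x) = (\<lambda>x. partial j f x + partial j g x)"
  by (rule ext, subst partial_has_derivative[OF has_derivative_add])
     (use assms in \<open>auto simp: partial_def frechet_derivative_works\<close>)

lemma partial_mult:
  assumes "\<forall>x. f differentiable (at x)" "\<forall>x. g differentiable (at x)"
  shows "partial j (\<lambda>x. f x * g x) = (\<lambda>x. f x * partial j g x + partial j f x * g x)"
  by (rule ext, subst partial_has_derivative[OF has_derivative_mult])
     (use assms in \<open>auto simp: partial_def frechet_derivative_works\<close>)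

lemma C_k_add: "C_k k f \<Longrightarrow> C_k k g \<Longrightarrow> C_k k (\<lambda>x. f x + g x)"
  by (induction k arbitrary: f g) (auto simp: partial_add intro!: continuous_intros)

lemma C_k_mult: "C_k k f \<Longrightarrow> C_k k g \<Longrightarrow> C_k k (\<lambda>x. f x * g x)"
proof (induction k arbitrary: f g)
  case (Suc k)
  then show ?case
    using C_k_Suc_imp[OF Suc.prems(1)] C_k_Suc_imp[OF Suc.prems(2)]
    by (auto simp: partial_mult intro!: C_k_add Suc.IH)
qed (auto intro!: continuous_intros)

lemma C_k_cmult: "C_k k f \<Longrightarrow> C_k k (\<lambda>x. c * f x)"
  by (intro C_k_mult C_k_const)

lemma C_k_diff: "C_k k f \<Longrightarrow> C_k k g \<Longrightarrow> C_k k (\<lambda>x. f x - g x)"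
  using C_k_add[OF _ C_k_cmult[of k g "-1"], of f] by simp

lemma C_k_inverse: "C_k k f \<Longrightarrow> (\<And>x. f x \<noteq> 0) \<Longrightarrow> C_k k (\<lambda>x. inverse (f x))"
proof (induction k arbitrary: f)
  case (Suc k)
  have P: "partial j (\<lambda>x. inverse (f x)) = (\<lambda>x. - 1 * (inverse (f x) * (partial j f x * inverse (f x))))" for j
    by (rule ext, subst partial_has_derivative[OF Deriv.has_derivative_inverse])
       (use Suc.prems in \<open>auto simp: partial_def frechet_derivative_works\<close>)
  have "C_k k (partial j f)" for j using Suc.prems by simp
  then show ?case using Suc.IH[OF C_k_Suc_imp[OF Suc.prems(1)] Suc.prems(2)] Suc.prems
    unfolding C_k.simps P by (intro conjI allI C_k_cmult C_k_mult differentiable_inverse) auto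
qed (auto intro!: continuous_intros)

definition smooth :: "(real^2 \<Rightarrow> real) \<Rightarrow> bool" where
  "smooth f \<longleftrightarrow> (\<forall>k. C_k k f)"

lemma smooth_const: "smooth (\<lambda>x. c)" by (simp add: smooth_def C_k_const)
lemma smooth_add: "smooth f \<Longrightarrow> smooth g \<Longrightarrow> smooth (\<lambda>x. f x + g x)" by (simp add: smooth_def C_k_add)
lemma smooth_diff: "smooth f \<Longrightarrow> smooth g \<Longrightarrow> smooth (\<lambda>x. f x - g x)" by (simp add: smooth_def C_k_diff)
lemma smooth_mult: "smooth f \<Longrightarrow> smooth g \<Longrightarrow> smooth (\<lambda>x. f x * g x)" by (simp add: smooth_def C_k_mult)
lemma smooth_inverse: "smooth f \<Longrightarrow> (\<And>x. f x \<noteq> 0) \<Longrightarrow> smooth (\<lambda>x. inverse (f x))"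
  by (simp add: smooth_def C_k_inverse)
lemma smooth_partial: "smooth f \<Longrightarrow> smooth (partial j f)"
  unfolding smooth_def using C_k.simps(2) by blast
lemma smooth_differentiable: "smooth f \<Longrightarrow> f differentiable (at x)"
  unfolding smooth_def using C_k.simps(2) by blast
lemma smooth_continuous: "smooth f \<Longrightarrow> continuous_on S f"
  unfolding smooth_def using C_k.simps(1) continuous_on_subset by blast

text \<open>Smoothness speaks about all orders at once, and derivatives of a function often leave its
syntactic form. It is therefore shown by exhibiting a class of functions that is closed under
partial derivatives.\<close>

lemma smooth_coinduct:
  assumes "F f" and step: "\<And>g. F g \<Longrightarrow> (\<forall>x. g differentiable (at x)) \<and> (\<forall>j. F (partial j g))"
  shows "smooth f"
proof -
  have "C_k k g" if "F g" for k g
    using that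
  proof (induction k arbitrary: g)
    case 0
    then show ?case using step[OF 0]
      by (auto simp: continuous_on_eq_continuous_within intro: differentiable_imp_continuous_within)
  qed (use step in auto)
  then show ?thesis using assms(1) by (auto simp: smooth_def)
qed

lemma smooth_coordinate: 
  "smooth (\<lambda>x. x $ i)"
proof -
  have P: "partial j (\<lambda>x. x $ i) = (\<lambda>x. axis j 1 $ i)" for j
    by (rule ext, rule partial_has_derivative) (auto intro!: derivative_eq_intros bounded_linear.has_derivative[OF bounded_linear_vec_nth])
  show ?thesis
    by (rule smooth_coinduct[where F="\<lambda>g. g = (\<lambda>x. x $ i) \<or> (\<exists>c. g = (\<lambda>x. c))"])
       (auto simp: P partial_const bounded_linear_vec_nth bounded_linear_imp_differentiable)
qed

text \<open>flat_fun functions\<close>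

text \<open>The derivatives of \<open>exp (-1/x)\<close>, extended by \<open>0\<close> to \<open>x \<le> 0\<close>, are of the form
\<open>P (1/x) exp (-1/x)\<close> with a polynomial \<open>P\<close>; with \<open>P\<close> as parameter the family is closed under
derivatives.\<close>

definition flat_fun :: "real poly \<Rightarrow> real \<Rightarrow> real" where
  "flat_fun P x = (if 0 < x then poly P (1 / x) * exp (- (1 / x)) else 0)"

lemma flat_tendsto: "((\<lambda>x. poly P (1 / x) * exp (- (1 / x))) \<longlongrightarrow> 0) (at_right (0::real))"
proof -
  have "((\<lambda>y. \<Sum>i\<le>degree P. coeff P i * (y ^ i / exp y)) \<longlongrightarrow> (\<Sum>i\<le>degree P. coeff P i * 0)) (at_top :: real filter)"
    by (intro tendsto_intros tendsto_power_div_exp_0)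
  moreover have "(\<lambda>y. \<Sum>i\<le>degree P. coeff P i * (y ^ i / exp y)) = (\<lambda>y. poly P y * exp (- y))"
    by (auto simp: poly_altdef exp_minus field_simps sum_divide_distrib sum_distrib_left)
  ultimately have "((\<lambda>y. poly P y * exp (- y)) \<longlongrightarrow> 0) at_top" by simp
  from filterlim_compose[OF this filterlim_inverse_at_top_right]
  show ?thesis by (simp add: inverse_eq_divide)
qed

text \<open>For \<open>y = 1/x\<close> one has \<open>dy/dx = -y\<^sup>2\<close>, so \<open>P\<close> turns into \<open>y\<^sup>2 (P - P')\<close>.\<close>

lemma flat_deriv: "(flat_fun P has_real_derivative flat_fun ([:0,0,1:] * (P - pderiv P)) x) (at x)"
proof -
  consider "x > 0" | "x < 0" | "x = 0" by linarith
  then show ?thesis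
  proof cases
    case 1
    have "((\<lambda>x. poly P (1 / x) * exp (- (1 / x))) has_real_derivative flat_fun ([:0,0,1:] * (P - pderiv P)) x) (at x)"
      using 1 by (auto intro!: derivative_eq_intros DERIV_chain2[OF poly_DERIV] simp: flat_fun_def field_simps power2_eq_square)
    moreover have "eventually (\<lambda>y. flat_fun P y = poly P (1 / y) * exp (- (1 / y))) (nhds x)"
      using eventually_nhds_in_open[of "{0<..}" x] 1 by (auto elim!: eventually_mono simp: flat_fun_def)
    ultimately show ?thesis
      by (rule DERIV_cong_ev[OF refl _ refl, THEN iffD2, rotated])
  next
    case 2
    have "eventually (\<lambda>y. flat_fun P y = 0) (nhds x)"
      using eventually_nhds_in_open[of "{..<0}" x] 2 by (auto elim!: eventually_mono simp: flat_fun_def)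
    then have "(flat_fun P has_real_derivative 0) (at x)"
      by (rule DERIV_cong_ev[OF refl _ refl, THEN iffD2]) simp
    then show ?thesis using 2 by (simp add: flat_fun_def)
  next
    case 3
    have r: "((\<lambda>y. flat_fun P y / y) \<longlongrightarrow> 0) (at_right 0)"
      using flat_tendsto[of "[:0,1:] * P"]
      by (rule Lim_transform_eventually) (auto simp: eventually_at_filter flat_fun_def)
    have l: "((\<lambda>y. flat_fun P y / y) \<longlongrightarrow> 0) (at_left 0)"
      by (rule Lim_transform_eventually[of "\<lambda>_. 0"]) (auto simp: eventually_at_filter flat_fun_def)
    show ?thesis using filterlim_split_at[OF l r] 3
      by (simp add: has_field_derivative_iff flat_fun_def)
  qed
qed

lemma smooth_flat: "smooth (\<lambda>x. flat_fun P (a * x $ j + b))"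
proof -
  have D: "((\<lambda>x. c * flat_fun P (a * x $ j + b)) has_derivative (\<lambda>h. c * (flat_fun ([:0,0,1:] * (P - pderiv P)) (a * x $ j + b) * (a * h $ j)))) (at x)" for x::"real^2" and P c
    by (intro has_derivative_mult_right has_derivative_compose[of "\<lambda>x. a * x $ j + b" _ x, OF _ flat_deriv[THEN has_field_derivative_imp_has_derivative]])
       (auto intro!: derivative_eq_intros bounded_linear.has_derivative[OF bounded_linear_vec_nth])
  have P: "partial i (\<lambda>x. c * flat_fun P (a * x $ j + b)) = (\<lambda>x. (c * a * axis i 1 $ j) * flat_fun ([:0,0,1:] * (P - pderiv P)) (a * x $ j + b))" for i c P
    by (rule ext, subst partial_has_derivative[OF D]) simp
  show ?thesis
  proof (rule smooth_coinduct[where F="\<lambda>g. \<exists>P c. g = (\<lambda>x. c * flat_fun P (a * x $ j + b))"])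
    show "\<exists>Q c. (\<lambda>x. flat_fun P (a * x $ j + b)) = (\<lambda>x. c * flat_fun Q (a * x $ j + b))"
      by (intro exI[of _ P] exI[of _ 1]) simp
  next
    fix g :: "real^2 \<Rightarrow> real"
    assume "\<exists>P c. g = (\<lambda>x. c * flat_fun P (a * x $ j + b))"
    then obtain P c where g: "g = (\<lambda>x. c * flat_fun P (a * x $ j + b))" by blast
    have "\<exists>Q c'. partial i g = (\<lambda>x. c' * flat_fun Q (a * x $ j + b))" for i
      unfolding g P[of i c P] by (intro exI) (rule refl)
    moreover have "g differentiable at x" for x
      unfolding g differentiable_def by (intro exI) (rule D)
    ultimately show "(\<forall>x. g differentiable at x) \<and> (\<forall>i. \<exists>P c. partial i g = (\<lambda>x. c * flat_fun P (a * x $ j + b)))"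
      by blast
  qed
qed

section \<open>Integration along coordinate lines\<close>

text \<open>With \<open>S = {..0}\<close> this is the antiderivative of \<open>g\<close> in direction \<open>j\<close> that vanishes far to
the left, and with \<open>S = UNIV\<close> the integral over the whole line. Integrating over shifts, and not
up to the coordinate of \<open>x\<close>, makes both commute with all partial derivatives.\<close>

definition line_integral :: "real set \<Rightarrow> 2 \<Rightarrow> (real^2 \<Rightarrow> real) \<Rightarrow> real^2 \<Rightarrow> real" where
  "line_integral S j g x = integral S (\<lambda>s. g (x + s *\<^sub>R axis j 1))"

text \<open>Vanishing outside a slab suffices for integrals over lines in direction \<open>j\<close>; unlike
compactness of the support it survives integration along the other coordinate.\<close>

definition slab_supported :: "real \<Rightarrow> 2 \<Rightarrow> (real^2 \<Rightarrow> real) \<Rightarrow> bool" where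
  "slab_supported R j g \<longleftrightarrow> (\<forall>x. R < \<bar>x $ j\<bar> \<longrightarrow> g x = 0)"

lemma line_integral_bounded:
  assumes g: "slab_supported R j g" and S: "S = {..0} \<or> S = UNIV" and M: "\<bar>x $ j\<bar> \<le> M"
  shows "line_integral S j g x
    = integral (cbox (- (M + R)) (if S = UNIV then M + R else 0)) (\<lambda>s. g (x + s *\<^sub>R axis j 1))"
proof -
  have z: "g (x + s *\<^sub>R axis j 1) = 0" if "\<bar>s\<bar> > M + R" for s
    using g M that by (auto simp: slab_supported_def)
  have "(if s \<in> S then g (x + s *\<^sub>R axis j 1) else 0) =
      (if s \<in> cbox (- (M + R)) (if S = UNIV then M + R else 0) then g (x + s *\<^sub>R axis j 1) else 0)" for s
    using S z[of s] by (auto simp: not_le)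
  then have "integral UNIV (\<lambda>s. if s \<in> S then g (x + s *\<^sub>R axis j 1) else 0) =
      integral UNIV (\<lambda>s. if s \<in> cbox (- (M + R)) (if S = UNIV then M + R else 0) then g (x + s *\<^sub>R axis j 1) else 0)"
    by (rule arg_cong[OF ext])
  then show ?thesis
    unfolding line_integral_def integral_restrict_UNIV .
qed

lemma partial_slab_supported:
  assumes g: "slab_supported R j g"
  shows "slab_supported R j (partial i g)"
  unfolding slab_supported_def
proof (intro allI impI)
  fix x :: "real^2" assume x: "R < \<bar>x $ j\<bar>"
  have "open {y :: real^2. R < \<bar>y $ j\<bar>}" by (intro open_Collect_less continuous_intros)
  then have ev: "eventually (\<lambda>y. 0 = g y) (nhds x)"
    using eventually_nhds_in_open[of "{y. R < \<bar>y $ j\<bar>}" x] x g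
    by (auto elim!: eventually_mono simp: slab_supported_def)
  have "(g has_derivative (\<lambda>_. 0)) (at x)"
    by (rule has_derivative_transform_eventually[OF has_derivative_const[of 0] eventually_at_filter[THEN iffD2, OF eventually_mono[OF ev]]])
      (use x g in \<open>auto simp: slab_supported_def\<close>)
  then show "partial i g x = 0" by (rule partial_has_derivative)
qed

text \<open>Near a given point the line integral extends over a fixed compact interval, so that
differentiation under the integral sign applies.\<close>

lemma has_derivative_line_integral:
  assumes g: "smooth g" "slab_supported R j g" and S: "S = {..0} \<or> S = UNIV"
  shows "(line_integral S j g has_derivative (\<lambda>h. \<Sum>i\<in>UNIV. h $ i * line_integral S j (partial i g) x)) (at x)"
proof -
  define M where "M = \<bar>x $ j\<bar> + 1"
  define b where "b = (if S = UNIV then M + R else 0)"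
  let ?e = "axis j 1 :: real^2"
  let ?C = "cbox (- (M + R)) b"
  define D where "D y s = (\<Sum>i\<in>UNIV. partial i g (y + s *\<^sub>R ?e) *\<^sub>R blinfun_inner_left (axis i 1 :: real^2))" for y s
  have B: "blinfun_apply (\<Sum>i\<in>UNIV. c i *\<^sub>R blinfun_inner_left (axis i 1 :: real^2)) = (\<lambda>h. \<Sum>i\<in>UNIV. h $ i * c i)" for c
    by (rule ext) (simp add: blinfun.sum_left blinfun.scaleR_left inner_axis' inner_axis mult.commute)
  have cont: "continuous_on A (\<lambda>s. h (y + s *\<^sub>R ?e))" if "smooth h" for h y A
    by (intro continuous_on_compose2[OF smooth_continuous[OF that, of UNIV]] continuous_intros) auto
  have "((\<lambda>y. integral ?C (\<lambda>s. g (y + s *\<^sub>R ?e))) has_derivative blinfun_apply (integral ?C (D x))) (at x within UNIV)"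
  proof (rule leibniz_rule)
    fix y s
    have "((\<lambda>y. g (y + s *\<^sub>R ?e)) has_derivative (\<lambda>h. \<Sum>i\<in>UNIV. h $ i * partial i g (y + s *\<^sub>R ?e))) (at y)"
      by (intro has_derivative_compose[of "\<lambda>y. y + s *\<^sub>R ?e" _ y UNIV, OF _ has_derivative_partials] smooth_differentiable g)
        (auto intro!: derivative_eq_intros)
    then show "((\<lambda>y. g (y + s *\<^sub>R ?e)) has_derivative blinfun_apply (D y s)) (at y within UNIV)"
      by (simp add: D_def B)
  next
    show "continuous_on (UNIV \<times> ?C) (\<lambda>(y, s). D y s)"
      unfolding D_def split_beta
      by (intro continuous_intros continuous_on_compose2[OF smooth_continuous[OF smooth_partial[OF g(1)], of UNIV]]) auto
    show "(\<lambda>s. g (y + s *\<^sub>R ?e)) integrable_on ?C" for y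
      by (rule integrable_continuous[OF cont[OF g(1)]])
  qed auto
  moreover have "integral ?C (D x) = (\<Sum>i\<in>UNIV. integral ?C (\<lambda>s. partial i g (x + s *\<^sub>R ?e)) *\<^sub>R blinfun_inner_left (axis i 1))"
    unfolding D_def
    by (intro integral_unique has_integral_sum has_integral_scaleR_left integrable_integral integrable_continuous cont smooth_partial g) auto
  moreover have "integral ?C (\<lambda>s. partial i g (x + s *\<^sub>R ?e)) = line_integral S j (partial i g) x" for i
    using line_integral_bounded[OF partial_slab_supported[OF g(2)] S, of x M i] by (simp add: M_def b_def)
  ultimately have *: "((\<lambda>y. integral ?C (\<lambda>s. g (y + s *\<^sub>R ?e))) has_derivative (\<lambda>h. \<Sum>i\<in>UNIV. h $ i * line_integral S j (partial i g) x)) (at x)"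
    by (simp add: B)
  have "open {y :: real^2. \<bar>y $ j\<bar> < M}" by (intro open_Collect_less continuous_intros)
  then show ?thesis
    by (rule has_derivative_transform_within_open[OF *])
       (auto simp: M_def line_integral_bounded[OF g(2) S, of _ M] b_def intro!: line_integral_bounded[OF g(2) S, of _ M, symmetric])
qed

lemma partial_line_integral:
  assumes g: "smooth g" "slab_supported R j g" and S: "S = {..0} \<or> S = UNIV"
  shows "partial i (line_integral S j g) = line_integral S j (partial i g)"
  by (rule ext, subst partial_has_derivative[OF has_derivative_line_integral[OF assms]])
    (simp add: axis_def if_distrib if_distribR cong: if_cong)

lemma smooth_line_integral:
  assumes g: "smooth g" "slab_supported R j g" and S: "S = {..0} \<or> S = UNIV"
  shows "smooth (line_integral S j g)"
proof (rule smooth_coinduct[where F="\<lambda>h. \<exists>g. smooth g \<and> slab_supported R j g \<and> h = line_integral S j g"])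
  fix h assume "\<exists>g. smooth g \<and> slab_supported R j g \<and> h = line_integral S j g"
  then show "(\<forall>x. h differentiable at x) \<and> (\<forall>i. \<exists>g. smooth g \<and> slab_supported R j g \<and> partial i h = line_integral S j g)"
    using has_derivative_line_integral[OF _ _ S] partial_line_integral[OF _ _ S] smooth_partial partial_slab_supported 
    unfolding differentiable_def by blast
qed (use g in blast)

lemma line_has_vector_derivative:
  assumes "smooth g"
  shows "((\<lambda>s. g (x + s *\<^sub>R axis j 1)) has_vector_derivative partial j g (x + s *\<^sub>R axis j 1)) (at s within A)"
proof -
  have "((\<lambda>s. g (x + s *\<^sub>R axis j 1)) has_derivative (\<lambda>h. \<Sum>i\<in>UNIV. (h *\<^sub>R axis j 1 :: real^2) $ i * partial i g (x + s *\<^sub>R axis j 1))) (at s within A)"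
      by (intro has_derivative_compose[of "\<lambda>s. x + s *\<^sub>R axis j 1" _ s A, OF _ has_derivative_partials] smooth_differentiable assms)
        (auto intro!: derivative_eq_intros)
  then show ?thesis
    by (simp add: has_vector_derivative_def axis_def if_distrib if_distribR cong: if_cong)
qed

text \<open>The fundamental theorem of calculus on a line, with no boundary term at infinity.\<close>

lemma line_integral_partial:
  assumes g: "smooth g" "slab_supported R j g"
  shows "line_integral {..0} j (partial j g) = g"
    and "line_integral UNIV j (partial j g) = (\<lambda>x. 0)"
proof -
  have z: "g y = 0" if "\<bar>y $ j\<bar> > R" for y using g that by (auto simp: slab_supported_def)
  have I: "integral (cbox (- L) b) (\<lambda>s. partial j g (x + s *\<^sub>R axis j 1)) = g (x + b *\<^sub>R axis j 1) - g (x - L *\<^sub>R axis j 1)"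
    if "- L \<le> b" for x L b
  proof -
    have "((\<lambda>s. partial j g (x + s *\<^sub>R axis j 1)) has_integral g (x + b *\<^sub>R axis j 1) - g (x + (- L) *\<^sub>R axis j 1)) {- L..b}"
      by (intro fundamental_theorem_of_calculus that line_has_vector_derivative g)
    then show ?thesis by (simp add: integral_unique)
  qed
  show "line_integral {..0} j (partial j g) = g"
  proof
    fix x
    define M where "M = \<bar>x $ j\<bar> + \<bar>R\<bar> + 1"
    have "line_integral {..0} j (partial j g) x = g x - g (x - (M + R) *\<^sub>R axis j 1)"
      using line_integral_bounded[OF partial_slab_supported[OF g(2)], of "{..0}" x M j] I[of "M + R" 0 x]
      by (auto simp: M_def)
    moreover have "g (x - (M + R) *\<^sub>R axis j 1) = 0"
      by (intro z) (auto simp: M_def)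
    ultimately show "line_integral {..0} j (partial j g) x = g x" by simp
  qed
  show "line_integral UNIV j (partial j g) = (\<lambda>x. 0)"
  proof
    fix x
    define M where "M = \<bar>x $ j\<bar> + \<bar>R\<bar> + 1"
    have "line_integral UNIV j (partial j g) x = g (x + (M + R) *\<^sub>R axis j 1) - g (x - (M + R) *\<^sub>R axis j 1)"
      using line_integral_bounded[OF partial_slab_supported[OF g(2)], of UNIV x M j] I[of "M + R" "M + R" x]
      by (auto simp: M_def)
    moreover have "g (x - (M + R) *\<^sub>R axis j 1) = 0" "g (x + (M + R) *\<^sub>R axis j 1) = 0"
      by (intro z; simp add: M_def)+
    ultimately show "line_integral UNIV j (partial j g) x = 0" by simp
  qed
qed

text \<open>Schwarz's theorem: writing \<open>g\<close> as a line integral of \<open>partial j g\<close>, one may pull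
\<open>partial i\<close> and then \<open>partial j\<close> under the integral, where the fundamental theorem of calculus
removes the last derivative again.\<close>

lemma partial_commute:
  assumes g: "smooth g" "slab_supported R j g"
  shows "partial j (partial i g) = partial i (partial j g)"
proof -
  have "partial j (partial i g) = partial j (partial i (line_integral {..0} j (partial j g)))"
    by (simp add: line_integral_partial[OF g])
  also have "\<dots> = partial j (line_integral {..0} j (partial i (partial j g)))"
    by (subst partial_line_integral[OF smooth_partial[OF g(1)] partial_slab_supported[OF g(2)]]) auto
  also have "\<dots> = line_integral {..0} j (partial j (partial i (partial j g)))"
    by (rule partial_line_integral[OF smooth_partial[OF smooth_partial[OF g(1)]] partial_slab_supported[OF partial_slab_supported[OF g(2)]]]) auto
  also have "\<dots> = partial i (partial j g)"
    by (rule line_integral_partial[OF smooth_partial[OF smooth_partial[OF g(1)]] partial_slab_supported[OF partial_slab_supported[OF g(2)]]])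
  finally show ?thesis .
qed

section \<open>Test functions\<close>

lemma integral_eq_integral_UNIV:
  fixes f :: "'a::euclidean_space \<Rightarrow> real"
  assumes "\<And>x. x \<notin> S \<Longrightarrow> f x = 0"
  shows "integral S f = integral UNIV f"
proof -
  have "(\<lambda>x. if x \<in> S then f x else 0) = f" using assms by auto
  then show ?thesis by (simp flip: integral_restrict_UNIV[of S f])
qed

lemma lborel_integral_translate:
  fixes f :: "'a::euclidean_space \<Rightarrow> real"
  assumes "f \<in> borel_measurable borel"
  shows "(\<integral>x. f (c + x) \<partial>lborel) = (\<integral>x. f x \<partial>lborel)"
  using integral_distr[of "(+) c" lborel borel f] assms by (simp add: lborel_distr_plus)

lemma integrable_compact_supported:
  fixes f :: "'a::euclidean_space \<Rightarrow> real"
  assumes "continuous_on UNIV f" "compact K" "\<And>x. x \<notin> K \<Longrightarrow> f x = 0"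
  shows "integrable lborel f"
proof -
  have "(\<lambda>x. indicator K x *\<^sub>R f x) = f" using assms(3) by (intro ext) (auto simp: indicator_def)
  then show ?thesis
    using borel_integrable_compact[OF assms(2) continuous_on_subset[OF assms(1)]] by simp
qed

lemma line_integral_lborel:
  assumes g: "smooth g" "slab_supported R j g"
  shows "line_integral UNIV j g x = (\<integral>s. g (x + s *\<^sub>R axis j 1) \<partial>lborel)"
  unfolding line_integral_def
proof (intro integral_lborel integrable_compact_supported[where K="cball 0 (R + \<bar>x $ j\<bar>)"])
  show "continuous_on UNIV (\<lambda>s. g (x + s *\<^sub>R axis j 1))"
    by (intro continuous_on_compose2[OF smooth_continuous[OF g(1), of UNIV]] continuous_intros) auto
  show "g (x + s *\<^sub>R axis j 1) = 0" if "s \<notin> cball 0 (R + \<bar>x $ j\<bar>)" for s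
    using g(2) that by (auto simp: slab_supported_def dist_norm)
qed auto

lemma line_integral_UNIV_shift:
  assumes g: "smooth g" "slab_supported R j g"
  shows "line_integral UNIV j g (x + s *\<^sub>R axis j 1) = line_integral UNIV j g x"
proof -
  have c: "continuous_on UNIV (\<lambda>s. g (x + s *\<^sub>R axis j 1))" 
    by (intro continuous_on_compose2[OF smooth_continuous[OF g(1), of UNIV]] continuous_intros) auto
  show ?thesis
    using lborel_integral_translate[OF borel_measurable_continuous_onI[OF c], of s]
    unfolding line_integral_lborel[OF g] by (simp add: scaleR_add_left add.assoc)
qed

lemma line_integral_pos:
  assumes g: "smooth g" "slab_supported R j g" and nn: "\<And>x. 0 \<le> g x" and x: "0 < g x"
  shows "0 < line_integral UNIV j g x"
proof -
  let ?f = "\<lambda>s. g (x + s *\<^sub>R axis j 1)"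
  have c: "continuous_on A ?f" for A 
    by (intro continuous_on_compose2[OF smooth_continuous[OF g(1), of UNIV]] continuous_intros) auto
  have g2: "slab_supported (\<bar>R\<bar> + 1) j g" using g(2) by (auto simp: slab_supported_def)
  define M where "M = \<bar>x $ j\<bar> + (\<bar>R\<bar> + 1)"
  have M: "0 < M" by (simp add: M_def)
  have "integral (cbox (- M) M) ?f \<noteq> 0"
    using integral_eq_0_iff[OF c, of "-M" M] M x nn by (auto dest!: bspec[where x=0])
  moreover have "integral (cbox (- M) M) ?f \<ge> 0" by (intro integral_nonneg integrable_continuous c nn)
  moreover have "line_integral UNIV j g x = integral (cbox (- M) M) ?f"
    using line_integral_bounded[OF g2, of UNIV x "\<bar>x $ j\<bar>"] by (simp add: M_def)
  ultimately show ?thesis by simp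
qed

text \<open>The integral of a translate of \<open>g\<close> does not depend on the translation; its derivative with
respect to the translation is the integral of \<open>partial j g\<close>.\<close>

lemma integral_partial_eq_0:
  assumes g: "smooth g" "compact K" "\<And>x. x \<notin> K \<Longrightarrow> g x = 0"
  shows "(\<integral>x. partial j g x \<partial>lborel) = 0"
proof -
  let ?e = "axis j 1 :: real^2"
  obtain r where r: "K \<subseteq> cball 0 r" "0 < r"
    using compact_imp_bounded[OF g(2)] unfolding bounded_pos by (auto simp: subset_eq dist_norm)
  obtain a where a: "cball 0 (r + 1) \<subseteq> cbox (-a) (a :: real^2)" 
    using bounded_subset_cbox_symmetric[of "cball 0 (r + 1) :: (real^2) set"] bounded_cball by blast
  have z: "g x = 0" if "x \<notin> cball 0 r" for x using that g(3) r by blast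
  have z': "g (x + s *\<^sub>R ?e) = 0" if "x \<notin> cbox (-a) a" "\<bar>s\<bar> \<le> 1" for x s
  proof (rule z, rule notI)
    assume "x + s *\<^sub>R ?e \<in> cball 0 r"
    then have "norm x \<le> r + 1" using that(2) norm_triangle_ineq4[of "x + s *\<^sub>R ?e" "s *\<^sub>R ?e"] by simp
    then show False using a that(1) by auto
  qed
  have cont: "continuous_on A (\<lambda>x. h (x + s *\<^sub>R ?e))" if "smooth h" for h s A
    by (intro continuous_on_compose2[OF smooth_continuous[OF that, of UNIV]] continuous_intros) auto
  have F: "integral (cbox (-a) a) (\<lambda>x. g (x + s *\<^sub>R ?e)) = (\<integral>x. g x \<partial>lborel)" if "\<bar>s\<bar> \<le> 1" for s
  proof -
    have "integral (cbox (-a) a) (\<lambda>x. g (x + s *\<^sub>R ?e)) = integral UNIV (\<lambda>x. g (x + s *\<^sub>R ?e))"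
      by (rule integral_eq_integral_UNIV) (rule z'[OF _ that])
    also have "\<dots> = (\<integral>x. g (x + s *\<^sub>R ?e) \<partial>lborel)"
      by (intro integral_lborel integrable_compact_supported[where K="cbox (-a) a"] cont[OF g(1)])
        (use z'[OF _ that] in auto)
    also have "\<dots> = (\<integral>x. g x \<partial>lborel)"
      using lborel_integral_translate[OF borel_measurable_continuous_onI[OF smooth_continuous[OF g(1)]], of "s *\<^sub>R ?e"]
      by (simp add: add.commute)
    finally show ?thesis .
  qed
  have "((\<lambda>s. integral (cbox (-a) a) (\<lambda>x. g (x + s *\<^sub>R ?e))) has_vector_derivative
      integral (cbox (-a) a) (\<lambda>x. partial j g (x + 0 *\<^sub>R ?e))) (at 0 within UNIV)"
  proof (rule leibniz_rule_vector_derivative)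
    show "continuous_on (UNIV \<times> cbox (-a) a) (\<lambda>(s, x). partial j g (x + s *\<^sub>R ?e))"
      unfolding split_beta 
      by (intro continuous_intros continuous_on_compose2[OF smooth_continuous[OF smooth_partial[OF g(1)], of UNIV]]) auto
  qed (auto intro!: line_has_vector_derivative g integrable_continuous cont)
  then have "((\<lambda>s. integral (cbox (-a) a) (\<lambda>x. g (x + s *\<^sub>R ?e))) has_derivative
      (\<lambda>h. h *\<^sub>R integral (cbox (-a) a) (partial j g))) (at 0)"
    by (simp add: has_vector_derivative_def)
  then have "((\<lambda>s. \<integral>x. g x \<partial>lborel) has_vector_derivative integral (cbox (-a) a) (partial j g)) (at 0)"
    unfolding has_vector_derivative_def
    by (rule has_derivative_transform_within_open[of _ _ _ _ "ball 0 1"])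
       (auto simp: F)
  then have "integral (cbox (-a) a) (partial j g) = 0"
    using vector_derivative_unique_at[OF _ has_vector_derivative_const] by blast
  moreover have zp: "partial j g x = 0" if "x \<notin> cball 0 r" for x
  proof -
    have "(g has_derivative (\<lambda>_. 0)) (at x)"
      by (rule has_derivative_transform_within_open[OF has_derivative_const, of "- cball 0 r"])
        (use that z in auto)
    then show ?thesis by (rule partial_has_derivative)
  qed
  have "integral (cbox (-a) a) (partial j g) = integral UNIV (partial j g)"
    by (rule integral_eq_integral_UNIV) (rule zp, use a subset_cball[of r "r + 1" "0 :: real^2"] in auto)
  moreover have "integral UNIV (partial j g) = (\<integral>x. partial j g x \<partial>lborel)"
    by (intro integral_lborel integrable_compact_supported[where K="cball 0 r"] smooth_continuous smooth_partial g(1) zp) auto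
  ultimately show ?thesis by simp
qed

lemma test_functionsI:
  assumes "smooth f" "compact K" "K \<subseteq> \<Omega>" "\<And>x. x \<notin> K \<Longrightarrow> f x = 0"
  shows "f \<in> test_functions \<Omega>"
proof -
  have "closure {x. f x \<noteq> 0} \<subseteq> K"
    using assms by (intro closure_minimal) (auto simp: compact_imp_closed)
  moreover from this have "compact (closure {x. f x \<noteq> 0})"
    using compact_Int_closed[OF assms(2) closed_closure[of "{x. f x \<noteq> 0}"]] by (simp only: Int_absorb1)
  ultimately show ?thesis using assms unfolding test_functions_def smooth_def by auto
qed

lemma test_functionsE:
  assumes "f \<in> test_functions \<Omega>"
  obtains K where "smooth f" "compact K" "K \<subseteq> \<Omega>" "\<And>x. x \<notin> K \<Longrightarrow> f x = 0"
proof (rule that)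
  show "smooth f" "compact (closure {x. f x \<noteq> 0})" "closure {x. f x \<noteq> 0} \<subseteq> \<Omega>"
    using assms unfolding test_functions_def smooth_def mem_Collect_eq by fast+
  show "f x = 0" if "x \<notin> closure {x. f x \<noteq> 0}" for x
    using that closure_subset[of "{x. f x \<noteq> 0}"] by blast
qed

lemma test_functions_mono: "A \<subseteq> B \<Longrightarrow> test_functions A \<subseteq> test_functions B"
  by (auto simp: test_functions_def)

lemma test_functions_mult:
  assumes "f \<in> test_functions \<Omega>" "smooth g"
  shows "(\<lambda>x. f x * g x) \<in> test_functions \<Omega>"
  using assms(1)
proof (rule test_functionsE)
  fix K assume "smooth f" "compact K" "K \<subseteq> \<Omega>" "\<And>x. x \<notin> K \<Longrightarrow> f x = 0"
  then show ?thesis using assms(2) by (intro test_functionsI[of _ K] smooth_mult) auto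
qed

lemma test_functions_lin:
  assumes "f \<in> test_functions \<Omega>" "g \<in> test_functions \<Omega>"
  shows "(\<lambda>x. f x + c * g x) \<in> test_functions \<Omega>"
  using assms(1)
proof (rule test_functionsE)
  fix K assume K: "smooth f" "compact K" "K \<subseteq> \<Omega>" "\<And>x. x \<notin> K \<Longrightarrow> f x = 0"
  show ?thesis using assms(2)
  proof (rule test_functionsE)
    fix K' assume K': "smooth g" "compact K'" "K' \<subseteq> \<Omega>" "\<And>x. x \<notin> K' \<Longrightarrow> g x = 0"
    show ?thesis
      using K K' by (intro test_functionsI[of _ "K \<union> K'"] smooth_add smooth_mult smooth_const) auto
  qed
qed

lemma test_functions_partial:
  assumes "f \<in> test_functions \<Omega>"
  shows "partial j f \<in> test_functions \<Omega>"
  using assms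
proof (rule test_functionsE)
  fix K assume K: "smooth f" "compact K" "K \<subseteq> \<Omega>" "\<And>x. x \<notin> K \<Longrightarrow> f x = 0"
  show ?thesis
  proof (intro test_functionsI[of _ K] smooth_partial K)
    fix x assume x: "x \<notin> K"
    have "(f has_derivative (\<lambda>_. 0)) (at x)"
      by (rule has_derivative_transform_within_open[OF has_derivative_const, of "- K"])
        (use x K compact_imp_closed in auto)
    then show "partial j f x = 0" by (rule partial_has_derivative)
  qed
qed

lemma compact_slab_supported:
  assumes "compact K" "\<And>x. x \<notin> K \<Longrightarrow> f x = (0::real)"
  obtains R where "\<And>j. slab_supported R j f"
proof -
  obtain r where r: "K \<subseteq> cball 0 r" using compact_imp_bounded[OF assms(1)] unfolding bounded_pos by (auto simp: subset_eq dist_norm)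
  show ?thesis
  proof 
    fix j show "slab_supported r j f"
      unfolding slab_supported_def
    proof (intro allI impI)
      fix x :: "real^2" assume "r < \<bar>x $ j\<bar>"
      then have "r < norm x" using component_le_norm_cart[of x j] by simp
      then have "x \<notin> K" using r by (auto simp: subset_eq dist_norm)
      then show "f x = 0" by (rule assms(2))
    qed
  qed
qed

lemma test_functions_slab_supported:
  assumes "f \<in> test_functions \<Omega>"
  obtains R where "\<And>j. slab_supported R j f"
proof (rule test_functionsE[OF assms])
  fix K assume K: "compact K" "\<And>x. x \<notin> K \<Longrightarrow> f x = 0"
  show ?thesis by (rule compact_slab_supported[of K f, OF K that])
qed

section \<open>Distributions with zero gradient are constant\<close>

lemma compact_in_box:
  fixes K :: "(real^2) set"
  assumes "compact K" "K \<subseteq> box a b"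
  obtains c d where "K \<subseteq> cbox c d" "\<And>i. a $ i < c $ i" "\<And>i. d $ i < b $ i"
proof -
  have "\<exists>l u. a $ i < l \<and> u < b $ i \<and> (\<forall>x\<in>K. l \<le> x $ i \<and> x $ i \<le> u)" for i
  proof (cases "K = {}")
    case True
    then show ?thesis by (intro exI[of _ "a $ i + 1"] exI[of _ "b $ i - 1"]) auto
  next
    case False
    have c: "compact ((\<lambda>x. x $ i) ` K)" by (intro compact_continuous_image assms continuous_intros)
    obtain x where x: "x \<in> K" "\<And>y. y \<in> K \<Longrightarrow> x $ i \<le> y $ i"
      using compact_attains_inf[OF c] False by auto
    obtain y where y: "y \<in> K" "\<And>z. z \<in> K \<Longrightarrow> z $ i \<le> y $ i"
      using compact_attains_sup[OF c] False by auto
    show ?thesis using x y assms(2)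
      by (intro exI[of _ "x $ i"] exI[of _ "y $ i"]) (auto simp: subset_eq mem_box_cart)
  qed
  then obtain l u where "\<And>i. a $ i < l i \<and> u i < b $ i \<and> (\<forall>x\<in>K. l i \<le> x $ i \<and> x $ i \<le> u i)" by metis
  then show ?thesis by (intro that[of "\<chi> i. l i" "\<chi> i. u i"]) (auto simp: mem_box_cart)
qed

definition strip_bump :: "2 \<Rightarrow> real \<Rightarrow> real \<Rightarrow> real^2 \<Rightarrow> real" where
  "strip_bump j l u x = flat_fun 1 (x $ j - l) * flat_fun 1 (u - x $ j)"

lemma smooth_strip_bump: "smooth (strip_bump j l u)"
  unfolding strip_bump_def
  using smooth_mult[OF smooth_flat[of 1 1 j "-l"] smooth_flat[of 1 "-1" j u]] by (simp add: algebra_simps)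

lemma strip_bump_nonneg: "0 \<le> strip_bump j l u x"
  by (simp add: strip_bump_def flat_fun_def)

lemma strip_bump_pos_iff: "0 < strip_bump j l u x \<longleftrightarrow> l < x $ j \<and> x $ j < u"
  by (simp add: strip_bump_def flat_fun_def)

lemma strip_bump_eq_0: "\<not> (l < x $ j \<and> x $ j < u) \<Longrightarrow> strip_bump j l u x = 0"
  by (auto simp: strip_bump_def flat_fun_def)

lemma strip_bump_shift: "i \<noteq> j \<Longrightarrow> strip_bump j l u (x + s *\<^sub>R axis i 1) = strip_bump j l u x"
  by (simp add: strip_bump_def axis_def)

lemma slab_supported_strip_bump: "slab_supported (\<bar>l\<bar> + \<bar>u\<bar>) j (strip_bump j l u)"
  unfolding slab_supported_def by (auto intro!: strip_bump_eq_0)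

lemma line_integral_strip_bump:
  "line_integral UNIV j (strip_bump j l u) x = line_integral UNIV j (strip_bump j l u) 0"
proof -
  have "line_integral UNIV j (strip_bump j l u) x = line_integral UNIV j (strip_bump j l u) (0 + x $ j *\<^sub>R axis j 1)"
    by (simp add: line_integral_def strip_bump_def)
  also have "\<dots> = line_integral UNIV j (strip_bump j l u) 0"
    by (rule line_integral_UNIV_shift[OF smooth_strip_bump slab_supported_strip_bump])
  finally show ?thesis .
qed

lemma line_integral_strip_bump_pos:
  assumes "l < u"
  shows "0 < line_integral UNIV j (strip_bump j l u) 0"
proof -
  have "0 < line_integral UNIV j (strip_bump j l u) (\<chi> i. (l + u) / 2)"
    by (rule line_integral_pos[OF smooth_strip_bump slab_supported_strip_bump])
       (use assms in \<open>auto simp: strip_bump_nonneg strip_bump_pos_iff\<close>)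
  then show ?thesis using line_integral_strip_bump by metis
qed

text \<open>One identity encodes both additivity and homogeneity, because the zero function is a test
function.\<close>

definition test_linear :: "(real^2) set \<Rightarrow> distribution \<Rightarrow> bool" where
  "test_linear \<Omega> S \<longleftrightarrow> (\<forall>f\<in>test_functions \<Omega>. \<forall>g\<in>test_functions \<Omega>. \<forall>c.
     S (\<lambda>x. f x + c * g x) = S f + c * S g)"

lemma zero_test_function: "(\<lambda>x. 0) \<in> test_functions \<Omega>"
  by (rule test_functionsI[of _ "{}"]) (auto simp: smooth_const)

lemma test_linearD:
  assumes "test_linear \<Omega> S" "f \<in> test_functions \<Omega>" "g \<in> test_functions \<Omega>"
  shows "S (\<lambda>x. f x + c * g x) = S f + c * S g"
  using assms unfolding test_linear_def by blast

lemma test_linear_cmult: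
  assumes S: "test_linear \<Omega> S" and f: "f \<in> test_functions \<Omega>"
  shows "S (\<lambda>x. c * f x) = c * S f"
proof -
  have "S (\<lambda>x. f x + (-1) * f x) = S f + (-1) * S f" by (rule test_linearD[OF S f f])
  then have "S (\<lambda>x. 0) = 0" by simp
  then show ?thesis using test_linearD[OF S zero_test_function f, of c] by simp
qed

lemma test_functions_cmult: "f \<in> test_functions \<Omega> \<Longrightarrow> (\<lambda>x. c * f x) \<in> test_functions \<Omega>"
  using test_functions_lin[OF zero_test_function, of f \<Omega> c] by simp

lemma line_integrable:
  assumes g: "smooth g" "slab_supported R j g"
  shows "(\<lambda>s. g (x + s *\<^sub>R axis j 1)) integrable_on UNIV"
proof (intro integrable_on_lborel integrable_compact_supported[where K="cball 0 (R + \<bar>x $ j\<bar>)"])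
  show "continuous_on UNIV (\<lambda>s. g (x + s *\<^sub>R axis j 1))"
    by (intro continuous_on_compose2[OF smooth_continuous[OF g(1), of UNIV]] continuous_intros) auto
  show "g (x + s *\<^sub>R axis j 1) = 0" if "s \<notin> cball 0 (R + \<bar>x $ j\<bar>)" for s
    using g(2) that by (auto simp: slab_supported_def dist_norm)
qed auto

text \<open>Subtracting from \<open>\<phi>\<close> the product of its line integrals with a normalized bump leaves a
function whose integral over every line in direction \<open>j\<close> is zero. Such a function is \<open>partial j\<close>
of a test function, namely of its antiderivative, and \<open>S\<close> does not see it. The factor on the
right replaces the normalization.\<close>

lemma gradient_free_replace_by_line_integral:
  assumes S: "test_linear (box a b) S"
    and S0: "\<And>\<psi>. \<psi> \<in> test_functions (box a b) \<Longrightarrow> S (partial j \<psi>) = 0"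
    and \<phi>: "\<phi> \<in> test_functions (box a b)" and lu: "a $ j < l" "l < u" "u < b $ j"
  shows "(\<lambda>x. strip_bump j l u x * line_integral UNIV j \<phi> x) \<in> test_functions (box a b)" (is "?g \<in> _")
    and "S (\<lambda>x. strip_bump j l u x * line_integral UNIV j \<phi> x) = line_integral UNIV j (strip_bump j l u) 0 * S \<phi>"
proof -
  define \<rho> where "\<rho> = strip_bump j l u"
  define A where "A = line_integral UNIV j \<phi>"
  define \<kappa> where "\<kappa> = line_integral UNIV j \<rho> 0"
  obtain K where K: "smooth \<phi>" "compact K" "K \<subseteq> box a b" "\<And>x. x \<notin> K \<Longrightarrow> \<phi> x = 0"
    by (rule test_functionsE[OF \<phi>]) (rule that)
  obtain R where R: "\<And>j. slab_supported R j \<phi>" by (rule test_functions_slab_supported[OF \<phi>]) (rule that)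
  obtain c' d' where cd': "K \<subseteq> cbox c' d'" "\<And>i. a $ i < c' $ i" "\<And>i. d' $ i < b $ i"
    by (rule compact_in_box[OF K(2,3)]) (rule that)
  define c d where "c = (\<chi> i. if i = j then min l (c' $ i) else c' $ i)"
    and "d = (\<chi> i. if i = j then max u (d' $ i) else d' $ i)"
  have bd: "a $ i < c $ i" "d $ i < b $ i" "c $ i \<le> c' $ i" "d' $ i \<le> d $ i" for i
    using cd'(2,3)[of i] lu by (auto simp: c_def d_def)
  have "x \<in> box a b" if "x \<in> cbox c d" for x
    using that bd(1,2) by (auto simp: mem_box_cart intro: order_less_le_trans order_le_less_trans)
  moreover have "x \<in> cbox c d" if "x \<in> cbox c' d'" for x
    using that bd(3,4) by (auto simp: mem_box_cart intro: order_trans)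
  moreover have "c $ j \<le> l" "u \<le> d $ j" by (auto simp: c_def d_def)
  ultimately have cd: "cbox c d \<subseteq> box a b" "cbox c' d' \<subseteq> cbox c d" "c $ j \<le> l" "u \<le> d $ j"
    by auto
  have \<phi>0: "\<phi> x = 0" if "x \<notin> cbox c d" for x
    using that cd cd' by (intro K(4)) blast
  have \<rho>0: "\<rho> x = 0" if "\<not> (c $ j \<le> x $ j \<and> x $ j \<le> d $ j)" for x
    using that cd by (auto simp: \<rho>_def intro!: strip_bump_eq_0)
  have A0: "A x = 0" if "i \<noteq> j" "\<not> (c $ i \<le> x $ i \<and> x $ i \<le> d $ i)" for x i
  proof -
    have "\<phi> (x + s *\<^sub>R axis j 1) = 0" for s
      using that by (intro \<phi>0) (auto simp: mem_box_cart axis_def intro!: exI[of _ i])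
    then show ?thesis by (simp add: A_def line_integral_def)
  qed
  have smA: "smooth A" unfolding A_def by (rule smooth_line_integral[OF K(1) R]) simp
  have sm\<rho>: "smooth \<rho>" unfolding \<rho>_def by (rule smooth_strip_bump)
  have g0: "\<rho> x * A x = 0" if x: "x \<notin> cbox c d" for x
  proof -
    obtain i where i: "\<not> (c $ i \<le> x $ i \<and> x $ i \<le> d $ i)"
      using x unfolding mem_box_cart by blast
    show ?thesis
    proof (cases "i = j")
      case True
      then show ?thesis using \<rho>0[of x] i by simp
    next
      case False
      then show ?thesis using A0[OF False i] by simp
    qed
  qed
  have gt: "(\<lambda>x. \<rho> x * A x) \<in> test_functions (box a b)"
    by (rule test_functionsI[of _ "cbox c d"]) (use smA sm\<rho> g0 cd in \<open>auto intro: smooth_mult\<close>)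
  then show "?g \<in> test_functions (box a b)" by (simp add: \<rho>_def A_def)
  define h where "h = (\<lambda>x. \<kappa> * \<phi> x + (-1) * (\<rho> x * A x))"
  have ht: "h \<in> test_functions (box a b)"
    unfolding h_def by (intro test_functions_lin test_functions_cmult \<phi> gt)
  obtain R' where R': "\<And>j. slab_supported R' j h" by (rule test_functions_slab_supported[OF ht]) (rule that)
  have smh: "smooth h" unfolding h_def
    by (intro smooth_add smooth_mult smooth_const smA sm\<rho> K)
  have h0: "h x = 0" if "x \<notin> cbox c d" for x
    using that g0[of x] \<phi>0[of x] by (simp add: h_def)
  \<comment> \<open>Beyond the support of \<open>h\<close> the antiderivative equals the integral over the whole line, which is zero.\<close>
  define \<psi> where "\<psi> = line_integral {..0} j h"
  have sm\<psi>: "smooth \<psi>" unfolding \<psi>_def by (rule smooth_line_integral[OF smh R']) simp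
  have Ah: "line_integral UNIV j h x = 0" for x
  proof -
    have shift: "A (x + s *\<^sub>R axis j 1) = A x" for s
      unfolding A_def by (rule line_integral_UNIV_shift[OF K(1) R])
    have i\<phi>: "(\<lambda>s. \<phi> (x + s *\<^sub>R axis j 1)) integrable_on UNIV"
      by (rule line_integrable[OF K(1) R])
    have i\<rho>: "(\<lambda>s. \<rho> (x + s *\<^sub>R axis j 1)) integrable_on UNIV"
      unfolding \<rho>_def by (rule line_integrable[OF smooth_strip_bump slab_supported_strip_bump])
    have "line_integral UNIV j h x = integral UNIV (\<lambda>s. \<kappa> * \<phi> (x + s *\<^sub>R axis j 1) - A x * \<rho> (x + s *\<^sub>R axis j 1))"
      unfolding line_integral_def h_def shift by (simp add: mult.commute)
    also have "\<dots> = \<kappa> * A x - A x * line_integral UNIV j \<rho> x"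
      using i\<phi> i\<rho> by (simp add: integral_diff integrable_on_mult_right A_def line_integral_def)
    also have "line_integral UNIV j \<rho> x = \<kappa>"
      unfolding \<kappa>_def \<rho>_def by (rule line_integral_strip_bump)
    finally show ?thesis by simp
  qed
  have \<psi>0: "\<psi> x = 0" if x: "x \<notin> cbox c d" for x
  proof -
    consider i where "i \<noteq> j" "\<not> (c $ i \<le> x $ i \<and> x $ i \<le> d $ i)" | "x $ j < c $ j" | "d $ j < x $ j"
    proof -
      obtain i where i: "\<not> (c $ i \<le> x $ i \<and> x $ i \<le> d $ i)"
        using x unfolding mem_box_cart by blast
      then show thesis using that by (cases "i = j") auto
    qed
    then show ?thesis
    proof cases
      case 1
      then have "h (x + s *\<^sub>R axis j 1) = 0" for s
        by (intro h0) (auto simp: mem_box_cart axis_def intro!: exI[of _ i])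
      then show ?thesis by (simp add: \<psi>_def line_integral_def)
    next
      case 2
      have "h (x + s *\<^sub>R axis j 1) = 0" if "s \<le> 0" for s
        using 2 that by (intro h0) (auto simp: mem_box_cart axis_def intro!: exI[of _ j])
      then have "integral {..0} (\<lambda>s. h (x + s *\<^sub>R axis j 1)) = integral {..0} (\<lambda>s::real. 0)"
        by (intro integral_cong) auto
      then show ?thesis by (simp add: \<psi>_def line_integral_def)
    next
      case 3
      have "h (x + s *\<^sub>R axis j 1) = 0" if "s \<notin> {..0}" for s
        using 3 that by (intro h0) (auto simp: mem_box_cart axis_def intro!: exI[of _ j])
      then have "\<psi> x = line_integral UNIV j h x"
        unfolding \<psi>_def line_integral_def by (rule integral_eq_integral_UNIV)
      then show ?thesis by (simp add: Ah)
    qed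
  qed
  have "\<psi> \<in> test_functions (box a b)"
    by (rule test_functionsI[of _ "cbox c d"]) (use sm\<psi> \<psi>0 cd in auto)
  then have "S (partial j \<psi>) = 0" by (rule S0)
  moreover have "partial j \<psi> = h"
    unfolding \<psi>_def by (subst partial_line_integral[OF smh R']) (simp_all add: line_integral_partial[OF smh R'])
  moreover have "S h = \<kappa> * S \<phi> + (-1) * S (\<lambda>x. \<rho> x * A x)"
    unfolding h_def by (subst test_linearD[OF S test_functions_cmult[OF \<phi>] gt]) (simp add: test_linear_cmult[OF S \<phi>])
  ultimately show "S ?g = line_integral UNIV j (strip_bump j l u) 0 * S \<phi>"
    by (simp add: \<kappa>_def \<rho>_def A_def)
qed

lemma test_functions_integrable:
  assumes "\<phi> \<in> test_functions \<Omega>"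
  shows "integrable lborel \<phi>"
  by (rule test_functionsE[OF assms]) (auto intro!: integrable_compact_supported smooth_continuous)

lemma test_linear_lborel_integral: "test_linear \<Omega> (\<lambda>\<phi>. \<integral>x. \<phi> x \<partial>lborel)"
  unfolding test_linear_def by (auto dest!: test_functions_integrable)

lemma test_linear_mono: "test_linear B S \<Longrightarrow> A \<subseteq> B \<Longrightarrow> test_linear A S"
  using test_functions_mono[of A B] unfolding test_linear_def by blast

lemma lborel_integral_partial:
  assumes "\<phi> \<in> test_functions \<Omega>"
  shows "(\<integral>x. partial j \<phi> x \<partial>lborel) = 0"
  by (rule test_functionsE[OF assms]) (rule integral_partial_eq_0)

definition box_bump :: "real^2 \<Rightarrow> real^2 \<Rightarrow> real^2 \<Rightarrow> real" where
  "box_bump l u x = strip_bump 2 (l $ 2) (u $ 2) x * strip_bump 1 (l $ 1) (u $ 1) x"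

lemma smooth_box_bump: "smooth (box_bump l u)"
  unfolding box_bump_def by (intro smooth_mult smooth_strip_bump)

lemma box_bump_eq_0:
  assumes "x \<notin> cbox l u"
  shows "box_bump l u x = 0"
proof -
  obtain i where "\<not> (l $ i \<le> x $ i \<and> x $ i \<le> u $ i)" using assms unfolding mem_box_cart by blast
  then have "strip_bump i (l $ i) (u $ i) x = 0" by (intro strip_bump_eq_0) auto
  then show ?thesis using exhaust_2[of i] by (auto simp: box_bump_def)
qed

lemma cbox_subset_box_cart:
  fixes a :: "real^'n"
  assumes "\<And>i. a $ i < l $ i" "\<And>i. u $ i < b $ i"
  shows "cbox l u \<subseteq> box a b"
  using assms by (auto simp: mem_box_cart) (metis order_less_le_trans, metis order_le_less_trans)

lemma box_bump_test:
  assumes "\<And>i. a $ i < l $ i" "\<And>i. u $ i < b $ i"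
  shows "box_bump l u \<in> test_functions (box a b)"
proof (rule test_functionsI[of _ "cbox l u"])
  show "smooth (box_bump l u)" by (rule smooth_box_bump)
  show "cbox l u \<subseteq> box a b"
    using assms by (rule cbox_subset_box_cart)
  show "box_bump l u x = 0" if "x \<notin> cbox l u" for x by (rule box_bump_eq_0[OF that])
qed auto

lemma box_bump_integral_pos:
  assumes lu: "\<And>i. l $ i < u $ i"
  shows "0 < (\<integral>x. box_bump l u x \<partial>lborel)"
proof -
  have nn: "0 \<le> box_bump l u x" for x
    by (simp add: box_bump_def strip_bump_nonneg)
  note sm = smooth_box_bump[of l u] and z = box_bump_eq_0[of _ l u]
  define m where "m = (\<chi> i. (l $ i + u $ i) / 2)"
  have "m \<in> box l u" using lu by (auto simp: m_def mem_box_cart)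
  moreover have "0 < box_bump l u m"
    unfolding box_bump_def by (intro mult_pos_pos) (use lu[of 1] lu[of 2] in \<open>auto simp: strip_bump_pos_iff m_def\<close>)
  ultimately have "integral (cbox l u) (box_bump l u) \<noteq> 0"
    using has_integral_0_cbox_imp_0[OF smooth_continuous[OF sm], of l u m] nn box_subset_cbox[of l u]
      integrable_continuous[OF smooth_continuous[OF sm], of l u] 
    by (metis empty_iff integrable_integral less_irrefl subsetD)
  moreover have "integral (cbox l u) (box_bump l u) = integral UNIV (box_bump l u)"
    by (rule integral_eq_integral_UNIV) (rule z)
  moreover have "integral UNIV (box_bump l u) = (\<integral>x. box_bump l u x \<partial>lborel)"
    by (intro integral_lborel integrable_compact_supported[where K="cbox l u"] smooth_continuous sm z) auto
  moreover have "0 \<le> (\<integral>x. box_bump l u x \<partial>lborel)"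
    by (rule integral_nonneg_AE) (simp add: nn)
  ultimately show ?thesis by linarith
qed

text \<open>Replacing in both directions turns \<open>\<phi>\<close> into a constant multiple of the fixed function
\<open>box_bump l u\<close>. The constant does not depend on \<open>S\<close>, which allows a comparison with the integral
below.\<close>

lemma box_functional_identity:
  assumes S: "test_linear (box a b) S"
    and S0: "\<And>\<psi> j. \<psi> \<in> test_functions (box a b) \<Longrightarrow> S (partial j \<psi>) = 0"
    and \<phi>: "\<phi> \<in> test_functions (box a b)"
    and lu: "\<And>i. a $ i < l $ i" "\<And>i. l $ i < u $ i" "\<And>i. u $ i < b $ i"
  shows "line_integral UNIV 2 (strip_bump 2 (l $ 2) (u $ 2)) 0 * line_integral UNIV 1 (strip_bump 1 (l $ 1) (u $ 1)) 0 * S \<phi>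
    = line_integral UNIV 2 (line_integral UNIV 1 \<phi>) 0 * S (box_bump l u)"
proof -
  define \<rho>1 \<rho>2 where "\<rho>1 = strip_bump 1 (l $ 1) (u $ 1)" and "\<rho>2 = strip_bump 2 (l $ 2) (u $ 2)"
  define A where "A = line_integral UNIV 1 \<phi>"
  obtain R where R: "\<And>j. slab_supported R j \<phi>" by (rule test_functions_slab_supported[OF \<phi>]) (rule that)
  have sm\<phi>: "smooth \<phi>" by (rule test_functionsE[OF \<phi>])
  have smA: "smooth A" unfolding A_def by (rule smooth_line_integral[OF sm\<phi> R]) simp
  have RA: "slab_supported R 2 A"
    using R[of 2] unfolding slab_supported_def A_def line_integral_def by (simp add: axis_def)
  have A1: "A (x + s *\<^sub>R axis 1 1) = A x" for x s
    unfolding A_def by (rule line_integral_UNIV_shift[OF sm\<phi> R])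
  define B where "B = line_integral UNIV 2 A"
  have B2: "B (x + s *\<^sub>R axis 2 1) = B x" for x s
    unfolding B_def by (rule line_integral_UNIV_shift[OF smA RA])
  have B1: "B (x + s *\<^sub>R axis 1 1) = B x" for x s
  proof -
    have "A (x + s *\<^sub>R axis 1 1 + t *\<^sub>R axis 2 1) = A (x + t *\<^sub>R axis 2 1)" for t
      using A1[of "x + t *\<^sub>R axis 2 1" s] by (simp add: ac_simps)
    then show ?thesis unfolding B_def line_integral_def by simp
  qed
  have Bc: "B x = B 0" for x
  proof -
    have "x = 0 + x $ 1 *\<^sub>R axis 1 1 + x $ 2 *\<^sub>R axis 2 1"
      by (auto simp: vec_eq_iff forall_2 axis_def)
    then have "B x = B (0 + x $ 1 *\<^sub>R axis 1 1 + x $ 2 *\<^sub>R axis 2 1)" by (rule arg_cong)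
    also have "\<dots> = B 0" by (simp only: B1 B2)
    finally show ?thesis .
  qed
  have g: "(\<lambda>x. \<rho>1 x * A x) \<in> test_functions (box a b)"
    and e1: "S (\<lambda>x. \<rho>1 x * A x) = line_integral UNIV 1 \<rho>1 0 * S \<phi>"
    unfolding \<rho>1_def A_def
    using gradient_free_replace_by_line_integral[OF S S0 \<phi> lu(1) lu(2) lu(3), of 1] by simp_all
  have e2: "S (\<lambda>x. \<rho>2 x * line_integral UNIV 2 (\<lambda>x. \<rho>1 x * A x) x) = line_integral UNIV 2 \<rho>2 0 * S (\<lambda>x. \<rho>1 x * A x)"
    unfolding \<rho>2_def
    by (rule gradient_free_replace_by_line_integral(2)[OF S S0 g lu(1) lu(2) lu(3)])
  have AB: "line_integral UNIV 2 (\<lambda>x. \<rho>1 x * A x) x = \<rho>1 x * B x" for x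
    unfolding line_integral_def B_def \<rho>1_def by (simp add: strip_bump_shift)
  have "\<rho>2 x * line_integral UNIV 2 (\<lambda>x. \<rho>1 x * A x) x = B 0 * box_bump l u x" for x
    using AB[of x] Bc[of x] by (simp add: box_bump_def \<rho>1_def \<rho>2_def)
  then have "B 0 * S (box_bump l u) = line_integral UNIV 2 \<rho>2 0 * S (\<lambda>x. \<rho>1 x * A x)"
    using e2 test_linear_cmult[OF S box_bump_test, of l u "B 0"] lu by simp
  then show ?thesis using e1 by (simp add: B_def A_def \<rho>1_def \<rho>2_def)
qed

text \<open>The identity above holds for \<open>S\<close> and also for the Lebesgue integral; the two instances
share the constant, which can therefore be eliminated.\<close>

lemma gradient_free_functional_on_box:
  assumes S: "test_linear (box a b) S"
    and S0: "\<And>\<psi> j. \<psi> \<in> test_functions (box a b) \<Longrightarrow> S (partial j \<psi>) = 0"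
    and ab: "\<And>i. a $ i < b $ i"
  shows "\<exists>c. \<forall>\<phi>\<in>test_functions (box a b). S \<phi> = c * (\<integral>x. \<phi> x \<partial>lborel)"
proof -
  define l u where "l = (\<chi> i. (2 * a $ i + b $ i) / 3)" and "u = (\<chi> i. (a $ i + 2 * b $ i) / 3)"
  have lu: "\<And>i. a $ i < l $ i" "\<And>i. l $ i < u $ i" "\<And>i. u $ i < b $ i"
    using ab by (auto simp: l_def u_def field_simps)
  \<comment> \<open>The factor \<open>k\<close> undoes the missing normalization of the two bumps.\<close>
  define k where "k = line_integral UNIV 2 (strip_bump 2 (l $ 2) (u $ 2)) 0 * line_integral UNIV 1 (strip_bump 1 (l $ 1) (u $ 1)) 0"
  have k: "0 < k" unfolding k_def by (intro mult_pos_pos line_integral_strip_bump_pos lu)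
  define J where "J = (\<integral>x. box_bump l u x \<partial>lborel)"
  have J: "0 < J" unfolding J_def by (rule box_bump_integral_pos[OF lu(2)])
  have "S \<phi> = S (box_bump l u) / J * (\<integral>x. \<phi> x \<partial>lborel)" if \<phi>: "\<phi> \<in> test_functions (box a b)" for \<phi>
  proof -
    define C where "C = line_integral UNIV 2 (line_integral UNIV 1 \<phi>) 0"
    have 1: "k * S \<phi> = C * S (box_bump l u)"
      unfolding k_def C_def by (rule box_functional_identity[OF S S0 \<phi> lu])
    have 2: "k * (\<integral>x. \<phi> x \<partial>lborel) = C * J"
      unfolding k_def C_def J_def
      by (rule box_functional_identity[OF test_linear_lborel_integral lborel_integral_partial \<phi> lu])
    have "k * (J * S \<phi>) = k * (S (box_bump l u) * (\<integral>x. \<phi> x \<partial>lborel))"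
      using 1 2 by (metis mult.left_commute mult.commute)
    then show ?thesis using k J by (simp add: field_simps)
  qed
  then show ?thesis by blast
qed

text \<open>A smooth transition in the coordinate \<open>j\<close> from \<open>0\<close> to \<open>1\<close> as \<open>\<alpha> x\<^sub>j\<close> moves from \<open>p\<close> to
\<open>q\<close>; the sign of \<open>\<alpha>\<close> decides between an ascending and a descending step.\<close>

definition smooth_step :: "real \<Rightarrow> 2 \<Rightarrow> real \<Rightarrow> real \<Rightarrow> real^2 \<Rightarrow> real" where
  "smooth_step \<alpha> j p q x = flat_fun 1 (\<alpha> * x $ j - p) * inverse (flat_fun 1 (\<alpha> * x $ j - p) + flat_fun 1 (q - \<alpha> * x $ j))"

lemma smooth_smooth_step:
  assumes "p < q"
  shows "smooth (smooth_step \<alpha> j p q)"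
  unfolding smooth_step_def
  using smooth_flat[of 1 \<alpha> j "-p"] smooth_flat[of 1 "-\<alpha>" j q] assms
  by (intro smooth_mult smooth_inverse smooth_add) (auto simp: flat_fun_def add_pos_pos less_imp_neq[symmetric])

lemma smooth_step_eq_0: "\<alpha> * x $ j \<le> p \<Longrightarrow> smooth_step \<alpha> j p q x = 0"
  by (simp add: smooth_step_def flat_fun_def)

lemma smooth_step_eq_1: "p < q \<Longrightarrow> q \<le> \<alpha> * x $ j \<Longrightarrow> smooth_step \<alpha> j p q x = 1"
  by (simp add: smooth_step_def flat_fun_def)

lemma cutoff_exists:
  assumes x: "x \<in> box a b"
  shows "\<exists>\<zeta> V. \<zeta> \<in> test_functions (box a b) \<and> open V \<and> x \<in> V \<and> (\<forall>y\<in>V. \<zeta> y = 1)"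
proof -
  have ab: "a $ i < x $ i" "x $ i < b $ i" for i using x by (auto simp: mem_box_cart)
  define l1 l2 u1 u2 where "l1 = (\<chi> i. (2 * a $ i + x $ i) / 3)" and "l2 = (\<chi> i. (a $ i + 2 * x $ i) / 3)"
    and "u1 = (\<chi> i. (b $ i + 2 * x $ i) / 3)" and "u2 = (\<chi> i. (2 * b $ i + x $ i) / 3)"
  have o: "a $ i < l1 $ i" "l1 $ i < l2 $ i" "l2 $ i < x $ i" "x $ i < u1 $ i" "u1 $ i < u2 $ i" "u2 $ i < b $ i" for i
    using ab[of i] by (auto simp: l1_def l2_def u1_def u2_def field_simps)
  define \<theta> where "\<theta> i y = smooth_step 1 i (l1 $ i) (l2 $ i) y * smooth_step (-1) i (- u2 $ i) (- u1 $ i) y" for i y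
  define \<zeta> where "\<zeta> y = \<theta> 1 y * \<theta> 2 y" for y
  have "smooth \<zeta>" unfolding \<zeta>_def \<theta>_def
    by (intro smooth_mult smooth_smooth_step) (use o in auto)
  moreover have "cbox l1 u2 \<subseteq> box a b"
    using o by (intro cbox_subset_box_cart)
  moreover have "\<zeta> y = 0" if "y \<notin> cbox l1 u2" for y
  proof -
    obtain i where "\<not> (l1 $ i \<le> y $ i \<and> y $ i \<le> u2 $ i)" using \<open>y \<notin> _\<close> unfolding mem_box_cart by blast
    then have "\<theta> i y = 0" by (auto simp: \<theta>_def smooth_step_eq_0 not_le)
    then show ?thesis using exhaust_2[of i] by (auto simp: \<zeta>_def)
  qed
  ultimately have "\<zeta> \<in> test_functions (box a b)"
    by (intro test_functionsI[of _ "cbox l1 u2"]) auto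
  moreover have "\<zeta> y = 1" if "y \<in> box l2 u1" for y
  proof -
    have "\<theta> i y = 1" for i
    proof -
      have "smooth_step 1 i (l1 $ i) (l2 $ i) y = 1" "smooth_step (-1) i (- u2 $ i) (- u1 $ i) y = 1"
        using that o[of i] by (auto simp: mem_box_cart less_imp_le intro!: smooth_step_eq_1)
      then show ?thesis by (simp add: \<theta>_def)
    qed
    then show ?thesis by (simp add: \<zeta>_def)
  qed
  moreover have "x \<in> box l2 u1" using o by (auto simp: mem_box_cart)
  ultimately show ?thesis by (intro exI[of _ \<zeta>] exI[of _ "box l2 u1"]) (auto simp: open_box)
qed

text \<open>A partition of unity made one set at a time: \<open>\<phi>\<close> splits into \<open>\<zeta> \<phi>\<close>, which is supported in
\<open>U\<close>, and \<open>\<phi> (1 - \<zeta>)\<close>, whose support no longer meets \<open>V\<close> and is covered by the remaining sets.\<close>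

lemma functional_eq_integral_if_covered:
  assumes "finite F" and S: "test_linear \<Omega> S"
    and F: "\<And>V. V \<in> F \<Longrightarrow> open V \<and> (\<exists>U \<zeta>. U \<subseteq> \<Omega> \<and> (\<forall>\<phi>\<in>test_functions U. S \<phi> = c * (\<integral>x. \<phi> x \<partial>lborel))
        \<and> \<zeta> \<in> test_functions U \<and> (\<forall>y\<in>V. \<zeta> y = 1))"
    and "\<phi> \<in> test_functions \<Omega>" "compact K" "K \<subseteq> \<Union>F" "\<And>x. x \<notin> K \<Longrightarrow> \<phi> x = 0"
  shows "S \<phi> = c * (\<integral>x. \<phi> x \<partial>lborel)"
  using assms(1) F assms(4-)
proof (induction F arbitrary: \<phi> K rule: finite_induct)
  case empty
  then have "\<phi> = (\<lambda>x. 0)" by auto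
  then show ?case using test_linear_cmult[OF S empty.prems(2), of 0] by simp
next
  case (insert V F)
  obtain U \<zeta> where V: "open V" "U \<subseteq> \<Omega>" "\<And>\<phi>. \<phi> \<in> test_functions U \<Longrightarrow> S \<phi> = c * (\<integral>x. \<phi> x \<partial>lborel)"
      "\<zeta> \<in> test_functions U" "\<And>y. y \<in> V \<Longrightarrow> \<zeta> y = 1"
    using insert.prems(1)[of V] by blast
  have sm: "smooth \<phi>" "smooth \<zeta>" using test_functionsE[OF insert.prems(2)] test_functionsE[OF V(4)] by blast+
  have 1: "(\<lambda>x. \<zeta> x * \<phi> x) \<in> test_functions U" by (rule test_functions_mult[OF V(4) sm(1)])
  have 2: "(\<lambda>x. \<phi> x * (1 - \<zeta> x)) \<in> test_functions \<Omega>"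
    by (rule test_functions_mult[OF insert.prems(2)]) (intro smooth_diff smooth_const sm)
  have S1: "S (\<lambda>x. \<zeta> x * \<phi> x) = c * (\<integral>x. \<zeta> x * \<phi> x \<partial>lborel)" by (rule V(3)[OF 1])
  have S2: "S (\<lambda>x. \<phi> x * (1 - \<zeta> x)) = c * (\<integral>x. \<phi> x * (1 - \<zeta> x) \<partial>lborel)"
  proof (rule insert.IH[OF _ 2])
    show "compact (K - V)" by (rule compact_diff[OF insert.prems(3) V(1)])
    show "K - V \<subseteq> \<Union>F" using insert.prems(4) by auto
    show "\<phi> x * (1 - \<zeta> x) = 0" if "x \<notin> K - V" for x
      using that V(5)[of x] insert.prems(5)[of x] by auto
  qed (use insert.prems(1) in blast)
  have one: "(\<lambda>x. \<zeta> x * \<phi> x) \<in> test_functions \<Omega>" using 1 test_functions_mono[OF V(2)] by blast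
  have eq: "\<phi> = (\<lambda>x. \<phi> x * (1 - \<zeta> x) + 1 * (\<zeta> x * \<phi> x))" by (auto simp: algebra_simps)
  have "S \<phi> = S (\<lambda>x. \<phi> x * (1 - \<zeta> x)) + 1 * S (\<lambda>x. \<zeta> x * \<phi> x)"
    by (subst eq) (rule test_linearD[OF S 2 one])
  moreover have "(\<integral>x. \<phi> x \<partial>lborel) = (\<integral>x. \<phi> x * (1 - \<zeta> x) \<partial>lborel) + 1 * (\<integral>x. \<zeta> x * \<phi> x \<partial>lborel)"
    by (subst eq) (rule test_linearD[OF test_linear_lborel_integral 2 one])
  ultimately show ?case using S1 S2 by (simp add: algebra_simps)
qed

lemma open_contains_box_cart:
  assumes "open (U :: (real^2) set)" "x \<in> U"
  shows "\<exists>a b. x \<in> box a b \<and> box a b \<subseteq> U \<and> (\<forall>i. a $ i < b $ i)"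
proof (rule open_contains_cbox[OF assms])
  fix a b assume ab: "cbox a b \<subseteq> U" "x \<in> box a b"
  have "a $ i < b $ i" for i
  proof -
    have "a $ i < x $ i \<and> x $ i < b $ i" using ab(2) by (simp add: mem_box_cart)
    then show ?thesis by simp
  qed
  then show ?thesis using ab box_subset_cbox[of a b] by (intro exI[of _ a] exI[of _ b]) auto
qed

text \<open>On each box in \<open>\<Omega>\<close> the functional is a multiple of the integral. The factor is the same on
overlapping boxes, because a bump in the overlap detects it, hence locally constant and by
connectedness constant; cutoffs then pass from boxes to \<open>\<Omega>\<close>.\<close>

theorem gradient_free_functional:
  assumes \<Omega>: "open \<Omega>" "connected \<Omega>" and S: "test_linear \<Omega> S"
    and S0: "\<And>\<psi> j. \<psi> \<in> test_functions \<Omega> \<Longrightarrow> S (partial j \<psi>) = 0"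
  shows "\<exists>c. \<forall>\<phi>\<in>test_functions \<Omega>. S \<phi> = c * (\<integral>x. \<phi> x \<partial>lborel)"
proof -
  define loc where "loc c U \<longleftrightarrow> U \<subseteq> \<Omega> \<and> (\<forall>\<phi>\<in>test_functions U. S \<phi> = c * (\<integral>x. \<phi> x \<partial>lborel))" for c U
  have "\<exists>c a b. x \<in> box a b \<and> loc c (box a b)" if "x \<in> \<Omega>" for x
  proof -
    obtain a b where ab: "x \<in> box a b" and sub: "box a b \<subseteq> \<Omega>" and lt: "\<And>i. a $ i < b $ i"
      using open_contains_box_cart[OF \<Omega>(1) \<open>x \<in> \<Omega>\<close>] by auto
    have "\<exists>c. \<forall>\<phi>\<in>test_functions (box a b). S \<phi> = c * (\<integral>x. \<phi> x \<partial>lborel)"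
    proof (rule gradient_free_functional_on_box[OF test_linear_mono[OF S sub] S0])
      show "\<psi> \<in> test_functions (box a b) \<Longrightarrow> \<psi> \<in> test_functions \<Omega>" for \<psi>
        using test_functions_mono[OF sub] by blast
      show "a $ i < b $ i" for i by (rule lt)
    qed
    then show ?thesis using ab sub unfolding loc_def by blast
  qed
  then obtain c where c: "\<And>x. x \<in> \<Omega> \<Longrightarrow> \<exists>a b. x \<in> box a b \<and> loc (c x) (box a b)" by metis
  have same: "k = k'" if k: "loc k U" "loc k' U'" "open U" "open U'" "y \<in> U \<inter> U'" for k k' U U' and y :: "real^2"
  proof -
    obtain a b where sub: "box a b \<subseteq> U \<inter> U'" and lt: "\<And>i. a $ i < b $ i"
      using open_contains_box_cart[OF open_Int[OF k(3,4)] k(5)] by auto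
    define l u where "l = (\<chi> i. (2 * a $ i + b $ i) / 3)" and "u = (\<chi> i. (a $ i + 2 * b $ i) / 3)"
    have lu: "\<And>i. a $ i < l $ i" "\<And>i. l $ i < u $ i" "\<And>i. u $ i < b $ i"
      using lt by (auto simp: l_def u_def field_simps)
    have "box_bump l u \<in> test_functions (box a b)" by (rule box_bump_test) (use lu in auto)
    then have "box_bump l u \<in> test_functions U" "box_bump l u \<in> test_functions U'"
      using sub test_functions_mono[of "box a b" U] test_functions_mono[of "box a b" U'] by auto
    then have "k * (\<integral>x. box_bump l u x \<partial>lborel) = k' * (\<integral>x. box_bump l u x \<partial>lborel)"
      using k(1,2) unfolding loc_def by metis
    then show ?thesis using box_bump_integral_pos[of l u, OF lu(2)] by simp
  qed
  have "c constant_on \<Omega>"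
  proof (rule locally_constant_imp_constant[OF \<Omega>(2)])
    fix x assume x: "x \<in> \<Omega>"
    obtain a b where ab: "x \<in> box a b" "loc (c x) (box a b)" using c[OF x] by blast
    have "c y = c x" if "y \<in> box a b" for y
    proof -
      have "y \<in> \<Omega>" using ab(2) that unfolding loc_def by blast
      then obtain a' b' where "y \<in> box a' b'" "loc (c y) (box a' b')" using c by blast
      then show ?thesis using same[of "c y" "box a' b'" "c x" "box a b" y] ab that by (simp add: open_box)
    qed
    moreover have "openin (top_of_set \<Omega>) (box a b)"
      using ab(2) unfolding loc_def by (intro open_openin_trans[OF \<Omega>(1) open_box]) blast
    ultimately show "\<exists>T. openin (top_of_set \<Omega>) T \<and> x \<in> T \<and> (\<forall>y\<in>T. c y = c x)" using ab(1) by blast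
  qed
  then obtain k where k: "\<And>x. x \<in> \<Omega> \<Longrightarrow> c x = k" unfolding constant_on_def by blast
  have "S \<phi> = k * (\<integral>x. \<phi> x \<partial>lborel)" if \<phi>: "\<phi> \<in> test_functions \<Omega>" for \<phi>
  proof (rule test_functionsE[OF \<phi>])
    fix K assume K: "smooth \<phi>" "compact K" "K \<subseteq> \<Omega>" "\<And>x. x \<notin> K \<Longrightarrow> \<phi> x = 0"
    define G where "G V \<longleftrightarrow> open V \<and> (\<exists>U \<zeta>. U \<subseteq> \<Omega> \<and> (\<forall>\<phi>\<in>test_functions U. S \<phi> = k * (\<integral>x. \<phi> x \<partial>lborel))
        \<and> \<zeta> \<in> test_functions U \<and> (\<forall>y\<in>V. \<zeta> y = 1))" for V
    have "K \<subseteq> \<Union>{V. G V}"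
    proof
      fix x assume "x \<in> K"
      then have x: "x \<in> \<Omega>" using K by blast
      obtain a b where ab: "x \<in> box a b" "loc k (box a b)" using c[OF x] k[OF x] by auto
      obtain \<zeta> V where "\<zeta> \<in> test_functions (box a b)" "open V" "x \<in> V" "\<forall>y\<in>V. \<zeta> y = 1"
        using cutoff_exists[OF ab(1)] by blast
      then have "G V" using ab(2) unfolding G_def loc_def by blast
      then show "x \<in> \<Union>{V. G V}" using \<open>x \<in> V\<close> by blast
    qed
    moreover have "\<And>V. V \<in> {V. G V} \<Longrightarrow> open V" by (simp add: G_def)
    ultimately obtain F where F: "F \<subseteq> {V. G V}" "finite F" "K \<subseteq> \<Union>F"
      using compactE[OF K(2)] by metis
    show ?thesis
    proof (rule functional_eq_integral_if_covered[OF F(2) S _ \<phi> K(2) F(3) K(4)])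
      show "open V \<and> (\<exists>U \<zeta>. U \<subseteq> \<Omega> \<and> (\<forall>\<phi>\<in>test_functions U. S \<phi> = k * (\<integral>x. \<phi> x \<partial>lborel))
        \<and> \<zeta> \<in> test_functions U \<and> (\<forall>y\<in>V. \<zeta> y = 1))" if "V \<in> F" for V
        using that F(1) unfolding G_def by blast
    qed
  qed
  then show ?thesis by blast
qed

section \<open>Distributions with zero second derivatives are affine\<close>

lemma test_functions_smooth: "f \<in> test_functions \<Omega> \<Longrightarrow> smooth f"
  by (rule test_functionsE)

lemma partial_test_lin:
  assumes "f \<in> test_functions \<Omega>" "g \<in> test_functions \<Omega>"
  shows "partial j (\<lambda>x. f x + c * g x) = (\<lambda>x. partial j f x + c * partial j g x)"
proof -
  have s: "smooth f" "smooth g" using assms by (auto intro: test_functions_smooth)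
  have "partial j (\<lambda>x. c * g x) = (\<lambda>x. c * partial j g x)"
    using partial_mult[of "\<lambda>x. c" g j] s smooth_differentiable by (simp add: partial_const)
  moreover have "\<forall>x. (\<lambda>x. c * g x) differentiable at x"
    using smooth_differentiable[OF smooth_mult[OF smooth_const s(2)]] by blast
  ultimately show ?thesis
    using partial_add[of f "\<lambda>x. c * g x" j] s smooth_differentiable by simp
qed

lemma test_linear_partial:
  assumes "test_linear \<Omega> S"
  shows "test_linear \<Omega> (\<lambda>\<phi>. S (partial j \<phi>))"
  unfolding test_linear_def
  by (intro ballI allI) (simp add: partial_test_lin test_linearD[OF assms] test_functions_partial)

lemma integral_coordinate_partial:
  assumes \<phi>: "\<phi> \<in> test_functions \<Omega>"
  shows "(\<integral>x. x $ j * partial i \<phi> x \<partial>lborel) = (if i = j then - (\<integral>x. \<phi> x \<partial>lborel) else 0)"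
proof -
  have sm: "smooth \<phi>" by (rule test_functionsE[OF \<phi>])
  have P: "partial i (\<lambda>x. x $ j) = (\<lambda>x. axis i 1 $ j)"
    by (rule ext, rule partial_has_derivative) (rule bounded_linear_imp_has_derivative[OF bounded_linear_vec_nth])
  have t: "(\<lambda>x. \<phi> x * x $ j) \<in> test_functions \<Omega>" by (rule test_functions_mult[OF \<phi> smooth_coordinate])
  have e: "partial i (\<lambda>x. \<phi> x * x $ j) = (\<lambda>x. \<phi> x * axis i 1 $ j + partial i \<phi> x * x $ j)"
    using partial_mult[of \<phi> "\<lambda>x. x $ j" i] smooth_differentiable[OF sm] smooth_differentiable[OF smooth_coordinate] P by simp
  have i1: "integrable lborel (\<lambda>x. \<phi> x * axis i 1 $ j)"
    using test_functions_integrable[OF \<phi>] by simp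
  have i2: "integrable lborel (\<lambda>x. partial i \<phi> x * x $ j)"
    by (rule test_functions_integrable[OF test_functions_mult[OF test_functions_partial[OF \<phi>] smooth_coordinate]])
  have "0 = (\<integral>x. \<phi> x * axis i 1 $ j \<partial>lborel) + (\<integral>x. partial i \<phi> x * x $ j \<partial>lborel)"
    using lborel_integral_partial[OF t, of i] unfolding e Bochner_Integration.integral_add[OF i1 i2] by simp
  then show ?thesis by (auto simp: axis_def mult.commute)
qed

text \<open>Each first derivative of \<open>S\<close> has zero gradient, so it is a constant. After subtraction of
the linear function with these slopes \<open>S\<close> itself has zero gradient.\<close>

theorem affine_functional:
  assumes \<Omega>: "open \<Omega>" "connected \<Omega>" and S: "test_linear \<Omega> S"
    and S0: "\<And>\<psi> i j. \<psi> \<in> test_functions \<Omega> \<Longrightarrow> S (partial i (partial j \<psi>)) = 0"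
  shows "\<exists>b c. \<forall>\<phi>\<in>test_functions \<Omega>. S \<phi> = (\<integral>x. (b + c \<bullet> x) * \<phi> x \<partial>lborel)"
proof -
  have "\<exists>d. \<forall>\<phi>\<in>test_functions \<Omega>. S (partial j \<phi>) = d * (\<integral>x. \<phi> x \<partial>lborel)" for j
    by (rule gradient_free_functional[OF \<Omega> test_linear_partial[OF S]]) (rule S0)
  then obtain d where d: "\<And>j \<phi>. \<phi> \<in> test_functions \<Omega> \<Longrightarrow> S (partial j \<phi>) = d j * (\<integral>x. \<phi> x \<partial>lborel)" by metis
  define c where "c = (\<chi> j. d j)"
  have smc: "smooth (\<lambda>x. c \<bullet> x)"
    unfolding inner_vec_def sum_2 inner_real_def
    by (intro smooth_add smooth_mult smooth_const smooth_coordinate)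
  have int: "integrable lborel (\<lambda>x. \<phi> x * (c \<bullet> x))" if "\<phi> \<in> test_functions \<Omega>" for \<phi>
    by (rule test_functions_integrable[OF test_functions_mult[OF that smc]])
  define S' where "S' \<phi> = S \<phi> + (\<integral>x. \<phi> x * (c \<bullet> x) \<partial>lborel)" for \<phi>
  have "test_linear \<Omega> S'"
    unfolding test_linear_def
  proof (intro ballI allI)
    fix f g k assume fg: "f \<in> test_functions \<Omega>" "g \<in> test_functions \<Omega>"
    have "(\<integral>x. (f x + k * g x) * (c \<bullet> x) \<partial>lborel) = (\<integral>x. f x * (c \<bullet> x) + k * (g x * (c \<bullet> x)) \<partial>lborel)"
      by (simp add: algebra_simps)
    also have "\<dots> = (\<integral>x. f x * (c \<bullet> x) \<partial>lborel) + k * (\<integral>x. g x * (c \<bullet> x) \<partial>lborel)"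
      using int[OF fg(1)] int[OF fg(2)] by simp
    finally show "S' (\<lambda>x. f x + k * g x) = S' f + k * S' g"
      unfolding S'_def test_linearD[OF S fg] by (simp add: algebra_simps)
  qed
  moreover have "S' (partial i \<phi>) = 0" if \<phi>: "\<phi> \<in> test_functions \<Omega>" for i \<phi>
  proof -
    have I: "integrable lborel (\<lambda>x. d j * (x $ j * partial i \<phi> x))" for j
      using test_functions_integrable[OF test_functions_mult[OF test_functions_partial[OF \<phi>] smooth_coordinate]]
      by (simp add: mult.commute)
    have "(\<integral>x. partial i \<phi> x * (c \<bullet> x) \<partial>lborel) = (\<integral>x. d 1 * (x $ 1 * partial i \<phi> x) + d 2 * (x $ 2 * partial i \<phi> x) \<partial>lborel)"
      by (simp add: c_def inner_vec_def sum_2 algebra_simps)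
    also have "\<dots> = d 1 * (\<integral>x. x $ 1 * partial i \<phi> x \<partial>lborel) + d 2 * (\<integral>x. x $ 2 * partial i \<phi> x \<partial>lborel)"
      using I[of 1] I[of 2] by simp
    also have "\<dots> = - (d i * (\<integral>x. \<phi> x \<partial>lborel))"
      using exhaust_2[of i] by (auto simp: integral_coordinate_partial[OF \<phi>])
    finally show ?thesis unfolding S'_def d[OF \<phi>] by simp
  qed
  ultimately obtain b where b: "\<And>\<phi>. \<phi> \<in> test_functions \<Omega> \<Longrightarrow> S' \<phi> = b * (\<integral>x. \<phi> x \<partial>lborel)"
    using gradient_free_functional[OF \<Omega>, of S'] by blast
  have "S \<phi> = (\<integral>x. (b + (- c) \<bullet> x) * \<phi> x \<partial>lborel)" if \<phi>: "\<phi> \<in> test_functions \<Omega>" for \<phi>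
  proof -
    have "(\<integral>x. (b + (- c) \<bullet> x) * \<phi> x \<partial>lborel) = (\<integral>x. b * \<phi> x - \<phi> x * (c \<bullet> x) \<partial>lborel)"
      by (simp add: algebra_simps)
    also have "\<dots> = b * (\<integral>x. \<phi> x \<partial>lborel) - (\<integral>x. \<phi> x * (c \<bullet> x) \<partial>lborel)"
      using int[OF \<phi>] test_functions_integrable[OF \<phi>] by simp
    finally show ?thesis using b[OF \<phi>] unfolding S'_def by simp
  qed
  then show ?thesis by blast
qed

lemma partial_test_commute:
  assumes "\<phi> \<in> test_functions \<Omega>"
  shows "partial i (partial j \<phi>) = partial j (partial i \<phi>)"
proof -
  obtain R where R: "\<And>j. slab_supported R j \<phi>" by (rule test_functions_slab_supported[OF assms]) (rule that)
  show ?thesis by (rule partial_commute[OF _ R]) (rule test_functionsE[OF assms])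
qed

text \<open>Every first-order relation may be tested with \<open>partial 1 \<phi>\<close> and \<open>partial 2 \<phi>\<close>. For any
three of the four components this gives six linear equations for the six second derivatives of
\<open>T\<close>, with only the trivial solution. If two components were missing, this would fail: curl and
divergence alone annihilate the gradient of every harmonic function.\<close>

lemma kernel_second_derivatives:
  fixes T :: "2 vector_distribution"
  assumes b: "card {i. b $ i = 0} \<le> 1"
    and T0: "\<And>\<phi> i. \<phi> \<in> test_functions \<Omega> \<Longrightarrow> b $ i * nabla_N T \<phi> $ i = 0"
    and \<phi>: "\<phi> \<in> test_functions \<Omega>"
  shows "T (partial i (partial j \<phi>)) $ k = 0"
proof -
  define X where "X i j k = T (partial i (partial j \<phi>)) $ k" for i j k
  have sym: "X 2 1 k = X 1 2 k" for k unfolding X_def using partial_test_commute[OF \<phi>] by simp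
  have two: "n = m" if "b $ n = 0" "b $ m = 0" for n m
    using b that card_le_Suc0_iff_eq[of "{i. b $ i = 0}"] by auto
  have N: "nabla_N T (partial j \<phi>) $ n = 0" if "b $ n \<noteq> 0" for n j
    using T0[OF test_functions_partial[OF \<phi>], of n j] that by simp
  have curl: "X 1 j 2 = X 2 j 1" if "b $ 1 \<noteq> 0" for j
    using N[OF that, of j] by (simp add: nabla_N_nth curl_def distr_partial_def component_def X_def)
  have div: "X 1 j 1 = - X 2 j 2" if "b $ 2 \<noteq> 0" for j
    using N[OF that, of j] by (simp add: nabla_N_nth divergence_def distr_partial_def component_def X_def)
  have sh1: "X 1 j 1 = X 2 j 2" if "b $ 3 \<noteq> 0" for j
    using N[OF that, of j] by (simp add: nabla_N_nth sh1_def distr_partial_def component_def X_def)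
  have sh2: "X 1 j 2 = - X 2 j 1" if "b $ 4 \<noteq> 0" for j
    using N[OF that, of j] by (simp add: nabla_N_nth sh2_def distr_partial_def component_def X_def)
  consider "b $ 2 \<noteq> 0" "b $ 3 \<noteq> 0" "b $ 4 \<noteq> 0" | "b $ 1 \<noteq> 0" "b $ 3 \<noteq> 0" "b $ 4 \<noteq> 0"
    | "b $ 1 \<noteq> 0" "b $ 2 \<noteq> 0" "b $ 4 \<noteq> 0" | "b $ 1 \<noteq> 0" "b $ 2 \<noteq> 0" "b $ 3 \<noteq> 0"
    using two[of 1 2] two[of 1 3] two[of 1 4] two[of 2 3] two[of 2 4] two[of 3 4] by auto
  then have "X 1 1 1 = 0 \<and> X 1 2 1 = 0 \<and> X 2 2 1 = 0 \<and> X 1 1 2 = 0 \<and> X 1 2 2 = 0 \<and> X 2 2 2 = 0"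
    by cases (use curl[of 1] curl[of 2] div[of 1] div[of 2] sh1[of 1] sh1[of 2] sh2[of 1] sh2[of 2] sym[of 1] sym[of 2] in linarith)+
  then have "X i j k = 0" using sym exhaust_2[of i] exhaust_2[of j] exhaust_2[of k] by auto
  then show ?thesis by (simp add: X_def)
qed

section \<open>A plane-filling curve\<close>

text \<open>An even function of period \<open>2\<close> which is \<open>0\<close> on \<open>[0, 1/3]\<close> and \<open>1\<close> on \<open>[2/3, 1]\<close>: on
\<open>[0, 1]\<close> the quotient \<open>arccos (cos (pi t)) / pi\<close> equals \<open>t\<close>.\<close>

definition zigzag :: "real \<Rightarrow> real" where
  "zigzag t = max 0 (min 1 (3 * arccos (cos (pi * t)) / pi - 1))"

lemma zigzag_continuous: "continuous_on A zigzag"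
  unfolding zigzag_def by (intro continuous_intros) auto

lemma zigzag_bounds: "0 \<le> zigzag t" "zigzag t \<le> 1"
  by (auto simp: zigzag_def)

lemma zigzag_periodic: "zigzag (2 * of_int m + t) = zigzag t"
proof -
  have "cos (pi * (2 * of_int m + t)) = cos (pi * t + 2 * pi * of_int m)" by (simp add: algebra_simps)
  also have "\<dots> = cos (pi * t)" by (simp add: cos_add)
  finally show ?thesis by (simp add: zigzag_def)
qed

lemma zigzag_eq:
  assumes "0 \<le> t" "t \<le> 1"
  shows "t \<le> 1/3 \<Longrightarrow> zigzag t = 0" "2/3 \<le> t \<Longrightarrow> zigzag t = 1"
proof -
  have "arccos (cos (pi * t)) = pi * t" using assms by (intro arccos_cos) auto
  then have "zigzag t = max 0 (min 1 (3 * t - 1))" by (simp add: zigzag_def)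
  then show "t \<le> 1/3 \<Longrightarrow> zigzag t = 0" "2/3 \<le> t \<Longrightarrow> zigzag t = 1" by auto
qed

lemma binary_expansion:
  assumes "0 \<le> r" "r \<le> 1"
  shows "\<exists>a :: nat \<Rightarrow> bool. (\<lambda>k. (1/2)^(Suc k) * of_bool (a k)) sums (r :: real)"
proof -
  \<comment> \<open>The remainder after \<open>n\<close> digits, scaled back to \<open>[0,1]\<close>.\<close>
  define R where "R = rec_nat r (\<lambda>_ q. 2 * q - of_bool (1/2 \<le> q))"
  have R0: "R 0 = r" and RS: "R (Suc n) = 2 * R n - of_bool (1/2 \<le> R n)" for n by (auto simp: R_def)
  have Rb: "0 \<le> R n \<and> R n \<le> 1" for n
    by (induction n) (use assms in \<open>auto simp: R0 RS\<close>)
  have S: "(\<Sum>k<n. (1/2)^(Suc k) * of_bool (1/2 \<le> R k)) = r - (1/2)^n * R n" for n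
    by (induction n) (auto simp: R0 RS algebra_simps)
  have "(\<lambda>n. (1/2)^n * R n) \<longlonglongrightarrow> 0"
  proof (rule Lim_null_comparison)
    show "\<forall>\<^sub>F n in sequentially. norm ((1/2)^n * R n) \<le> (1/2)^n"
      using Rb by (auto simp: abs_mult intro!: mult_left_le)
  qed (simp add: LIMSEQ_power_zero)
  then have "(\<lambda>n. r - (1/2)^n * R n) \<longlonglongrightarrow> r - 0" by (intro tendsto_intros)
  then show ?thesis unfolding sums_def S[symmetric] by auto
qed

text \<open>The point of the Cantor set with ternary digits \<open>2 c\<^sub>k\<close>.\<close>

definition ternary :: "(nat \<Rightarrow> bool) \<Rightarrow> real" where
  "ternary c = (\<Sum>k. (1/3)^(Suc k) * (2 * of_bool (c k)))"

lemma ternary_summable: "summable (\<lambda>k. (1/3)^(Suc k) * (2 * of_bool (c k) :: real))"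
  by (rule summable_comparison_test[of _ "\<lambda>k. (1/3)^k * (2/3)"]) (auto intro!: summable_mult2 exI[of _ 0])

lemma ternary_bounds: "0 \<le> ternary c" "ternary c \<le> 1"
proof -
  show "0 \<le> ternary c" unfolding ternary_def by (intro suminf_nonneg ternary_summable) auto
  have "ternary c \<le> (\<Sum>k. (1/3)^k * (2/3))"
    unfolding ternary_def by (intro suminf_le ternary_summable summable_mult2) auto
  also have "\<dots> = 1" by (subst suminf_mult2[symmetric]) (auto simp: suminf_geometric)
  finally show "ternary c \<le> 1" .
qed

lemma ternary_shift: "3 * ternary c = 2 * of_bool (c 0) + ternary (\<lambda>k. c (Suc k))"
proof -
  have "ternary c = (1/3) * (2 * of_bool (c 0)) + (\<Sum>k. (1/3)^(Suc (Suc k)) * (2 * of_bool (c (Suc k))))"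
    unfolding ternary_def using suminf_split_initial_segment[OF ternary_summable[of c], of 1] by simp
  also have "(\<Sum>k. (1/3)^(Suc (Suc k)) * (2 * of_bool (c (Suc k)))) = (1/3) * ternary (\<lambda>k. c (Suc k))"
    unfolding ternary_def by (subst suminf_mult[OF ternary_summable, symmetric]) (simp add: mult.assoc)
  finally show ?thesis by simp
qed

lemma ternary_power: "\<exists>m :: int. 3 ^ n * ternary c = 2 * of_int m + ternary (\<lambda>k. c (k + n))"
proof (induction n)
  case 0
  then show ?case by (intro exI[of _ 0]) simp
next
  case (Suc n)
  then obtain m :: int where "3 ^ n * ternary c = 2 * of_int m + ternary (\<lambda>k. c (k + n))" by blast
  then have "3 ^ Suc n * ternary c = 2 * of_int (3 * m) + 3 * ternary (\<lambda>k. c (k + n))" by simp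
  also have "\<dots> = 2 * of_int (3 * m + of_bool (c n)) + ternary (\<lambda>k. c (k + Suc n))"
    by (subst ternary_shift) simp
  finally show ?case by blast
qed

text \<open>As \<open>zigzag\<close> has period \<open>2\<close>, only the shifted digits count; the first of them puts the
point into \<open>[0, 1/3]\<close> or \<open>[2/3, 1]\<close>.\<close>

lemma zigzag_ternary: "zigzag (3 ^ n * ternary c) = of_bool (c n)"
proof -
  obtain m :: int where "3 ^ n * ternary c = 2 * of_int m + ternary (\<lambda>k. c (k + n))" using ternary_power by blast
  then have "zigzag (3 ^ n * ternary c) = zigzag (ternary (\<lambda>k. c (k + n)))" by (simp add: zigzag_periodic)
  moreover have "3 * ternary (\<lambda>k. c (k + n)) = 2 * of_bool (c n) + ternary (\<lambda>k. c (k + Suc n))"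
    by (subst ternary_shift) simp
  ultimately show ?thesis
    using ternary_bounds[of "\<lambda>k. c (k + n)"] ternary_bounds[of "\<lambda>k. c (k + Suc n)"]
    by (cases "c n") (auto simp: zigzag_eq)
qed

text \<open>Schoenberg's curve, with coordinates \<open>i = 0\<close> and \<open>i = 1\<close>: evaluated at a point of the
Cantor set, \<open>schoenberg 0\<close> reads the even and \<open>schoenberg 1\<close> the odd digits as binary
expansions.\<close>

definition schoenberg :: "nat \<Rightarrow> real \<Rightarrow> real" where
  "schoenberg i t = (\<Sum>k. (1/2)^(Suc k) * zigzag (3 ^ (2 * k + i) * t))"

lemma schoenberg_continuous: "continuous_on UNIV (schoenberg i)"
proof (rule uniform_limit_theorem[where F=sequentially])
  show "uniform_limit UNIV (\<lambda>n t. \<Sum>k<n. (1/2)^(Suc k) * zigzag (3 ^ (2 * k + i) * t)) (schoenberg i) sequentially"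
    unfolding schoenberg_def
  proof (rule Weierstrass_m_test)
    show "norm ((1/2)^(Suc k) * zigzag (3 ^ (2 * k + i) * t)) \<le> (1/2)^(Suc k)" for k t
      using zigzag_bounds by (auto simp: abs_mult intro!: mult_left_le)
    show "summable (\<lambda>k. (1/2)^(Suc k) :: real)" by simp
  qed
  show "\<forall>\<^sub>F n in sequentially. continuous_on UNIV (\<lambda>t. \<Sum>k<n. (1/2)^(Suc k) * zigzag (3 ^ (2 * k + i) * t))"
    by (intro always_eventually allI continuous_intros continuous_on_compose2[OF zigzag_continuous[of UNIV]]) auto
qed auto

lemma schoenberg_surj:
  assumes "0 \<le> x" "x \<le> 1" "0 \<le> y" "y \<le> 1"
  shows "\<exists>t\<in>{0..1}. schoenberg 0 t = x \<and> schoenberg 1 t = y"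
proof -
  obtain a b :: "nat \<Rightarrow> bool" where ab: "(\<lambda>k. (1/2)^(Suc k) * of_bool (a k)) sums x" "(\<lambda>k. (1/2)^(Suc k) * of_bool (b k)) sums y"
    using binary_expansion assms by meson
  define c where "c n = (if even n then a (n div 2) else b (n div 2))" for n
  have "schoenberg 0 (ternary c) = x" "schoenberg 1 (ternary c) = y"
    using ab unfolding schoenberg_def zigzag_ternary c_def by (auto simp: sums_iff)
  then show ?thesis using ternary_bounds[of c] by auto
qed

lemma peano_curve:
  assumes "bounded (S :: (real^2) set)"
  shows "\<exists>g :: real \<Rightarrow> real^2. continuous_on UNIV g \<and> S \<subseteq> g ` {0..1}"
proof -
  obtain L where L: "L > 0" "\<And>x. x \<in> S \<Longrightarrow> norm x \<le> L" using assms unfolding bounded_pos by blast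
  define g :: "real \<Rightarrow> real^2" where "g t = (\<chi> i. if i = 1 then L * (2 * schoenberg 0 t - 1) else L * (2 * schoenberg 1 t - 1))" for t
  have "continuous_on UNIV g"
    unfolding g_def
  proof (rule continuous_on_vec_lambda)
    show "continuous_on UNIV (\<lambda>t. if i = 1 then L * (2 * schoenberg 0 t - 1) else L * (2 * schoenberg 1 t - 1))" for i :: 2
      by (cases "i = 1") (auto intro!: continuous_intros schoenberg_continuous)
  qed
  moreover have "x \<in> g ` {0..1}" if x: "x \<in> S" for x
  proof -
    have b: "\<bar>x $ i\<bar> \<le> L" for i using L(2)[OF x] component_le_norm_cart[of x i] by simp
    obtain t where t: "t \<in> {0..1}" "schoenberg 0 t = (x $ 1 / L + 1) / 2" "schoenberg 1 t = (x $ 2 / L + 1) / 2"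
      using schoenberg_surj[of "(x $ 1 / L + 1) / 2" "(x $ 2 / L + 1) / 2"] b[of 1] b[of 2] L(1)
      by (auto simp: field_simps abs_le_iff)
    have "2 * schoenberg 0 t - 1 = x $ 1 / L" "2 * schoenberg 1 t - 1 = x $ 2 / L"
      unfolding t by (simp_all add: field_simps)
    then have "g t = x" using L(1) unfolding g_def vec_eq_iff forall_2 by simp
    then show ?thesis using t(1) by blast
  qed
  ultimately show ?thesis by blast
qed

text \<open>The smallest preimage in \<open>[0,1]\<close> is a measurable choice: its sublevel sets are images of
compact intervals.\<close>

lemma borel_section:
  fixes g :: "real \<Rightarrow> 'a::t2_space"
  assumes g: "continuous_on UNIV g" and S: "S \<subseteq> g ` {0..1}"
  shows "\<exists>s. s \<in> borel_measurable (restrict_space borel S) \<and> (\<forall>x\<in>S. s x \<in> {0..1} \<and> g (s x) = x)"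
proof -
  define T where "T x = {0..1} \<inter> g -` {x}" for x
  define s where "s x = Inf (T x)" for x
  have cT: "closed (T x)" for x
    unfolding T_def using continuous_closed_vimage[of "{x}" g] g by (intro closed_Int) (auto simp: continuous_on_eq_continuous_at)
  have s: "s x \<in> T x" if "x \<in> S" for x
    unfolding s_def using S that cT by (intro closed_contains_Inf) (auto simp: T_def)
  have le: "s x \<le> t" if "t \<in> T x" for x t
    unfolding s_def using that by (intro cInf_lower bdd_belowI[of _ 0]) (auto simp: T_def)
  have "{x \<in> space (restrict_space borel S). s x \<le> a} = S \<inter> g ` ({0..1} \<inter> {..a})" for a
  proof -
    have "s x \<le> a \<longleftrightarrow> x \<in> g ` ({0..1} \<inter> {..a})" if x: "x \<in> S" for x
    proof
      assume "s x \<le> a"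
      then show "x \<in> g ` ({0..1} \<inter> {..a})" using s[OF x] by (intro image_eqI[of _ _ "s x"]) (auto simp: T_def)
    next
      assume "x \<in> g ` ({0..1} \<inter> {..a})"
      then obtain t where "t \<in> T x" "t \<le> a" by (auto simp: T_def)
      then show "s x \<le> a" using le by (meson order_trans)
    qed
    then show ?thesis by (auto simp: space_restrict_space)
  qed
  moreover have "compact (g ` ({0..1} \<inter> {..a}))" for a
    by (intro compact_continuous_image continuous_on_subset[OF g] compact_Int_closed) auto
  ultimately have "{x \<in> space (restrict_space borel S). s x \<le> a} \<in> sets (restrict_space borel S)" for a
    unfolding sets_restrict_space by (simp only:) (intro imageI borel_compact)
  then have "s \<in> borel_measurable (restrict_space borel S)"
    unfolding borel_measurable_iff_le by blast
  then show ?thesis using s by (intro exI[of _ s]) (auto simp: T_def)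
qed

section \<open>Weak limits of bounded sequences of measures\<close>

text \<open>The integrands are those of \<open>C\<^sub>0(\<Omega>)\<close>, extended by zero; mass may escape to the boundary in
the limit.\<close>

definition vague_limit :: "(real^2) set \<Rightarrow> (nat \<Rightarrow> (real^2) measure) \<Rightarrow> (real^2) measure \<Rightarrow> bool" where
  "vague_limit \<Omega> P Q \<longleftrightarrow> finite_measure Q \<and> sets Q = sets (restrict_space borel \<Omega>) \<and>
    (\<forall>f :: real^2 \<Rightarrow> real. continuous_on UNIV f \<longrightarrow> bounded (range f) \<longrightarrow> (\<forall>x. x \<notin> \<Omega> \<longrightarrow> f x = 0) \<longrightarrow>
       (\<lambda>n. \<integral>x. f x \<partial>P n) \<longlonglongrightarrow> (\<integral>x. f x \<partial>Q))"

text \<open>The measures are normalized and pushed to \<open>[0,1]\<close> by the section \<open>s\<close>, where they are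
tight; the limit on the line is pushed back by the curve \<open>g\<close>. An integrand \<open>f\<close> on \<open>\<Omega>\<close> becomes
the continuous \<open>f \<circ> g\<close> on the line, with the same integrals because \<open>g \<circ> s\<close> is the identity.\<close>

lemma bounded_measures_subseq_convergent:
  fixes P :: "nat \<Rightarrow> (real^2) measure"
  assumes \<Omega>: "bounded \<Omega>" "\<Omega> \<in> sets borel"
    and sets: "\<And>n. sets (P n) = sets (restrict_space borel \<Omega>)"
    and fin: "\<And>n. finite_measure (P n)" and mass: "\<And>n. measure (P n) \<Omega> \<le> C"
  shows "\<exists>r Q. strict_mono (r :: nat \<Rightarrow> nat) \<and> vague_limit \<Omega> (\<lambda>n. P (r n)) Q"
proof -
  obtain g :: "real \<Rightarrow> real^2" where g: "continuous_on UNIV g" "\<Omega> \<subseteq> g ` {0..1}"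
    using peano_curve[OF \<Omega>(1)] by blast
  obtain s where s: "s \<in> borel_measurable (restrict_space borel \<Omega>)" "\<And>x. x \<in> \<Omega> \<Longrightarrow> s x \<in> {0..1}" "\<And>x. x \<in> \<Omega> \<Longrightarrow> g (s x) = x"
    using borel_section[OF g] by blast
  have space: "space (P n) = \<Omega>" for n
    using sets_eq_imp_space_eq[OF sets[of n]] by (simp add: space_restrict_space)
  have sP: "s \<in> borel_measurable (P n)" for n
    using s(1) measurable_cong_sets[OF sets refl] by blast
  have gm: "g \<in> borel_measurable borel" by (rule borel_measurable_continuous_onI[OF g(1)])
  define m where "m n = measure (P n) \<Omega>" for n
  have m: "0 \<le> m n" "m n \<le> C" for n using mass by (auto simp: m_def)
  have "compact {0..C}" by simp
  then obtain m' q where q: "strict_mono q" "(m \<circ> q) \<longlonglongrightarrow> m'"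
    using m unfolding compact_def by (metis atLeastAtMost_iff)
  have m': "0 \<le> m'" using q(2) m by (intro LIMSEQ_le_const[OF q(2)]) auto
  \<comment> \<open>If the mass is zero, any probability measure will do, as its weight \<open>m n\<close> in the limit is zero.\<close>
  define N where "N n = (if m n = 0 then return borel 0 else distr (density (P n) (\<lambda>_. ennreal (1 / m n))) borel s)" for n
  have emass: "emeasure (P n) \<Omega> = ennreal (m n)" for n
    unfolding m_def using finite_measure.emeasure_eq_measure[OF fin] .
  have rd: "real_distribution (N n)" for n
  proof (cases "m n = 0")
    case True
    then show ?thesis
      by (auto simp: N_def real_distribution_def real_distribution_axioms_def intro!: prob_space_return)
  next
    case False
    then have "emeasure (density (P n) (\<lambda>_. ennreal (1 / m n))) \<Omega> = 1"
      using m(1)[of n] sets.top[of "P n"] unfolding space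
      by (subst emeasure_density) (auto simp: nn_integral_cmult_indicator emass space simp flip: ennreal_mult)
    then have "prob_space (density (P n) (\<lambda>_. ennreal (1 / m n)))" by (intro prob_spaceI) (simp add: space)
    then show ?thesis using False sP[of n]
      by (auto simp: N_def real_distribution_def real_distribution_axioms_def intro!: prob_space.prob_space_distr)
  qed
  have conc: "measure (N n) {- 1<..2} = 1" for n
  proof -
    interpret N: real_distribution "N n" by (rule rd)
    have "AE x in N n. x \<in> {- 1<..2}"
    proof (cases "m n = 0")
      case True
      then have N0: "N n = return borel 0" by (simp add: N_def)
      show ?thesis unfolding N0 by (subst AE_return) auto
    next
      case False
      have "AE x in density (P n) (\<lambda>_. ennreal (1 / m n)). s x \<in> {- 1<..2}"
        using s(2) by (intro AE_I2) (force simp: space)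
      moreover have N1: "N n = distr (density (P n) (\<lambda>_. ennreal (1 / m n))) borel s"
        using False by (simp add: N_def)
      ultimately show ?thesis using sP[of n] unfolding N1 by (subst AE_distr_iff) auto
    qed
    then show ?thesis by (intro N.prob_eq_1[THEN iffD2]) auto
  qed
  have "tight N" unfolding tight_def
  proof (intro conjI allI impI rd)
    fix \<epsilon> :: real assume "0 < \<epsilon>"
    then show "\<exists>a b. a < b \<and> (\<forall>n. 1 - \<epsilon> < measure (N n) {a<..b})"
      by (intro exI[of _ "-1"] exI[of _ 2]) (simp add: conc)
  qed
  from tight_imp_convergent_subsubsequence[OF this q(1)]
  obtain r M where r: "strict_mono r" "real_distribution M" "weak_conv_m (N \<circ> q \<circ> r) M" by blast
  interpret M: real_distribution M by (rule r)
  define Q where "Q = restrict_space (density (distr M borel g) (\<lambda>_. ennreal m')) \<Omega>"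
  have setsQ: "sets Q = sets (restrict_space borel \<Omega>)"
    unfolding Q_def by (intro sets_restrict_space_cong) simp
  have finQ: "finite_measure Q"
  proof
    have "emeasure (density (distr M borel g) (\<lambda>_. ennreal m')) UNIV = m'"
      using gm M.emeasure_space_1 by (subst emeasure_density) (auto simp: nn_integral_distr emeasure_distr)
    then have "emeasure (density (distr M borel g) (\<lambda>_. ennreal m')) \<Omega> \<le> m'"
      by (metis emeasure_mono sets_density sets_distr space_borel sets.top subset_UNIV)
    then show "emeasure Q (space Q) \<noteq> \<infinity>"
      unfolding Q_def using \<Omega>(2) by (subst emeasure_restrict_space) (auto simp: space_restrict_space top_unique)
  qed
  have conv: "(\<lambda>n. \<integral>x. f x \<partial>P ((q \<circ> r) n)) \<longlonglongrightarrow> (\<integral>x. f x \<partial>Q)"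
    if f: "continuous_on UNIV f" "bounded (range f)" "\<And>x. x \<notin> \<Omega> \<Longrightarrow> f x = 0" for f :: "real^2 \<Rightarrow> real"
  proof -
    have fm: "f \<in> borel_measurable borel" by (rule borel_measurable_continuous_onI[OF f(1)])
    have fP: "f \<in> borel_measurable (P n)" for n
      using measurable_restrict_space1[OF fm, of \<Omega>] measurable_cong_sets[OF sets refl] by blast
    obtain B where B: "\<And>x. norm (f x) \<le> B" using f(2) unfolding bounded_iff by auto
    have fg: "(\<lambda>t. f (g t)) \<in> borel_measurable borel" using measurable_compose[OF gm fm] .
    have "(\<lambda>n. \<integral>t. f (g t) \<partial>(N \<circ> q \<circ> r) n) \<longlonglongrightarrow> (\<integral>t. f (g t) \<partial>M)"
    proof (rule weak_conv_imp_integral_bdd_continuous_conv[OF _ r(2,3)])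
      show "real_distribution ((N \<circ> q \<circ> r) n)" for n using rd by simp
      show "isCont (\<lambda>t. f (g t)) t" for t
        using continuous_on_compose2[OF f(1) g(1)] by (simp add: continuous_on_eq_continuous_at)
    qed (rule B)
    moreover have "(m \<circ> q \<circ> r) \<longlonglongrightarrow> m'" by (rule LIMSEQ_subseq_LIMSEQ[OF q(2) r(1)])
    ultimately have "(\<lambda>n. (m \<circ> q \<circ> r) n * (\<integral>t. f (g t) \<partial>(N \<circ> q \<circ> r) n)) \<longlonglongrightarrow> m' * (\<integral>t. f (g t) \<partial>M)"
      by (intro tendsto_mult)
    moreover have "m n * (\<integral>t. f (g t) \<partial>N n) = (\<integral>x. f x \<partial>P n)" for n
    proof (cases "m n = 0")
      case True
      have "AE x in P n. f x = 0"
        by (rule AE_I[of _ _ \<Omega>]) (use True emass[of n] sets.top[of "P n"] in \<open>auto simp: space\<close>)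
      then show ?thesis using True fP[of n] by (simp add: integral_eq_zero_AE)
    next
      case False
      have "(\<integral>t. f (g t) \<partial>N n) = (\<integral>x. (1 / m n) *\<^sub>R f (g (s x)) \<partial>P n)"
        using False m(1)[of n] sP[of n] fg measurable_compose[OF sP[of n] fg]
        by (simp add: N_def integral_distr integral_density)
      also have "\<dots> = (\<integral>x. (1 / m n) *\<^sub>R f x \<partial>P n)"
        by (rule Bochner_Integration.integral_cong) (auto simp: space s)
      finally show ?thesis using False by simp
    qed
    moreover have "(\<integral>x. f x \<partial>Q) = m' * (\<integral>t. f (g t) \<partial>M)"
    proof -
      have "(\<integral>x. f x \<partial>Q) = (\<integral>x. indicator \<Omega> x *\<^sub>R f x \<partial>(density (distr M borel g) (\<lambda>_. ennreal m')))"
        unfolding Q_def using \<Omega>(2) by (subst integral_restrict_space) auto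
      also have "\<dots> = (\<integral>x. f x \<partial>(density (distr M borel g) (\<lambda>_. ennreal m')))"
        by (rule Bochner_Integration.integral_cong) (use f(3) in \<open>auto simp: indicator_def\<close>)
      also have "\<dots> = (\<integral>x. m' *\<^sub>R f x \<partial>(distr M borel g))"
        using m' fm by (subst integral_density) auto
      also have "\<dots> = (\<integral>t. m' *\<^sub>R f (g t) \<partial>M)"
        using gm fm by (subst integral_distr) auto
      finally show ?thesis by simp
    qed
    ultimately show ?thesis by (simp add: comp_def)
  qed
  show ?thesis
    using strict_mono_o[OF q(1) r(1)] finQ setsQ conv unfolding vague_limit_def
    by (intro exI[of _ "q \<circ> r"] exI[of _ Q]) auto
qed

section \<open>Signed measures and their integrals\<close>

text \<open>The scalar form of membership in \<open>radon_measures\<close>.\<close>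

definition signed_measure :: "(real^2) set \<Rightarrow> ((real^2) set \<Rightarrow> real) \<Rightarrow> bool" where
  "signed_measure \<Omega> \<nu> \<longleftrightarrow> (\<forall>A::nat \<Rightarrow> (real^2) set. range A \<subseteq> sets (restrict_space borel \<Omega>) \<longrightarrow>
     disjoint_family A \<longrightarrow> (\<lambda>n. \<nu> (A n)) sums \<nu> (\<Union>n. A n))"

lemma signed_measureD:
  assumes "signed_measure \<Omega> \<nu>" "range A \<subseteq> sets (restrict_space borel \<Omega>)" "disjoint_family A"
  shows "(\<lambda>n::nat. \<nu> (A n)) sums \<nu> (\<Union>n. A n)"
  using assms unfolding signed_measure_def by blast

lemma radon_measures_iff: "\<mu> \<in> radon_measures \<Omega> \<longleftrightarrow> (\<forall>i. signed_measure \<Omega> (\<lambda>A. \<mu> A $ i))"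
proof
  assume "\<mu> \<in> radon_measures \<Omega>"
  then show "\<forall>i. signed_measure \<Omega> (\<lambda>A. \<mu> A $ i)"
    unfolding radon_measures_def signed_measure_def
    by (auto intro!: bounded_linear.sums[OF bounded_linear_vec_nth])
next
  assume "\<forall>i. signed_measure \<Omega> (\<lambda>A. \<mu> A $ i)"
  then show "\<mu> \<in> radon_measures \<Omega>"
    unfolding radon_measures_def signed_measure_def sums_def
    by (auto intro!: vec_tendstoI)
qed

lemma signed_measure_uminus: "signed_measure \<Omega> \<nu> \<Longrightarrow> signed_measure \<Omega> (\<lambda>A. - \<nu> A)"
  unfolding signed_measure_def by (auto intro: sums_minus)

lemma signed_measure_add: "signed_measure \<Omega> \<nu> \<Longrightarrow> signed_measure \<Omega> \<nu>' \<Longrightarrow> signed_measure \<Omega> (\<lambda>A. \<nu> A + \<nu>' A)"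
  unfolding signed_measure_def by (auto intro: sums_add)

lemma signed_measure_empty:
  assumes "signed_measure \<Omega> \<nu>" shows "\<nu> {} = 0"
proof -
  have "(\<lambda>n::nat. \<nu> {}) sums \<nu> (\<Union>n::nat. {})"
    using assms unfolding signed_measure_def by (auto simp: disjoint_family_on_def)
  then have "summable (\<lambda>n::nat. \<nu> {})" by (rule sums_summable)
  then show ?thesis by (simp add: summable_const_iff)
qed

lemma signed_measure_Un:
  assumes \<nu>: "signed_measure \<Omega> \<nu>" and CD: "C \<in> sets (restrict_space borel \<Omega>)" "D \<in> sets (restrict_space borel \<Omega>)" "C \<inter> D = {}"
  shows "\<nu> (C \<union> D) = \<nu> C + \<nu> D"
proof -
  have "(\<lambda>n. \<nu> (binaryset C D n)) sums \<nu> (\<Union>n. binaryset C D n)"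
    by (rule signed_measureD[OF \<nu>]) (use CD in \<open>auto simp: binaryset_def disjoint_family_on_def\<close>)
  moreover have "(\<lambda>n. \<nu> (binaryset C D n)) sums (\<nu> C + \<nu> D)"
    using signed_measure_empty[OF \<nu>] by (rule binaryset_sums)
  ultimately show ?thesis by (simp add: UN_binaryset_eq sums_iff)
qed

text \<open>If \<open>\<nu>\<close> is unbounded on the subsets of \<open>E\<close>, then \<open>E\<close> splits into two parts with large
values of \<open>\<nu>\<close>, and \<open>\<nu>\<close> is unbounded on one of them. Splitting repeatedly produces disjoint sets
on which \<open>\<bar>\<nu>\<bar>\<close> exceeds \<open>1\<close>, against the convergence of the series.\<close>

lemma signed_measure_bounded:
  assumes \<nu>: "signed_measure \<Omega> \<nu>"
  shows "\<exists>c. \<forall>B\<in>sets (restrict_space borel \<Omega>). \<bar>\<nu> B\<bar> \<le> c"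
proof (rule ccontr)
  let ?S = "sets (restrict_space borel \<Omega>)"
  define unb where "unb E \<longleftrightarrow> E \<in> ?S \<and> (\<forall>c. \<exists>B\<in>?S. B \<subseteq> E \<and> c < \<bar>\<nu> B\<bar>)" for E
  assume "\<not> ?thesis"
  then have 0: "unb \<Omega>"
    unfolding unb_def using sets.sets_into_space[of _ "restrict_space borel \<Omega>"] sets.top[of "restrict_space borel \<Omega>"]
    by (fastforce simp: space_restrict_space not_le)
  have split: "\<nu> E = \<nu> (E \<inter> A) + \<nu> (E - A)" if "E \<in> ?S" "A \<in> ?S" for E A
    using signed_measure_Un[OF \<nu>, of "E \<inter> A" "E - A"] that by (simp add: Int_Diff_disjoint Int_Diff_Un)
  have step: "\<exists>E'. unb E' \<and> E' \<subseteq> E \<and> 1 < \<bar>\<nu> (E - E')\<bar>" if E: "unb E" for E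
  proof -
    obtain A where A: "A \<in> ?S" "A \<subseteq> E" "1 + \<bar>\<nu> E\<bar> < \<bar>\<nu> A\<bar>" using E unfolding unb_def by blast
    have ES: "E \<in> ?S" using E by (simp add: unb_def)
    have "E \<inter> A = A" using A(2) by blast
    then have "\<nu> E = \<nu> A + \<nu> (E - A)" using split[OF ES A(1)] by simp
    then have B: "1 < \<bar>\<nu> (E - A)\<bar>" using A(3) by linarith
    show ?thesis
    proof (cases "unb A")
      case True
      then show ?thesis using B A(2) by blast
    next
      case False
      then obtain c where c: "\<And>B. B \<in> ?S \<Longrightarrow> B \<subseteq> A \<Longrightarrow> \<bar>\<nu> B\<bar> \<le> c" using A(1) unfolding unb_def by (meson not_le)
      have "unb (E - A)" unfolding unb_def
      proof (intro conjI allI)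
        fix d
        obtain B where B: "B \<in> ?S" "B \<subseteq> E" "c + d < \<bar>\<nu> B\<bar>" using E unfolding unb_def by blast
        have "\<bar>\<nu> (B \<inter> A)\<bar> \<le> c" using c[of "B \<inter> A"] B(1) A(1) by blast
        then have "d < \<bar>\<nu> (B - A)\<bar>" using split[OF B(1) A(1)] B(3) by linarith
        then show "\<exists>B\<in>?S. B \<subseteq> E - A \<and> d < \<bar>\<nu> B\<bar>" using B A(1) by (intro bexI[of _ "B - A"]) auto
      qed (use ES A(1) in blast)
      moreover have "E - (E - A) = A" using A(2) by blast
      ultimately show ?thesis using A(3) by (intro exI[of _ "E - A"]) auto
    qed
  qed
  have "\<exists>f. \<forall>n. unb (f n) \<and> f (Suc n) \<subseteq> f n \<and> 1 < \<bar>\<nu> (f n - f (Suc n))\<bar>"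
    by (rule dependent_nat_choice) (use 0 step in auto)
  then obtain f where f: "\<And>n. unb (f n)" "\<And>n. f (Suc n) \<subseteq> f n" "\<And>n. 1 < \<bar>\<nu> (f n - f (Suc n))\<bar>"
    by auto
  have anti: "f n \<subseteq> f m" if "m \<le> n" for m n
    using lift_Suc_antimono_le[of f] f(2) that by blast
  have "disjoint_family (\<lambda>n. f n - f (Suc n))"
    unfolding disjoint_family_on_def
  proof (intro ballI impI)
    fix m n :: nat assume "m \<noteq> n"
    then consider "Suc m \<le> n" | "Suc n \<le> m" by linarith
    then show "(f m - f (Suc m)) \<inter> (f n - f (Suc n)) = {}"
      by cases (use anti in blast)+
  qed
  then have "(\<lambda>n. \<nu> (f n - f (Suc n))) sums \<nu> (\<Union>n. f n - f (Suc n))"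
    by (rule signed_measureD[OF \<nu>, rotated]) (use f(1) in \<open>auto simp: unb_def\<close>)
  then have "(\<lambda>n. \<nu> (f n - f (Suc n))) \<longlonglongrightarrow> 0" by (intro summable_LIMSEQ_zero sums_summable)
  then have "\<forall>\<^sub>F n in sequentially. \<bar>\<nu> (f n - f (Suc n))\<bar> < 1"
    by (auto dest!: tendstoD[where e=1] simp: dist_real_def)
  then show False using f(3) by (auto simp: eventually_sequentially) (meson less_asym order_refl)
qed

lemma emeasure_pos_part_scalar:
  assumes \<nu>: "signed_measure \<Omega> \<nu>" and A: "A \<in> sets (restrict_space borel \<Omega>)"
  shows "emeasure (pos_part \<Omega> \<nu>) A = pos_variation \<Omega> \<nu> A"
  using emeasure_pos_part[of "\<lambda>A. (\<chi> i. \<nu> A) :: real^1" \<Omega> A 1] assms by (simp add: radon_measures_iff)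

lemma sets_pos_part: "sets (pos_part \<Omega> \<nu>) = sets (restrict_space borel \<Omega>)"
  and space_pos_part: "space (pos_part \<Omega> \<nu>) = \<Omega>"
proof -
  have sa: "sigma_algebra \<Omega> (sets (restrict_space borel \<Omega>))"
    using sets.sigma_algebra_axioms[of "restrict_space borel \<Omega>"] by (simp add: space_restrict_space)
  show "sets (pos_part \<Omega> \<nu>) = sets (restrict_space borel \<Omega>)" "space (pos_part \<Omega> \<nu>) = \<Omega>"
    unfolding pos_part_def using sigma_algebra.sets_measure_of_eq[OF sa] sigma_algebra.space_measure_of_eq[OF sa] by auto
qed

lemma space_in_sets_restrict_space: "\<Omega> \<in> sets (restrict_space borel \<Omega>)"
  using sets.top[of "restrict_space borel \<Omega>"] by (simp add: space_restrict_space)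

lemma pos_variation_le:
  assumes "\<And>B. B \<in> sets (restrict_space borel \<Omega>) \<Longrightarrow> B \<subseteq> A \<Longrightarrow> \<nu> B \<le> c"
  shows "pos_variation \<Omega> \<nu> A \<le> ennreal c"
  unfolding pos_variation_def using assms by (auto intro!: SUP_least ennreal_leI)

lemma finite_pos_part:
  assumes \<nu>: "signed_measure \<Omega> \<nu>"
  shows "finite_measure (pos_part \<Omega> \<nu>)"
proof
  obtain c where c: "\<And>B. B \<in> sets (restrict_space borel \<Omega>) \<Longrightarrow> \<bar>\<nu> B\<bar> \<le> c"
    using signed_measure_bounded[OF \<nu>] by blast
  have "emeasure (pos_part \<Omega> \<nu>) \<Omega> \<le> ennreal c"
    unfolding emeasure_pos_part_scalar[OF \<nu> space_in_sets_restrict_space]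
    by (rule pos_variation_le) (use c in \<open>auto simp: abs_le_iff\<close>)
  then show "emeasure (pos_part \<Omega> \<nu>) (space (pos_part \<Omega> \<nu>)) \<noteq> \<infinity>"
    by (auto simp: space_pos_part top_unique)
qed

text \<open>For \<open>B \<subseteq> A\<close> one has \<open>\<nu> B = \<nu> A + (- \<nu>) (A - B)\<close>; the supremum over \<open>B\<close> gives one
inequality, and the other one follows by symmetry.\<close>

lemma jordan_decomposition:
  assumes \<nu>: "signed_measure \<Omega> \<nu>" and A: "A \<in> sets (restrict_space borel \<Omega>)"
  shows "\<nu> A = measure (pos_part \<Omega> \<nu>) A - measure (pos_part \<Omega> (\<lambda>A. - \<nu> A)) A"
proof -
  have le: "measure (pos_part \<Omega> \<kappa>) A \<le> \<kappa> A + measure (pos_part \<Omega> (\<lambda>A. - \<kappa> A)) A"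
    if \<kappa>: "signed_measure \<Omega> \<kappa>" for \<kappa>
  proof -
    let ?P = "pos_part \<Omega> \<kappa>" and ?N = "pos_part \<Omega> (\<lambda>A. - \<kappa> A)"
    interpret P: finite_measure ?P by (rule finite_pos_part[OF \<kappa>])
    interpret N: finite_measure ?N by (rule finite_pos_part[OF signed_measure_uminus[OF \<kappa>]])
    have N_ge: "- \<kappa> B \<le> measure ?N A" if "B \<in> sets (restrict_space borel \<Omega>)" "B \<subseteq> A" for B
    proof -
      have "ennreal (- \<kappa> B) \<le> pos_variation \<Omega> (\<lambda>A. - \<kappa> A) A"
        unfolding pos_variation_def using that by (intro SUP_upper) auto
      also have "\<dots> = ennreal (measure ?N A)"
        using emeasure_pos_part_scalar[OF signed_measure_uminus[OF \<kappa>] A] N.emeasure_eq_measure by simp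
      finally show ?thesis by (simp add: ennreal_le_iff)
    qed
    have "\<kappa> B \<le> \<kappa> A + measure ?N A" if B: "B \<in> sets (restrict_space borel \<Omega>)" "B \<subseteq> A" for B
    proof -
      have "\<kappa> A = \<kappa> B + \<kappa> (A - B)"
        using signed_measure_Un[OF \<kappa> B(1) sets.Diff[OF A B(1)]] B(2) by (simp add: Un_absorb1)
      moreover have "- \<kappa> (A - B) \<le> measure ?N A" using A B by (intro N_ge) auto
      ultimately show ?thesis by simp
    qed
    then have "ennreal (measure ?P A) \<le> ennreal (\<kappa> A + measure ?N A)"
      unfolding P.emeasure_eq_measure[symmetric] emeasure_pos_part_scalar[OF \<kappa> A] by (rule pos_variation_le)
    moreover have "0 \<le> \<kappa> A + measure ?N A" using N_ge[OF A] by simp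
    ultimately show ?thesis by (simp add: ennreal_le_iff)
  qed
  show ?thesis using le[OF \<nu>] le[OF signed_measure_uminus[OF \<nu>]] by simp
qed

lemma signed_measure_diff:
  assumes P: "finite_measure P" "sets P = sets (restrict_space borel \<Omega>)"
    and Q: "finite_measure Q" "sets Q = sets (restrict_space borel \<Omega>)"
  shows "signed_measure \<Omega> (\<lambda>A. measure P A - measure Q A)"
  unfolding signed_measure_def
  by (auto intro!: sums_diff finite_measure.finite_measure_UNION assms simp: assms)

text \<open>Relations between finite measures pass to integrals by approximation with simple
functions. Relations with several terms are what the Jordan parts of sums and differences of
signed measures satisfy.\<close>

lemma integral_combination_eq_0:
  fixes c :: "'i \<Rightarrow> real" and f :: "'a \<Rightarrow> real"
  assumes I: "finite I" and M: "\<And>i. i \<in> I \<Longrightarrow> finite_measure (M i)" "\<And>i. i \<in> I \<Longrightarrow> sets (M i) = sets N"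
    and eq: "\<And>A. A \<in> sets N \<Longrightarrow> (\<Sum>i\<in>I. c i * measure (M i) A) = 0"
    and f: "f \<in> borel_measurable N" "\<And>x. x \<in> space N \<Longrightarrow> \<bar>f x\<bar> \<le> B"
  shows "(\<Sum>i\<in>I. c i * (\<integral>x. f x \<partial>M i)) = 0"
proof -
  obtain F where F: "\<And>k. simple_function N (F k)" "\<And>x. x \<in> space N \<Longrightarrow> (\<lambda>k. F k x) \<longlonglongrightarrow> f x"
    "\<And>k x. x \<in> space N \<Longrightarrow> norm (F k x) \<le> 2 * norm (f x)"
  proof -
    obtain F where "\<forall>k. simple_function N (F k)" "\<forall>x\<in>space N. (\<lambda>k. F k x) \<longlonglongrightarrow> f x"
      "\<forall>k. \<forall>x\<in>space N. dist (F k x) 0 \<le> 2 * dist (f x) 0"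
      using borel_measurable_implies_sequence_metric[OF f(1), of 0] by blast
    then show thesis by (intro that[of F]) auto
  qed
  have sp: "space (M i) = space N" if "i \<in> I" for i by (rule sets_eq_imp_space_eq[OF M(2)[OF that]])
  have simple: "(\<Sum>i\<in>I. c i * (\<integral>x. F k x \<partial>M i)) = 0" for k
  proof -
    have "(\<integral>x. F k x \<partial>M i) = (\<Sum>y\<in>F k ` space N. measure (M i) {x \<in> space N. F k x = y} * y)" if i: "i \<in> I" for i
    proof -
      have "simple_function (M i) (F k)"
        using F(1)[of k] by (simp add: simple_function_def sp[OF i] M(2)[OF i])
      then have "Bochner_Integration.simple_bochner_integrable (M i) (F k)"
        using finite_measure.emeasure_finite[OF M(1)[OF i]]
        by (intro Bochner_Integration.simple_bochner_integrable.intros) auto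
      from has_bochner_integral_integral_eq[OF has_bochner_integral_simple_bochner_integrable[OF this]]
      show ?thesis by (simp add: Bochner_Integration.simple_bochner_integral_def sp[OF i])
    qed
    then have "(\<Sum>i\<in>I. c i * (\<integral>x. F k x \<partial>M i)) =
        (\<Sum>i\<in>I. \<Sum>y\<in>F k ` space N. y * (c i * measure (M i) {x \<in> space N. F k x = y}))"
      by (intro sum.cong) (auto simp: sum_distrib_left algebra_simps)
    also have "\<dots> = (\<Sum>y\<in>F k ` space N. y * (\<Sum>i\<in>I. c i * measure (M i) {x \<in> space N. F k x = y}))"
      by (subst sum.swap) (simp add: sum_distrib_left)
    also have "\<dots> = 0"
    proof (intro sum.neutral ballI)
      fix y assume "y \<in> F k ` space N"
      have "{x \<in> space N. F k x = y} \<in> sets N" using simple_functionD(2)[OF F(1)[of k], of "{y}"] by (simp add: vimage_def Int_def conj_commute)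
      then show "y * (\<Sum>i\<in>I. c i * measure (M i) {x \<in> space N. F k x = y}) = 0" by (simp add: eq)
    qed
    finally show ?thesis .
  qed
  have "(\<lambda>k. \<Sum>i\<in>I. c i * (\<integral>x. F k x \<partial>M i)) \<longlonglongrightarrow> (\<Sum>i\<in>I. c i * (\<integral>x. f x \<partial>M i))"
  proof (intro tendsto_sum tendsto_mult tendsto_const)
    fix i assume i: "i \<in> I"
    interpret finite_measure "M i" by (rule M(1)[OF i])
    have meas: "h \<in> borel_measurable (M i)" if "h \<in> borel_measurable N" for h :: "'a \<Rightarrow> real"
      using that measurable_cong_sets[OF M(2)[OF i] refl] by blast
    show "(\<lambda>k. \<integral>x. F k x \<partial>M i) \<longlonglongrightarrow> (\<integral>x. f x \<partial>M i)"
    proof (rule integral_dominated_convergence[where w="\<lambda>_. 2 * B"])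
      show "AE x in M i. (\<lambda>k. F k x) \<longlonglongrightarrow> f x" using F(2) by (intro AE_I2) (simp add: sp[OF i])
      show "AE x in M i. norm (F k x) \<le> 2 * B" for k
      proof (rule AE_I2)
        fix x assume "x \<in> space (M i)"
        then have x: "x \<in> space N" by (simp add: sp[OF i])
        show "norm (F k x) \<le> 2 * B" using F(3)[OF x, of k] f(2)[OF x] by simp
      qed
      show "f \<in> borel_measurable (M i)" by (rule meas[OF f(1)])
      show "F k \<in> borel_measurable (M i)" for k by (rule meas[OF borel_measurable_simple_function[OF F(1)]])
    qed simp
  qed
  then show ?thesis unfolding simple by (simp add: LIMSEQ_const_iff)
qed

text \<open>The integral may be computed from any representation of \<open>\<nu>\<close> as a difference of finite
measures, not just from the Jordan decomposition.\<close>

lemma signed_integral_eq: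
  assumes P: "finite_measure P" "sets P = sets (restrict_space borel \<Omega>)"
    and Q: "finite_measure Q" "sets Q = sets (restrict_space borel \<Omega>)"
    and \<nu>: "\<And>A. A \<in> sets (restrict_space borel \<Omega>) \<Longrightarrow> \<nu> A = measure P A - measure Q A" "signed_measure \<Omega> \<nu>"
    and f: "f \<in> borel_measurable (restrict_space borel \<Omega>)" "\<And>x. x \<in> \<Omega> \<Longrightarrow> \<bar>f x\<bar> \<le> B"
  shows "signed_integral \<Omega> \<nu> f = (\<integral>x. f x \<partial>P) - (\<integral>x. f x \<partial>Q)"
proof -
  \<comment> \<open>\<open>\<nu>\<^sup>+ - \<nu>\<^sup>- - P + Q\<close> vanishes on all sets, hence also as a functional.\<close>
  define M where "M i = [pos_part \<Omega> \<nu>, pos_part \<Omega> (\<lambda>A. - \<nu> A), P, Q] ! i" for i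
  define c where "c i = [1, -1, -1, 1 :: real] ! i" for i
  have "(\<Sum>i\<in>{0,1,2,3}. c i * (\<integral>x. f x \<partial>M i)) = 0"
  proof (rule integral_combination_eq_0[where N="restrict_space borel \<Omega>"])
    show "finite_measure (M i)" "sets (M i) = sets (restrict_space borel \<Omega>)" if "i \<in> {0,1,2,3}" for i
      using that P Q finite_pos_part[OF \<nu>(2)] finite_pos_part[OF signed_measure_uminus[OF \<nu>(2)]] sets_pos_part
      by (auto simp: M_def numeral_eq_Suc)
    show "(\<Sum>i\<in>{0,1,2,3}. c i * measure (M i) A) = 0" if "A \<in> sets (restrict_space borel \<Omega>)" for A
      using \<nu>(1)[OF that] jordan_decomposition[OF \<nu>(2) that] by (simp add: M_def c_def numeral_eq_Suc)
  qed (use f in \<open>auto simp: space_restrict_space\<close>)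
  then show ?thesis by (simp add: M_def c_def numeral_eq_Suc signed_integral_def)
qed

lemma signed_integral_add:
  assumes \<nu>: "signed_measure \<Omega> \<nu>" "signed_measure \<Omega> \<nu>'"
    and f: "f \<in> borel_measurable (restrict_space borel \<Omega>)" "\<And>x. x \<in> \<Omega> \<Longrightarrow> \<bar>f x\<bar> \<le> B"
  shows "signed_integral \<Omega> (\<lambda>A. \<nu> A + \<nu>' A) f = signed_integral \<Omega> \<nu> f + signed_integral \<Omega> \<nu>' f"
proof -
  note s = signed_measure_add[OF \<nu>]
  define M where "M i = [pos_part \<Omega> (\<lambda>A. \<nu> A + \<nu>' A), pos_part \<Omega> (\<lambda>A. - (\<nu> A + \<nu>' A)),
    pos_part \<Omega> \<nu>, pos_part \<Omega> (\<lambda>A. - \<nu> A), pos_part \<Omega> \<nu>', pos_part \<Omega> (\<lambda>A. - \<nu>' A)] ! i" for i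
  define c where "c i = [1, -1, -1, 1, -1, 1 :: real] ! i" for i
  have "(\<Sum>i\<in>{0,1,2,3,4,5}. c i * (\<integral>x. f x \<partial>M i)) = 0"
  proof (rule integral_combination_eq_0[where N="restrict_space borel \<Omega>"])
    show "finite_measure (M i)" "sets (M i) = sets (restrict_space borel \<Omega>)" if "i \<in> {0,1,2,3,4,5}" for i
      using that finite_pos_part[OF \<nu>(1)] finite_pos_part[OF signed_measure_uminus[OF \<nu>(1)]]
        finite_pos_part[OF \<nu>(2)] finite_pos_part[OF signed_measure_uminus[OF \<nu>(2)]]
        finite_pos_part[OF s] finite_pos_part[OF signed_measure_uminus[OF s]] sets_pos_part
      by (auto simp: M_def numeral_eq_Suc)
    show "(\<Sum>i\<in>{0,1,2,3,4,5}. c i * measure (M i) A) = 0" if "A \<in> sets (restrict_space borel \<Omega>)" for A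
      using jordan_decomposition[OF \<nu>(1) that] jordan_decomposition[OF \<nu>(2) that] jordan_decomposition[OF s that]
      by (simp add: M_def c_def numeral_eq_Suc)
  qed (use f in \<open>auto simp: space_restrict_space\<close>)
  then show ?thesis by (simp add: M_def c_def numeral_eq_Suc signed_integral_def)
qed

section \<open>Weak compactness of vector measures\<close>

lemma signed_integral_uminus: "signed_integral \<Omega> (\<lambda>A. - \<nu> A) f = - signed_integral \<Omega> \<nu> f"
  by (simp add: signed_integral_def)

lemma signed_integral_cong: "(\<And>x. x \<in> \<Omega> \<Longrightarrow> f x = g x) \<Longrightarrow> signed_integral \<Omega> \<nu> f = signed_integral \<Omega> \<nu> g"
  unfolding signed_integral_def
  by (intro arg_cong2[where f="(-)"] Bochner_Integration.integral_cong) (auto simp: space_pos_part)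

lemma signed_integral_zero: "signed_integral \<Omega> \<nu> (\<lambda>x. 0) = 0"
  by (simp add: signed_integral_def)

lemma signed_integral_cmult: "signed_integral \<Omega> \<nu> (\<lambda>x. c * f x) = c * signed_integral \<Omega> \<nu> f"
  by (simp add: signed_integral_def algebra_simps)

lemma bounded_integrable_restrict:
  assumes "finite_measure P" "sets P = sets (restrict_space borel \<Omega>)"
    and f: "f \<in> borel_measurable (restrict_space borel \<Omega>)" "\<And>x. x \<in> \<Omega> \<Longrightarrow> \<bar>f x\<bar> \<le> B"
  shows "integrable P (f :: real^2 \<Rightarrow> real)"
proof (rule finite_measure.integrable_const_bound[OF assms(1), of _ B])
  have "space P = \<Omega>" using sets_eq_imp_space_eq[OF assms(2)] by (simp add: space_restrict_space)
  then show "AE x in P. norm (f x) \<le> B" using f(2) by (intro AE_I2) simp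
  show "f \<in> borel_measurable P" using f(1) measurable_cong_sets[OF assms(2) refl] by blast
qed

lemma signed_integral_lin:
  assumes \<nu>: "signed_measure \<Omega> \<nu>"
    and f: "f \<in> borel_measurable (restrict_space borel \<Omega>)" "\<And>x. x \<in> \<Omega> \<Longrightarrow> \<bar>f x\<bar> \<le> B"
    and g: "g \<in> borel_measurable (restrict_space borel \<Omega>)" "\<And>x. x \<in> \<Omega> \<Longrightarrow> \<bar>g x\<bar> \<le> B'"
  shows "signed_integral \<Omega> \<nu> (\<lambda>x. f x + c * g x) = signed_integral \<Omega> \<nu> f + c * signed_integral \<Omega> \<nu> g"
proof -
  have i: "integrable (pos_part \<Omega> \<nu>) f" "integrable (pos_part \<Omega> \<nu>) g"
    "integrable (pos_part \<Omega> (\<lambda>A. - \<nu> A)) f" "integrable (pos_part \<Omega> (\<lambda>A. - \<nu> A)) g"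
    using bounded_integrable_restrict[OF finite_pos_part[OF \<nu>] sets_pos_part f] bounded_integrable_restrict[OF finite_pos_part[OF \<nu>] sets_pos_part g]
    bounded_integrable_restrict[OF finite_pos_part[OF signed_measure_uminus[OF \<nu>]] sets_pos_part f]
    bounded_integrable_restrict[OF finite_pos_part[OF signed_measure_uminus[OF \<nu>]] sets_pos_part g] by auto
  show ?thesis unfolding signed_integral_def using i by (simp add: algebra_simps)
qed

text \<open>By regularity \<open>A\<close> is approximated from inside by a compact \<open>K\<close> with respect to the
positive part, and from outside by an open \<open>U\<close> with respect to the negative part. A Urysohn
function between \<open>K\<close> and \<open>U\<close> has an integral close to \<open>\<nu> A\<close> or above.\<close>

lemma signed_measure_le_if_integrals_le:
  assumes \<Omega>: "open \<Omega>" and \<nu>: "signed_measure \<Omega> \<nu>" and A: "A \<in> sets (restrict_space borel \<Omega>)"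
    and le: "\<And>\<phi>. continuous_on UNIV \<phi> \<Longrightarrow> (\<And>x. 0 \<le> \<phi> x) \<Longrightarrow> (\<And>x. \<phi> x \<le> 1) \<Longrightarrow> (\<And>x. x \<notin> \<Omega> \<Longrightarrow> \<phi> x = 0)
      \<Longrightarrow> signed_integral \<Omega> \<nu> \<phi> \<le> c"
  shows "\<nu> A \<le> c"
proof (rule field_le_epsilon)
  fix e :: real assume e: "0 < e"
  let ?P = "pos_part \<Omega> \<nu>" and ?N = "pos_part \<Omega> (\<lambda>A. - \<nu> A)"
  interpret P: finite_measure ?P by (rule finite_pos_part[OF \<nu>])
  interpret N: finite_measure ?N by (rule finite_pos_part[OF signed_measure_uminus[OF \<nu>]])
  have S: "B \<in> sets (restrict_space borel \<Omega>) \<longleftrightarrow> B \<subseteq> \<Omega> \<and> B \<in> sets borel" for B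
    using sets_restrict_space_iff[of \<Omega> borel B] \<Omega> by simp
  have idP: "(\<lambda>x. x) \<in> measurable ?P borel" and idN: "(\<lambda>x. x) \<in> measurable ?N borel"
    using measurable_cong_sets[OF sets_pos_part refl] measurable_restrict_space1[of "\<lambda>x. x" borel borel \<Omega>] by auto
  define P' N' where "P' = distr ?P borel (\<lambda>x. x)" and "N' = distr ?N borel (\<lambda>x. x)"
  have P'B: "emeasure P' B = emeasure ?P (B \<inter> \<Omega>)" and N'B: "emeasure N' B = emeasure ?N (B \<inter> \<Omega>)" if "B \<in> sets borel" for B
    unfolding P'_def N'_def using that idP idN by (auto simp: emeasure_distr space_pos_part)
  have A': "A \<in> sets borel" "A \<subseteq> \<Omega>" using A S by auto
  have fin: "emeasure P' B \<noteq> \<infinity>" "emeasure N' B \<noteq> \<infinity>" if "B \<in> sets borel" for B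
    using P'B[OF that] N'B[OF that] by auto
  obtain K where K: "K \<subseteq> A" "compact K" "measure ?P A < measure ?P K + e / 2"
  proof -
    have sup: "emeasure P' A = (SUP K \<in> {K. K \<subseteq> A \<and> compact K}. emeasure P' K)"
      by (rule inner_regular) (use A' fin[of UNIV] in \<open>auto simp: P'_def\<close>)
    have "emeasure P' A < emeasure P' A + ennreal (e / 2)" using e fin[OF A'(1)]
      by (metis ennreal_add_left_cancel_less add.right_neutral ennreal_less_zero_iff half_gt_zero infinity_ennreal_def)
    have "\<exists>K\<in>{K. K \<subseteq> A \<and> compact K}. emeasure P' A < emeasure P' K + ennreal (e / 2)"
    proof (rule ccontr)
      assume "\<not> ?thesis"
      then have "(SUP K \<in> {K. K \<subseteq> A \<and> compact K}. emeasure P' K + ennreal (e / 2)) \<le> emeasure P' A"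
        by (intro SUP_least) (auto simp: not_less)
      moreover have "(SUP K \<in> {K. K \<subseteq> A \<and> compact K}. emeasure P' K + ennreal (e / 2)) = emeasure P' A + ennreal (e / 2)"
        unfolding sup by (rule ennreal_SUP_add_left) (auto intro: exI[of _ "{}"])
      ultimately show False using \<open>emeasure P' A < _\<close> by simp
    qed
    then obtain K where K: "K \<subseteq> A" "compact K" "emeasure P' A < emeasure P' K + ennreal (e / 2)" by blast
    have "K \<inter> \<Omega> = K" "A \<inter> \<Omega> = A" using K(1) A'(2) by auto
    then have "ennreal (measure ?P A) < ennreal (measure ?P K + e / 2)"
      using K P'B[of K] P'B[OF A'(1)] e by (simp add: P.emeasure_eq_measure borel_compact)
    then have "measure ?P A < measure ?P K + e / 2" by (simp add: ennreal_less_iff del: ennreal_plus)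
    then show thesis using that[of K] K by blast
  qed
  obtain U where U: "A \<subseteq> U" "open U" "measure ?N (U \<inter> \<Omega>) < measure ?N A + e / 2"
  proof -
    have inf: "emeasure N' A = (INF U \<in> {U. A \<subseteq> U \<and> open U}. emeasure N' U)"
      by (rule outer_regular) (use A' fin[of UNIV] in \<open>auto simp: N'_def\<close>)
    have "emeasure N' A < emeasure N' A + ennreal (e / 2)" using e fin[OF A'(1)]
      by (metis ennreal_add_left_cancel_less add.right_neutral ennreal_less_zero_iff half_gt_zero infinity_ennreal_def)
    then have "\<exists>U\<in>{U. A \<subseteq> U \<and> open U}. emeasure N' U < emeasure N' A + ennreal (e / 2)"
      using inf by (simp only: INF_less_iff[symmetric])
    then obtain U where U: "A \<subseteq> U" "open U" "emeasure N' U < emeasure N' A + ennreal (e / 2)" by blast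
    have "A \<inter> \<Omega> = A" using A'(2) by auto
    then have "ennreal (measure ?N (U \<inter> \<Omega>)) < ennreal (measure ?N A + e / 2)"
      using U N'B[of U] N'B[OF A'(1)] e by (simp add: N.emeasure_eq_measure)
    then have "measure ?N (U \<inter> \<Omega>) < measure ?N A + e / 2" by (simp add: ennreal_less_iff del: ennreal_plus)
    then show thesis using that[of U] U by blast
  qed
  obtain \<phi> where \<phi>: "continuous_on UNIV \<phi>" "\<And>x. \<phi> x \<in> closed_segment 1 (0::real)" "\<And>x. x \<in> K \<Longrightarrow> \<phi> x = 1"
      "\<And>x. x \<in> - (U \<inter> \<Omega>) \<Longrightarrow> \<phi> x = 0"
    by (rule Urysohn[of K "- (U \<inter> \<Omega>)" 1 0])
      (use K U A'(2) \<Omega> in \<open>auto simp: compact_imp_closed open_Int\<close>)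
  have b: "0 \<le> \<phi> x" "\<phi> x \<le> 1" for x using \<phi>(2)[of x] by (auto simp: closed_segment_eq_real_ivl)
  have m: "\<phi> \<in> borel_measurable (restrict_space borel \<Omega>)"
    by (rule measurable_restrict_space1[OF borel_measurable_continuous_onI[OF \<phi>(1)]])
  have ab: "\<bar>\<phi> x\<bar> \<le> 1" for x using b[of x] by auto
  have KS: "K \<in> sets ?P" and US: "U \<inter> \<Omega> \<in> sets ?N"
    using K U A' \<Omega> by (auto simp: sets_pos_part S borel_compact)
  have "measure ?P K = (\<integral>x. indicator K x \<partial>?P)"
    using KS sets.sets_into_space[OF KS] by (simp add: Int_absorb1 Int_absorb2)
  also have "\<dots> \<le> (\<integral>x. \<phi> x \<partial>?P)"
  proof (rule integral_mono)
    show "integrable ?P (\<lambda>x. indicator K x :: real)"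
      by (rule integrable_real_indicator[OF KS]) (simp add: P.emeasure_eq_measure)
    show "integrable ?P \<phi>" by (rule bounded_integrable_restrict[OF P.finite_measure_axioms sets_pos_part m ab])
    show "indicator K x \<le> \<phi> x" for x using b \<phi>(3) by (auto simp: indicator_def)
  qed
  finally have 1: "measure ?P K \<le> (\<integral>x. \<phi> x \<partial>?P)" .
  have "(\<integral>x. \<phi> x \<partial>?N) \<le> (\<integral>x. indicator (U \<inter> \<Omega>) x \<partial>?N)"
  proof (rule integral_mono)
    show "integrable ?N (\<lambda>x. indicator (U \<inter> \<Omega>) x :: real)"
      by (rule integrable_real_indicator[OF US]) (simp add: N.emeasure_eq_measure)
    show "integrable ?N \<phi>" by (rule bounded_integrable_restrict[OF N.finite_measure_axioms sets_pos_part m ab])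
    show "\<phi> x \<le> indicator (U \<inter> \<Omega>) x" for x using b \<phi>(4)[of x] by (auto simp: indicator_def)
  qed
  also have "\<dots> = measure ?N (U \<inter> \<Omega>)"
    using US sets.sets_into_space[OF US] by (simp add: Int_absorb1 Int_absorb2)
  finally have 2: "(\<integral>x. \<phi> x \<partial>?N) \<le> measure ?N (U \<inter> \<Omega>)" .
  have "signed_integral \<Omega> \<nu> \<phi> \<le> c" by (rule le[OF \<phi>(1) b]) (use \<phi>(4) in auto)
  moreover have "signed_integral \<Omega> \<nu> \<phi> = (\<integral>x. \<phi> x \<partial>?P) - (\<integral>x. \<phi> x \<partial>?N)" by (simp add: signed_integral_def)
  moreover have "\<nu> A = measure ?P A - measure ?N A" by (rule jordan_decomposition[OF \<nu> A])
  ultimately show "\<nu> A \<le> c + e" using 1 2 K(3) U(3) by linarith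
qed

lemma le_dual_norm:
  assumes "\<phi> \<in> C0_functions \<Omega>" "\<And>x. x \<in> \<Omega> \<Longrightarrow> norm (\<phi> x) \<le> 1"
  shows "ereal (\<Sum>i\<in>UNIV. signed_integral \<Omega> (\<lambda>A. \<mu> A $ i) (\<lambda>x. \<phi> x $ i)) \<le> dual_norm \<Omega> \<mu>"
  unfolding dual_norm_def using assms by (intro SUP_upper) auto

lemma dual_norm_nonneg:
  fixes \<mu> :: "(real^2) set \<Rightarrow> real^'d::finite"
  shows "0 \<le> dual_norm \<Omega> \<mu>"
proof -
  have "ereal (\<Sum>i\<in>UNIV. signed_integral \<Omega> (\<lambda>A. \<mu> A $ i) (\<lambda>x. (0 :: real^'d) $ i)) \<le> dual_norm \<Omega> \<mu>"
    by (rule le_dual_norm) (auto simp: C0_functions_def)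
  then show ?thesis by (simp add: signed_integral_zero zero_ereal_def)
qed

lemma component_le_dual_norm:
  fixes \<mu> :: "(real^2) set \<Rightarrow> real^'d::finite"
  assumes \<Omega>: "bounded \<Omega>" and \<phi>: "continuous_on UNIV \<phi>" "\<And>x. \<bar>\<phi> x\<bar> \<le> 1" "\<And>x. x \<notin> \<Omega> \<Longrightarrow> \<phi> x = 0"
  shows "ereal (signed_integral \<Omega> (\<lambda>A. \<mu> A $ i) \<phi>) \<le> dual_norm \<Omega> \<mu>"
proof -
  let ?\<phi> = "\<lambda>x. \<phi> x *\<^sub>R axis i 1 :: real^'d"
  have "?\<phi> \<in> C0_functions \<Omega>"
    unfolding C0_functions_def
  proof (intro CollectI conjI allI impI)
    show "continuous_on \<Omega> ?\<phi>" by (intro continuous_intros continuous_on_subset[OF \<phi>(1)]) auto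
    fix e :: real assume e: "0 < e"
    have eq: "{x \<in> \<Omega>. e \<le> norm (?\<phi> x)} = {x. e \<le> \<bar>\<phi> x\<bar>}" using \<phi>(3) e by force
    have "closed {x. e \<le> \<bar>\<phi> x\<bar>}" by (intro closed_Collect_le continuous_intros \<phi>(1))
    moreover have "bounded {x. e \<le> \<bar>\<phi> x\<bar>}" using \<Omega> by (rule bounded_subset) (use eq in auto)
    ultimately show "compact {x \<in> \<Omega>. e \<le> norm (?\<phi> x)}" unfolding eq by (simp add: compact_eq_bounded_closed)
  qed
  from le_dual_norm[OF this, of \<mu>] have "ereal (\<Sum>k\<in>UNIV. signed_integral \<Omega> (\<lambda>A. \<mu> A $ k) (\<lambda>x. ?\<phi> x $ k)) \<le> dual_norm \<Omega> \<mu>"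
    using \<phi>(2) by simp
  moreover have "(\<Sum>k\<in>UNIV. signed_integral \<Omega> (\<lambda>A. \<mu> A $ k) (\<lambda>x. ?\<phi> x $ k)) = (\<Sum>k\<in>UNIV. if k = i then signed_integral \<Omega> (\<lambda>A. \<mu> A $ i) \<phi> else 0)"
    by (intro sum.cong) (auto simp: axis_def signed_integral_zero)
  ultimately show ?thesis by simp
qed

text \<open>Compactness of the superlevel sets is what makes the extension by zero continuous across
the boundary.\<close>

lemma C0_component_extension:
  fixes \<phi> :: "real^2 \<Rightarrow> real^'d::finite"
  assumes \<Omega>: "open \<Omega>" and \<phi>: "\<phi> \<in> C0_functions \<Omega>"
  shows "continuous_on UNIV (\<lambda>x. if x \<in> \<Omega> then \<phi> x $ i else 0)" (is "continuous_on UNIV ?f")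
  unfolding continuous_on_eq_continuous_at[OF open_UNIV]
proof (intro ballI)
  fix x :: "real^2"
  show "isCont ?f x"
  proof (cases "x \<in> \<Omega>")
    case True
    have "continuous_on \<Omega> (\<lambda>x. \<phi> x $ i)" using \<phi> by (auto simp: C0_functions_def intro!: continuous_intros)
    then have "continuous_on \<Omega> ?f" by (rule continuous_on_eq) simp
    then show ?thesis using True unfolding continuous_on_eq_continuous_at[OF \<Omega>] by blast
  next
    case False
    have "(?f \<longlongrightarrow> 0) (at x)"
    proof (rule tendstoI)
      fix e :: real assume e: "0 < e"
      have "compact {y \<in> \<Omega>. e \<le> norm (\<phi> y)}" using \<phi> e by (simp add: C0_functions_def)
      then have "open (- {y \<in> \<Omega>. e \<le> norm (\<phi> y)})" by (intro open_Compl compact_imp_closed)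
      then have "eventually (\<lambda>y. y \<in> - {y \<in> \<Omega>. e \<le> norm (\<phi> y)}) (at x)"
        using False by (intro eventually_at_topological[THEN iffD2]) blast
      then show "eventually (\<lambda>y. dist (?f y) 0 < e) (at x)"
      proof (rule eventually_mono)
        fix y assume "y \<in> - {y \<in> \<Omega>. e \<le> norm (\<phi> y)}"
        then show "dist (?f y) 0 < e" using e component_le_norm_cart[of "\<phi> y" i] by auto
      qed
    qed
    then show ?thesis using False by (simp add: isCont_def)
  qed
qed

lemma bounded_measure_families_subseq_convergent:
  fixes P :: "nat \<Rightarrow> 'i \<Rightarrow> (real^2) measure"
  assumes \<Omega>: "bounded \<Omega>" "\<Omega> \<in> sets borel" and I: "finite I"
    and sets: "\<And>n i. sets (P n i) = sets (restrict_space borel \<Omega>)"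
    and fin: "\<And>n i. finite_measure (P n i)" and mass: "\<And>n i. measure (P n i) \<Omega> \<le> C"
  shows "\<exists>r Q. strict_mono (r :: nat \<Rightarrow> nat) \<and> (\<forall>i\<in>I. vague_limit \<Omega> (\<lambda>n. P (r n) i) (Q i))"
  using I
proof (induction I)
  case empty
  show ?case by (intro exI[of _ id]) (auto simp: strict_mono_def)
next
  case (insert j I)
  obtain r Q where r: "strict_mono r" "\<And>i. i \<in> I \<Longrightarrow> vague_limit \<Omega> (\<lambda>n. P (r n) i) (Q i)"
    using insert.IH by blast
  have "\<exists>r' M. strict_mono r' \<and> vague_limit \<Omega> (\<lambda>n. P (r (r' n)) j) M"
    by (rule bounded_measures_subseq_convergent[OF \<Omega>, where P="\<lambda>n. P (r n) j"]) (rule sets fin mass)+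
  then obtain r' M where r': "strict_mono r'" "vague_limit \<Omega> (\<lambda>n. P (r (r' n)) j) M" by blast
  have "vague_limit \<Omega> (\<lambda>n. P (r (r' n)) i) (Q i)" if "i \<in> I" for i
    using r(2)[OF that] LIMSEQ_subseq_LIMSEQ[OF _ r'(1)]
    unfolding vague_limit_def comp_def by fast
  then have "\<forall>i\<in>insert j I. vague_limit \<Omega> (\<lambda>n. P ((r \<circ> r') n) i) ((Q(j := M)) i)"
    using r'(2) insert.hyps(2) by (auto simp: fun_upd_def)
  then show ?case
    by (intro exI[of _ "r \<circ> r'"] exI[of _ "Q(j := M)"] conjI strict_mono_o[OF r(1) r'(1)])
qed

text \<open>The dual norm bounds the masses of all positive and negative parts, and these finitely
many sequences have a common convergent subsequence. The limit is again the difference of two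
measures for each component, though perhaps not its Jordan decomposition. The norm bound
survives because each integral in the supremum converges.\<close>

theorem radon_measures_weak_compactness:
  fixes \<mu> :: "nat \<Rightarrow> (real^2) set \<Rightarrow> real^'d::finite"
  assumes \<Omega>: "open \<Omega>" "bounded \<Omega>" and \<mu>: "\<And>n. \<mu> n \<in> radon_measures \<Omega>" and c: "\<And>n. dual_norm \<Omega> (\<mu> n) \<le> ereal c"
  shows "\<exists>r \<mu>'. strict_mono (r :: nat \<Rightarrow> nat) \<and> \<mu>' \<in> radon_measures \<Omega> \<and> dual_norm \<Omega> \<mu>' \<le> ereal c \<and>
    (\<forall>f i. continuous_on UNIV f \<longrightarrow> bounded (range f) \<longrightarrow> (\<forall>x. x \<notin> \<Omega> \<longrightarrow> f x = 0) \<longrightarrow>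
       (\<lambda>n. signed_integral \<Omega> (\<lambda>A. \<mu> (r n) A $ i) f) \<longlonglongrightarrow> signed_integral \<Omega> (\<lambda>A. \<mu>' A $ i) f)"
proof -
  have \<Omega>b: "\<Omega> \<in> sets borel" using \<Omega> by simp
  have sm: "signed_measure \<Omega> (\<lambda>A. \<mu> n A $ i)" for n i using \<mu> by (simp add: radon_measures_iff)
  \<comment> \<open>The pairs \<open>p\<close> index the components together with a sign, so that positive and negative parts are treated alike.\<close>
  define \<kappa> where "\<kappa> n p = (if snd p then (\<lambda>A. \<mu> n A $ fst p) else (\<lambda>A. - (\<mu> n A $ fst p)))" for n and p :: "'d \<times> bool"
  have s\<kappa>: "signed_measure \<Omega> (\<kappa> n p)" for n p
    using sm signed_measure_uminus[OF sm] by (auto simp: \<kappa>_def)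
  define P where "P n p = pos_part \<Omega> (\<kappa> n p)" for n p
  have comp: "signed_integral \<Omega> (\<kappa> n p) \<phi> \<le> c"
    if \<phi>: "continuous_on UNIV \<phi>" "\<And>x. 0 \<le> \<phi> x" "\<And>x. \<phi> x \<le> 1" "\<And>x. x \<notin> \<Omega> \<Longrightarrow> \<phi> x = 0" for n p \<phi>
  proof -
    have "ereal (signed_integral \<Omega> (\<lambda>A. \<mu> n A $ fst p) \<phi>) \<le> ereal c"
      by (rule order_trans[OF component_le_dual_norm c]) (use \<Omega> \<phi> in auto)
    moreover have "ereal (signed_integral \<Omega> (\<lambda>A. \<mu> n A $ fst p) (\<lambda>x. - 1 * \<phi> x)) \<le> ereal c"
      by (rule order_trans[OF component_le_dual_norm c]) (use \<Omega> \<phi> in \<open>auto intro!: continuous_intros\<close>)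
    ultimately show ?thesis
      unfolding signed_integral_cmult by (auto simp: \<kappa>_def signed_integral_uminus)
  qed
  have mass: "measure (P n p) \<Omega> \<le> c" for n p
  proof -
    have le: "\<kappa> n p B \<le> c" if "B \<in> sets (restrict_space borel \<Omega>)" for B
      by (rule signed_measure_le_if_integrals_le[OF \<Omega>(1) s\<kappa> that]) (rule comp)
    have "0 \<le> c" using le[of "{}"] signed_measure_empty[OF s\<kappa>] by simp
    have "emeasure (P n p) \<Omega> \<le> ennreal c"
      unfolding P_def emeasure_pos_part_scalar[OF s\<kappa> space_in_sets_restrict_space] by (rule pos_variation_le) (rule le)
    then show ?thesis
      using \<open>0 \<le> c\<close> finite_measure.emeasure_eq_measure[OF finite_pos_part[OF s\<kappa>[of n p]]] by (simp add: P_def)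
  qed
  have "\<exists>r Q. strict_mono (r :: nat \<Rightarrow> nat) \<and> (\<forall>p\<in>UNIV. vague_limit \<Omega> (\<lambda>n. P (r n) p) (Q p))"
    by (rule bounded_measure_families_subseq_convergent[OF \<Omega>(2) \<Omega>b finite _ _ mass])
      (auto simp: P_def sets_pos_part finite_pos_part[OF s\<kappa>])
  then obtain r Q where r: "strict_mono r" and "\<forall>p. vague_limit \<Omega> (\<lambda>n. P (r n) p) (Q p)" by auto
  then have vl: "vague_limit \<Omega> (\<lambda>n. P (r n) p) (Q p)" for p by blast
  have Q: "finite_measure (Q p)" "sets (Q p) = sets (restrict_space borel \<Omega>)" for p
    using vl[of p] by (auto simp: vague_limit_def)
  have lim: "(\<lambda>n. \<integral>x. f x \<partial>P (r n) p) \<longlonglongrightarrow> (\<integral>x. f x \<partial>Q p)"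
    if "continuous_on UNIV f" "bounded (range f)" "\<And>x. x \<notin> \<Omega> \<Longrightarrow> f x = 0" for f :: "real^2 \<Rightarrow> real" and p
    using vl[of p] that unfolding vague_limit_def by blast
  define \<mu>' where "\<mu>' A = (\<chi> i. measure (Q (i, True)) A - measure (Q (i, False)) A)" for A
  have s': "signed_measure \<Omega> (\<lambda>A. \<mu>' A $ i)" for i
    unfolding \<mu>'_def by (simp add: signed_measure_diff Q)
  have SI: "(\<lambda>n. signed_integral \<Omega> (\<lambda>A. \<mu> (r n) A $ i) f) \<longlonglongrightarrow> signed_integral \<Omega> (\<lambda>A. \<mu>' A $ i) f"
    if f: "continuous_on UNIV f" "bounded (range f)" "\<And>x. x \<notin> \<Omega> \<Longrightarrow> f x = 0" for f i
  proof -
    obtain B where B: "\<And>x. \<bar>f x\<bar> \<le> B" using f(2) unfolding bounded_iff by auto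
    have "signed_integral \<Omega> (\<lambda>A. \<mu>' A $ i) f = (\<integral>x. f x \<partial>Q (i, True)) - (\<integral>x. f x \<partial>Q (i, False))"
      by (rule signed_integral_eq[OF Q Q _ s' measurable_restrict_space1[OF borel_measurable_continuous_onI[OF f(1)]] B])
        (simp add: \<mu>'_def)
    moreover have "signed_integral \<Omega> (\<lambda>A. \<mu> (r n) A $ i) f = (\<integral>x. f x \<partial>P (r n) (i, True)) - (\<integral>x. f x \<partial>P (r n) (i, False))" for n
      by (simp add: signed_integral_def P_def \<kappa>_def)
    ultimately show ?thesis using tendsto_diff[OF lim[OF f, of "(i, True)"] lim[OF f, of "(i, False)"]] by simp
  qed
  have "dual_norm \<Omega> \<mu>' \<le> ereal c"
    unfolding dual_norm_def
  proof (rule SUP_least)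
    fix \<phi> :: "real^2 \<Rightarrow> real^'d" assume "\<phi> \<in> {\<phi> \<in> C0_functions \<Omega>. \<forall>x\<in>\<Omega>. norm (\<phi> x) \<le> 1}"
    then have \<phi>: "\<phi> \<in> C0_functions \<Omega>" "\<And>x. x \<in> \<Omega> \<Longrightarrow> norm (\<phi> x) \<le> 1" by auto
    define f where "f i x = (if x \<in> \<Omega> then \<phi> x $ i else 0)" for i x
    have f: "continuous_on UNIV (f i)" for i unfolding f_def by (rule C0_component_extension[OF \<Omega>(1) \<phi>(1)])
    have fb: "\<bar>f i x\<bar> \<le> 1" for i x using \<phi>(2)[of x] component_le_norm_cart[of "\<phi> x" i] by (auto simp: f_def)
    have fbd: "bounded (range (f i))" for i using fb[of i] by (auto simp: bounded_iff)
    have eq: "signed_integral \<Omega> \<nu> (\<lambda>x. \<phi> x $ i) = signed_integral \<Omega> \<nu> (f i)" for \<nu> i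
      by (rule signed_integral_cong) (simp add: f_def)
    have "(\<lambda>n. \<Sum>i\<in>UNIV. signed_integral \<Omega> (\<lambda>A. \<mu> (r n) A $ i) (f i)) \<longlonglongrightarrow> (\<Sum>i\<in>UNIV. signed_integral \<Omega> (\<lambda>A. \<mu>' A $ i) (f i))"
      by (intro tendsto_sum SI f fbd) (simp add: f_def)
    moreover have "(\<Sum>i\<in>UNIV. signed_integral \<Omega> (\<lambda>A. \<mu> (r n) A $ i) (f i)) \<le> c" for n
      using order_trans[OF le_dual_norm[OF \<phi>, of "\<mu> (r n)"] c] by (simp add: eq)
    ultimately have "(\<Sum>i\<in>UNIV. signed_integral \<Omega> (\<lambda>A. \<mu>' A $ i) (f i)) \<le> c"
      by (intro LIMSEQ_le_const2) auto
    then show "ereal (\<Sum>i\<in>UNIV. signed_integral \<Omega> (\<lambda>A. \<mu>' A $ i) (\<lambda>x. \<phi> x $ i)) \<le> ereal c" by (simp add: eq)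
  qed
  moreover have "\<mu>' \<in> radon_measures \<Omega>" using s' by (simp add: radon_measures_iff)
  ultimately show ?thesis using r SI by (intro exI[of _ r] exI[of _ \<mu>'] conjI allI impI) simp_all
qed

section \<open>Densities and regular distributions\<close>

lemma test_functions_bounded:
  assumes "\<phi> \<in> test_functions \<Omega>"
  obtains s where "0 < s" "\<And>x. \<bar>\<phi> x\<bar> \<le> s"
proof (rule test_functionsE[OF assms])
  fix K assume K: "smooth \<phi>" "compact K" "\<And>x. x \<notin> K \<Longrightarrow> \<phi> x = 0"
  have "bounded (\<phi> ` K)"
    by (intro compact_imp_bounded compact_continuous_image smooth_continuous K)
  then obtain s where s: "0 < s" "\<And>x. x \<in> K \<Longrightarrow> \<bar>\<phi> x\<bar> \<le> s" unfolding bounded_pos by auto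
  show ?thesis by (rule that[of s]) (use s K(3) in force)+
qed

lemma test_functions_continuous: "\<phi> \<in> test_functions \<Omega> \<Longrightarrow> continuous_on A \<phi>"
  by (rule smooth_continuous) (rule test_functions_smooth)

lemma test_functions_outside: "\<phi> \<in> test_functions \<Omega> \<Longrightarrow> x \<notin> \<Omega> \<Longrightarrow> \<phi> x = 0"
  by (erule test_functionsE) blast

lemma test_functions_measurable:
  "\<phi> \<in> test_functions \<Omega> \<Longrightarrow> \<phi> \<in> borel_measurable (restrict_space borel A)"
  by (intro measurable_restrict_space1 borel_measurable_continuous_onI test_functions_continuous)

text \<open>The positive and negative parts of \<open>a\<close> are densities of two finite measures, since \<open>\<Omega>\<close> has
finite area and \<open>a\<close> is bounded on it.\<close>

lemma signed_measure_of_continuous_density: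
  fixes a :: "real^2 \<Rightarrow> real"
  assumes \<Omega>: "open \<Omega>" "bounded \<Omega>" and a: "continuous_on UNIV a"
  shows "\<exists>\<nu>. signed_measure \<Omega> \<nu> \<and> (\<forall>\<phi>\<in>test_functions \<Omega>. signed_integral \<Omega> \<nu> \<phi> = (\<integral>x. a x * \<phi> x \<partial>lborel))"
proof -
  define L where "L = restrict_space lborel \<Omega>"
  have setsL: "sets L = sets (restrict_space borel \<Omega>)" unfolding L_def by (rule sets_restrict_space_cong) simp
  have spL: "space L = \<Omega>" by (simp add: L_def space_restrict_space)
  have am: "a \<in> borel_measurable borel" by (rule borel_measurable_continuous_onI[OF a])
  have measL: "h \<in> borel_measurable L" if "h \<in> borel_measurable borel" for h :: "real^2 \<Rightarrow> real"
    unfolding L_def using that by (intro measurable_restrict_space1) simp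
  have "compact (closure \<Omega>)" using \<Omega>(2) by simp
  then have "bounded (a ` closure \<Omega>)"
    by (intro compact_imp_bounded compact_continuous_image continuous_on_subset[OF a]) auto
  then obtain B where B: "\<And>x. x \<in> \<Omega> \<Longrightarrow> \<bar>a x\<bar> \<le> B"
    unfolding bounded_iff using closure_subset[of \<Omega>] by auto
  have finL: "finite_measure L"
    unfolding L_def using \<Omega> emeasure_bounded_finite[OF \<Omega>(2)]
    by (intro finite_measureI) (simp add: emeasure_restrict_space space_restrict_space)
  define D where "D g = density L (\<lambda>x. ennreal (max 0 (g x)))" for g
  have finD: "finite_measure (D g)" and setsD: "sets (D g) = sets (restrict_space borel \<Omega>)"
    if g: "g \<in> borel_measurable borel" "\<And>x. x \<in> \<Omega> \<Longrightarrow> g x \<le> B" for g :: "real^2 \<Rightarrow> real"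
  proof -
    show "sets (D g) = sets (restrict_space borel \<Omega>)" by (simp add: D_def setsL)
    have "emeasure (D g) (space (D g)) = (\<integral>\<^sup>+x. ennreal (max 0 (g x)) \<partial>L)"
      using measL[OF g(1)] by (simp add: D_def emeasure_density cong: nn_integral_cong)
    also have "\<dots> \<le> (\<integral>\<^sup>+x. ennreal (max 0 B) \<partial>L)"
      using g(2) by (intro nn_integral_mono ennreal_leI max.mono) (auto simp: spL)
    also have "\<dots> < \<infinity>" using finite_measure.emeasure_finite[OF finL] by (simp add: ennreal_mult_less_top less_top)
    finally show "finite_measure (D g)" by (intro finite_measureI) simp
  qed
  have negm: "(\<lambda>x. - a x) \<in> borel_measurable borel" using am by simp
  have Bp: "a x \<le> B" "- a x \<le> B" if "x \<in> \<Omega>" for x using B[OF that] by auto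
  define \<nu> where "\<nu> A = measure (D a) A - measure (D (\<lambda>x. - a x)) A" for A
  have \<nu>: "signed_measure \<Omega> \<nu>" unfolding \<nu>_def
    by (intro signed_measure_diff finD setsD am negm Bp)
  moreover have "signed_integral \<Omega> \<nu> \<phi> = (\<integral>x. a x * \<phi> x \<partial>lborel)" if \<phi>: "\<phi> \<in> test_functions \<Omega>" for \<phi>
  proof -
    obtain s where s: "\<And>x. \<bar>\<phi> x\<bar> \<le> s" by (rule test_functions_bounded[OF \<phi>]) (rule that)
    have \<phi>m: "\<phi> \<in> borel_measurable borel" by (intro borel_measurable_continuous_onI test_functions_continuous[OF \<phi>])
    have I: "integrable L (\<lambda>x. max 0 (g x) * \<phi> x)" if g: "g \<in> borel_measurable borel" "\<And>x. x \<in> \<Omega> \<Longrightarrow> g x \<le> B" for g :: "real^2 \<Rightarrow> real"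
    proof (rule finite_measure.integrable_const_bound[OF finL, of _ "max 0 B * s"])
      show "AE x in L. norm (max 0 (g x) * \<phi> x) \<le> max 0 B * s"
      proof (rule AE_I2)
        fix x assume "x \<in> space L"
        then have "max 0 (g x) \<le> max 0 B" using g(2) by (intro max.mono) (auto simp: spL)
        then show "norm (max 0 (g x) * \<phi> x) \<le> max 0 B * s"
          unfolding norm_mult using s[of x] by (intro mult_mono) auto
      qed
    qed (use measL[OF g(1)] measL[OF \<phi>m] in simp)
    have dens: "(\<integral>x. \<phi> x \<partial>D g) = (\<integral>x. max 0 (g x) * \<phi> x \<partial>L)" if g: "g \<in> borel_measurable borel" for g
    proof -
      have "(\<lambda>x. max 0 (g x)) \<in> borel_measurable L" using measL[OF g] by simp
      from integral_density[OF measL[OF \<phi>m] this] show ?thesis by (simp only: D_def real_scaleR_def) simp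
    qed
    have "signed_integral \<Omega> \<nu> \<phi> = (\<integral>x. \<phi> x \<partial>D a) - (\<integral>x. \<phi> x \<partial>D (\<lambda>x. - a x))"
      by (rule signed_integral_eq[OF finD setsD finD setsD _ \<nu> test_functions_measurable[OF \<phi>] s])
        (auto simp: \<nu>_def intro: am negm Bp)
    also have "\<dots> = (\<integral>x. max 0 (a x) * \<phi> x \<partial>L) - (\<integral>x. max 0 (- a x) * \<phi> x \<partial>L)"
      by (simp only: dens[OF am] dens[OF negm])
    also have "\<dots> = (\<integral>x. max 0 (a x) * \<phi> x - max 0 (- a x) * \<phi> x \<partial>L)"
      by (rule Bochner_Integration.integral_diff[symmetric]; rule I) (auto intro: am negm Bp)
    also have "\<dots> = (\<integral>x. a x * \<phi> x \<partial>L)"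
      by (rule Bochner_Integration.integral_cong) (auto simp: max_def)
    also have "\<dots> = (\<integral>x. indicator \<Omega> x *\<^sub>R (a x * \<phi> x) \<partial>lborel)"
      unfolding L_def using \<Omega> by (subst integral_restrict_space) auto
    also have "\<dots> = (\<integral>x. a x * \<phi> x \<partial>lborel)"
      by (rule Bochner_Integration.integral_cong) (auto simp: indicator_def test_functions_outside[OF \<phi>])
    finally show ?thesis .
  qed
  ultimately show ?thesis by blast
qed

lemma finite_lebesgue_on:
  assumes "open \<Omega>" "bounded (\<Omega> :: (real^2) set)"
  shows "finite_measure (lebesgue_on \<Omega>)"
  using assms emeasure_bounded_finite[of \<Omega>]
  by (intro finite_measureI) (simp add: emeasure_restrict_space space_restrict_space)

lemma Lp_integrable:
  assumes \<Omega>: "open \<Omega>" "bounded \<Omega>" and p: "1 \<le> p" and u: "u \<in> Lp p \<Omega>"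
  shows "integrable (lebesgue_on \<Omega>) u"
proof -
  interpret finite_measure "lebesgue_on \<Omega>" by (rule finite_lebesgue_on[OF \<Omega>])
  have i: "integrable (lebesgue_on \<Omega>) (\<lambda>x. 1 + \<bar>u x\<bar> powr p)" using u by (simp add: Lp_def)
  have m: "u \<in> borel_measurable (lebesgue_on \<Omega>)" using u by (simp add: Lp_def)
  show ?thesis
  proof (rule Bochner_Integration.integrable_bound[OF i m], rule AE_I2)
    fix x
    have "\<bar>u x\<bar> \<le> 1 + \<bar>u x\<bar> powr p"
    proof (cases "\<bar>u x\<bar> \<le> 1")
      case True then show ?thesis by (simp add: add_increasing2)
    next
      case False
      then have "\<bar>u x\<bar> powr 1 \<le> \<bar>u x\<bar> powr p" by (intro powr_mono p) auto
      then show ?thesis using False by simp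
    qed
    then show "norm (u x) \<le> norm (1 + \<bar>u x\<bar> powr p)" by (simp add: add_nonneg_nonneg)
  qed
qed

lemma Lp_diff_integrable:
  assumes p: "1 \<le> p" and u: "u \<in> Lp p \<Omega>" "v \<in> Lp p \<Omega>"
  shows "integrable (lebesgue_on \<Omega>) (\<lambda>x. \<bar>u x - v x\<bar> powr p)"
proof -
  have i: "integrable (lebesgue_on \<Omega>) (\<lambda>x. 2 powr p * (\<bar>u x\<bar> powr p + \<bar>v x\<bar> powr p))" using u by (simp add: Lp_def)
  have m: "(\<lambda>x. \<bar>u x - v x\<bar> powr p) \<in> borel_measurable (lebesgue_on \<Omega>)"
    using u by (auto simp: Lp_def intro!: powr_real_measurable)
  show ?thesis
  proof (rule Bochner_Integration.integrable_bound[OF i m], rule AE_I2)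
    fix x
    have "\<bar>u x - v x\<bar> powr p \<le> (2 * max \<bar>u x\<bar> \<bar>v x\<bar>) powr p" using p by (intro powr_mono2) auto
    also have "\<dots> = 2 powr p * max \<bar>u x\<bar> \<bar>v x\<bar> powr p" by (simp add: powr_mult)
    also have "\<dots> \<le> 2 powr p * (\<bar>u x\<bar> powr p + \<bar>v x\<bar> powr p)" by (intro mult_left_mono) (auto simp: max_def)
    finally show "norm (\<bar>u x - v x\<bar> powr p) \<le> norm (2 powr p * (\<bar>u x\<bar> powr p + \<bar>v x\<bar> powr p))" by simp
  qed
qed

text \<open>Integrated over a set of finite measure, this bounds the \<open>L\<^sup>1\<close> norm by a small constant
plus a large multiple of the \<open>p\<close>-th power of the \<open>L\<^sup>p\<close> norm.\<close>

lemma le_add_powr: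
  assumes "0 < e" "0 \<le> a" "1 \<le> (p :: real)"
  shows "a \<le> e + e * (1 / e) powr p * a powr p"
proof (cases "a \<le> e")
  case True then show ?thesis using assms by (simp add: add_increasing2)
next
  case False
  then have "(a / e) powr 1 \<le> (a / e) powr p" using assms by (intro powr_mono) auto
  moreover have "(a / e) powr p = (1 / e) powr p * a powr p" using assms powr_mult[of "1 / e" a p] by simp
  ultimately have "a / e \<le> (1 / e) powr p * a powr p" using assms False by simp
  then have "a \<le> e * ((1 / e) powr p * a powr p)" using assms by (simp add: field_simps)
  then show ?thesis using assms by (simp add: mult.assoc)
qed

lemma Lp_convergence_imp_L1:
  assumes \<Omega>: "open \<Omega>" "bounded \<Omega>" and p: "1 \<le> p"
    and u: "\<And>n. u n \<in> Lp p \<Omega>" "v \<in> Lp p \<Omega>" and lim: "(\<lambda>n. Lp_dist p \<Omega> (u n) v) \<longlonglongrightarrow> 0"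
  shows "(\<lambda>n. \<integral>x. \<bar>u n x - v x\<bar> \<partial>(lebesgue_on \<Omega>)) \<longlonglongrightarrow> 0"
proof -
  interpret finite_measure "lebesgue_on \<Omega>" by (rule finite_lebesgue_on[OF \<Omega>])
  define I where "I n = (\<integral>x. \<bar>u n x - v x\<bar> powr p \<partial>(lebesgue_on \<Omega>))" for n
  define m where "m = measure (lebesgue_on \<Omega>) \<Omega>"
  have I0: "0 \<le> I n" for n unfolding I_def by (rule integral_nonneg_AE) simp
  have "(\<lambda>n. Lp_dist p \<Omega> (u n) v powr p) \<longlonglongrightarrow> 0"
    by (rule tendsto_zero_powrI[OF lim tendsto_const]) (use p in \<open>auto simp: Lp_dist_def\<close>)
  moreover have "Lp_dist p \<Omega> (u n) v powr p = I n" for n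
    using p I0[of n] by (simp add: Lp_dist_def powr_powr I_def)
  ultimately have I: "I \<longlonglongrightarrow> 0" by simp
  have bound: "(\<integral>x. \<bar>u n x - v x\<bar> \<partial>(lebesgue_on \<Omega>)) \<le> e * m + e * (1 / e) powr p * I n" if e: "0 < e" for e n
  proof -
    have "(\<integral>x. \<bar>u n x - v x\<bar> \<partial>(lebesgue_on \<Omega>)) \<le> (\<integral>x. e + e * (1 / e) powr p * \<bar>u n x - v x\<bar> powr p \<partial>(lebesgue_on \<Omega>))"
      by (rule integral_mono) (use Lp_integrable[OF \<Omega> p] Lp_diff_integrable[OF p] u le_add_powr[OF e _ p] in auto)
    also have "\<dots> = e * m + e * (1 / e) powr p * I n"
      using Lp_diff_integrable[OF p u(1) u(2), of n] by (simp add: I_def m_def space_restrict_space)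
    finally show ?thesis .
  qed
  show ?thesis
  proof (rule LIMSEQ_I)
    fix \<eta> :: real assume \<eta>: "0 < \<eta>"
    have m0: "0 \<le> m" by (simp add: m_def)
    \<comment> \<open>The \<open>+ 1\<close> guards against division by a vanishing area.\<close>
    define e where "e = \<eta> / (2 * (m + 1))"
    have e: "0 < e" using \<eta> m0 by (simp add: e_def)
    have "e * m < e * (m + 1)" using e by simp
    also have "e * (m + 1) = \<eta> / 2" using m0 by (simp add: e_def field_simps)
    finally have em: "e * m < \<eta> / 2" .
    have "(\<lambda>n. e * (1 / e) powr p * I n) \<longlonglongrightarrow> e * (1 / e) powr p * 0" by (intro tendsto_intros I)
    then have "\<forall>\<^sub>F n in sequentially. e * (1 / e) powr p * I n < \<eta> / 2"
      using \<eta> by (intro order_tendstoD(2)[where y="e * (1 / e) powr p * 0"]) auto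
    then obtain N where N: "\<And>n. n \<ge> N \<Longrightarrow> e * (1 / e) powr p * I n < \<eta> / 2"
      unfolding eventually_sequentially by blast
    have "norm ((\<integral>x. \<bar>u n x - v x\<bar> \<partial>(lebesgue_on \<Omega>)) - 0) < \<eta>" if "n \<ge> N" for n
    proof -
      have "0 \<le> (\<integral>x. \<bar>u n x - v x\<bar> \<partial>(lebesgue_on \<Omega>))" by (rule integral_nonneg_AE) simp
      then show ?thesis using bound[OF e, of n] em N[OF that] by simp
    qed
    then show "\<exists>N. \<forall>n\<ge>N. norm ((\<integral>x. \<bar>u n x - v x\<bar> \<partial>(lebesgue_on \<Omega>)) - 0) < \<eta>" by blast
  qed
qed

lemma integrable_mult_test:
  assumes u: "integrable (lebesgue_on \<Omega>) u" and \<phi>: "\<phi> \<in> test_functions \<Omega>"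
  shows "integrable (lebesgue_on \<Omega>) (\<lambda>x. u x * \<phi> x)"
proof -
  obtain s where s: "0 < s" "\<And>x. \<bar>\<phi> x\<bar> \<le> s" by (rule test_functions_bounded[OF \<phi>]) (rule that)
  have \<phi>m: "\<phi> \<in> borel_measurable (lebesgue_on \<Omega>)"
    by (intro measurable_restrict_space1 measurable_completion) 
      (simp add: borel_measurable_continuous_onI[OF test_functions_continuous[OF \<phi>]])
  show ?thesis
  proof (rule Bochner_Integration.integrable_bound[of _ "\<lambda>x. s * u x"])
    show "integrable (lebesgue_on \<Omega>) (\<lambda>x. s * u x)" using u by simp
    show "(\<lambda>x. u x * \<phi> x) \<in> borel_measurable (lebesgue_on \<Omega>)" using borel_measurable_integrable[OF u] \<phi>m by simp
    show "AE x in lebesgue_on \<Omega>. norm (u x * \<phi> x) \<le> norm (s * u x)"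
      using s by (intro AE_I2) (auto simp: abs_mult mult.commute intro!: mult_right_mono)
  qed
qed

lemma regular_distr_convergence:
  assumes u: "\<And>n. integrable (lebesgue_on \<Omega>) (u n)" "integrable (lebesgue_on \<Omega>) v"
    and lim: "(\<lambda>n. \<integral>x. \<bar>u n x - v x\<bar> \<partial>(lebesgue_on \<Omega>)) \<longlonglongrightarrow> 0" and \<phi>: "\<phi> \<in> test_functions \<Omega>"
  shows "(\<lambda>n. regular_distr \<Omega> (u n) \<phi>) \<longlonglongrightarrow> regular_distr \<Omega> v \<phi>"
proof -
  obtain s where s: "0 < s" "\<And>x. \<bar>\<phi> x\<bar> \<le> s" by (rule test_functions_bounded[OF \<phi>]) (rule that)
  have "norm (regular_distr \<Omega> (u n) \<phi> - regular_distr \<Omega> v \<phi>) \<le> s * (\<integral>x. \<bar>u n x - v x\<bar> \<partial>(lebesgue_on \<Omega>))" for n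
  proof -
    have "regular_distr \<Omega> (u n) \<phi> - regular_distr \<Omega> v \<phi> = (\<integral>x. (u n x - v x) * \<phi> x \<partial>(lebesgue_on \<Omega>))"
      unfolding regular_distr_def left_diff_distrib
      by (rule Bochner_Integration.integral_diff[symmetric]; rule integrable_mult_test[OF _ \<phi>]) (rule u)+
    also have "norm \<dots> \<le> (\<integral>x. norm ((u n x - v x) * \<phi> x) \<partial>(lebesgue_on \<Omega>))" by (rule integral_norm_bound)
    also have "\<dots> \<le> (\<integral>x. s * \<bar>u n x - v x\<bar> \<partial>(lebesgue_on \<Omega>))"
    proof (rule integral_mono)
      have d: "integrable (lebesgue_on \<Omega>) (\<lambda>x. u n x - v x)" using u by simp
      show "integrable (lebesgue_on \<Omega>) (\<lambda>x. norm ((u n x - v x) * \<phi> x))"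
        using integrable_mult_test[OF d \<phi>] by simp
      show "integrable (lebesgue_on \<Omega>) (\<lambda>x. s * \<bar>u n x - v x\<bar>)" using d by simp
      show "norm ((u n x - v x) * \<phi> x) \<le> s * \<bar>u n x - v x\<bar>" for x
        using s(2)[of x] by (simp add: abs_mult mult.commute mult_right_mono)
    qed
    finally show ?thesis by simp
  qed
  moreover have "(\<lambda>n. s * (\<integral>x. \<bar>u n x - v x\<bar> \<partial>(lebesgue_on \<Omega>))) \<longlonglongrightarrow> 0"
    using tendsto_mult[OF tendsto_const lim, of s] by simp
  ultimately have "(\<lambda>n. regular_distr \<Omega> (u n) \<phi> - regular_distr \<Omega> v \<phi>) \<longlonglongrightarrow> 0"
    by (rule Lim_null_comparison[OF always_eventually[OF allI]])
  then show ?thesis by (simp add: LIM_zero_iff)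
qed

lemma test_linear_regular_distr:
  assumes u: "integrable (lebesgue_on \<Omega>) u"
  shows "test_linear \<Omega> (regular_distr \<Omega> u)"
  unfolding test_linear_def
proof (intro ballI allI)
  fix f g c assume fg: "f \<in> test_functions \<Omega>" "g \<in> test_functions \<Omega>"
  have "(\<integral>x. u x * (f x + c * g x) \<partial>(lebesgue_on \<Omega>)) = (\<integral>x. u x * f x + c * (u x * g x) \<partial>(lebesgue_on \<Omega>))"
    by (simp add: algebra_simps)
  then show "regular_distr \<Omega> u (\<lambda>x. f x + c * g x) = regular_distr \<Omega> u f + c * regular_distr \<Omega> u g"
    unfolding regular_distr_def using integrable_mult_test[OF u fg(1)] integrable_mult_test[OF u fg(2)] by simp
qed

lemma test_linear_signed_integral:
  assumes \<nu>: "signed_measure \<Omega> \<nu>"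
  shows "test_linear \<Omega> (signed_integral \<Omega> \<nu>)"
  unfolding test_linear_def
proof (intro ballI allI)
  fix f g c assume fg: "f \<in> test_functions \<Omega>" "g \<in> test_functions \<Omega>"
  obtain s where s: "\<And>x. \<bar>f x\<bar> \<le> s" by (rule test_functions_bounded[OF fg(1)]) (rule that)
  obtain s' where s': "\<And>x. \<bar>g x\<bar> \<le> s'" by (rule test_functions_bounded[OF fg(2)]) (rule that)
  show "signed_integral \<Omega> \<nu> (\<lambda>x. f x + c * g x) = signed_integral \<Omega> \<nu> f + c * signed_integral \<Omega> \<nu> g"
    by (rule signed_integral_lin[OF \<nu> test_functions_measurable[OF fg(1)] s test_functions_measurable[OF fg(2)] s'])
qed

section \<open>Gamma-convergence\<close>

lemma matrix_diag_mult: "(diag b *v x) $ i = b $ i * x $ i"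
  by (simp add: diag_def matrix_vector_mult_def if_distrib if_distribR cong: if_cong)

lemma nabla_N_tendsto:
  assumes "\<And>j. (\<lambda>n. T n (partial j \<phi>)) \<longlonglongrightarrow> T' (partial j \<phi>)"
  shows "(\<lambda>n. nabla_N (T n) \<phi> $ i) \<longlonglongrightarrow> nabla_N T' \<phi> $ i"
proof -
  have c: "(\<lambda>n. component k (T n) (partial j \<phi>)) \<longlonglongrightarrow> component k T' (partial j \<phi>)" for k j
    unfolding component_def by (intro tendsto_vec_nth assms)
  consider "i = 1" | "i = 2" | "i = 3" | "i = 4" using exhaust_4 by blast
  then show ?thesis
    by cases (simp_all only: nabla_N_nth curl_def divergence_def sh1_def sh2_def distr_partial_def; intro tendsto_intros c)+
qed

lemma nabla_N_cong:
  assumes "\<And>j. T (partial j \<phi>) = T' (partial j \<phi>)"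
  shows "nabla_N T \<phi> = nabla_N T' \<phi>"
  by (simp add: nabla_N_def curl_def divergence_def sh1_def sh2_def distr_partial_def component_def assms)

lemma measure_distr_bound:
  fixes \<nu> :: "(real^2) set \<Rightarrow> real^'d::finite"
  assumes \<Omega>: "bounded \<Omega>" and c: "dual_norm \<Omega> \<nu> \<le> ereal c" and \<phi>: "\<phi> \<in> test_functions \<Omega>"
    and s: "0 < s" "\<And>x. \<bar>\<phi> x\<bar> \<le> s"
  shows "\<bar>measure_distr \<Omega> \<nu> \<phi> $ i\<bar> \<le> c * s"
proof -
  have le: "e / s * signed_integral \<Omega> (\<lambda>A. \<nu> A $ i) \<phi> \<le> c" if e: "\<bar>e\<bar> = 1" for e
  proof -
    have "ereal (signed_integral \<Omega> (\<lambda>A. \<nu> A $ i) (\<lambda>x. e / s * \<phi> x)) \<le> dual_norm \<Omega> \<nu>"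
    proof (rule component_le_dual_norm[OF \<Omega>])
      show "continuous_on UNIV (\<lambda>x. e / s * \<phi> x)" by (intro continuous_intros test_functions_continuous[OF \<phi>])
      show "\<bar>e / s * \<phi> x\<bar> \<le> 1" for x using s(1) s(2)[of x] e by (simp add: abs_mult)
    qed (simp add: test_functions_outside[OF \<phi>])
    from order_trans[OF this c] show ?thesis unfolding signed_integral_cmult by simp
  qed
  show ?thesis using le[of 1] le[of "-1"] s(1) by (simp add: measure_distr_def abs_le_iff field_simps)
qed

lemma radon_norm_nonneg: "0 \<le> radon_norm \<Omega> T"
  unfolding radon_norm_def by (intro INF_greatest dual_norm_nonneg)

lemma radon_norm_lessD:
  assumes "radon_norm \<Omega> T < c"
  shows "\<exists>\<mu>\<in>radon_measures \<Omega>. distr_eq \<Omega> T (measure_distr \<Omega> \<mu>) \<and> dual_norm \<Omega> \<mu> < c"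
  using assms unfolding radon_norm_def INF_less_iff by auto

lemma radon_norm_sequence_lessD:
  assumes "\<And>n. radon_norm \<Omega> (T n) < c"
  shows "\<exists>\<mu>. \<forall>n. \<mu> n \<in> radon_measures \<Omega> \<and> distr_eq \<Omega> (T n) (measure_distr \<Omega> (\<mu> n)) \<and> dual_norm \<Omega> (\<mu> n) \<le> c"
proof (rule choice, rule allI)
  fix n
  show "\<exists>\<mu>. \<mu> \<in> radon_measures \<Omega> \<and> distr_eq \<Omega> (T n) (measure_distr \<Omega> \<mu>) \<and> dual_norm \<Omega> \<mu> \<le> c"
    using radon_norm_lessD[OF assms, of n] less_imp_le by blast
qed

lemma radon_norm_le:
  assumes "\<mu> \<in> radon_measures \<Omega>" "distr_eq \<Omega> T (measure_distr \<Omega> \<mu>)" "dual_norm \<Omega> \<mu> \<le> c"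
  shows "radon_norm \<Omega> T \<le> c"
  unfolding radon_norm_def using assms by (intro INF_lower2[of \<mu>]) auto

lemma grad_nth: "grad \<Omega> u \<phi> $ j = - regular_distr \<Omega> u (partial j \<phi>)"
  by (simp add: grad_def distr_partial_def)

text \<open>This is the compactness argument for the lower bound. The residuals \<open>grad \<Omega> (u n) - w n\<close>
have a weak limit, and the limit of \<open>w\<close> as a distribution is \<open>grad \<Omega> v\<close> minus that limit.\<close>

lemma limit_of_decompositions:
  fixes u :: "nat \<Rightarrow> real^2 \<Rightarrow> real" and w :: "nat \<Rightarrow> (real^2) set \<Rightarrow> real^2"
  assumes \<Omega>: "open \<Omega>" "connected \<Omega>" "bounded \<Omega>"
    and b: "card {i. b $ i = 0} \<le> 1"
    and t: "\<And>n. 0 < t n" "filterlim t at_top sequentially"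
    and u: "\<And>n. integrable (lebesgue_on \<Omega>) (u n)" "integrable (lebesgue_on \<Omega>) v"
    and lim: "(\<lambda>n. \<integral>x. \<bar>u n x - v x\<bar> \<partial>(lebesgue_on \<Omega>)) \<longlonglongrightarrow> 0"
    and first: "\<And>n. radon_norm \<Omega> (\<lambda>\<phi>. grad \<Omega> (u n) \<phi> - measure_distr \<Omega> (w n) \<phi>) < ereal c"
    and second: "\<And>n. radon_norm \<Omega> (\<lambda>\<phi>. diag (t n *\<^sub>R b) *v nabla_N (measure_distr \<Omega> (w n)) \<phi>) < ereal c"
  shows "\<exists>w'\<in>radon_measures \<Omega>. distr_eq \<Omega> (\<lambda>\<phi>. diag b *v nabla_N (measure_distr \<Omega> w') \<phi>) (\<lambda>_. 0) \<and>
     radon_norm \<Omega> (\<lambda>\<phi>. grad \<Omega> v \<phi> - measure_distr \<Omega> w' \<phi>) \<le> ereal c \<and>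
     (\<exists>\<mu>\<in>radon_measures \<Omega>. distr_eq \<Omega> (grad \<Omega> v) (measure_distr \<Omega> \<mu>))"
proof -
  obtain \<mu> where "\<forall>n. \<mu> n \<in> radon_measures \<Omega> \<and>
      distr_eq \<Omega> (\<lambda>\<phi>. grad \<Omega> (u n) \<phi> - measure_distr \<Omega> (w n) \<phi>) (measure_distr \<Omega> (\<mu> n)) \<and>
      dual_norm \<Omega> (\<mu> n) \<le> ereal c"
    using radon_norm_sequence_lessD[OF first] ..
  then have \<mu>: "\<mu> n \<in> radon_measures \<Omega>"
      "distr_eq \<Omega> (\<lambda>\<phi>. grad \<Omega> (u n) \<phi> - measure_distr \<Omega> (w n) \<phi>) (measure_distr \<Omega> (\<mu> n))"
      "dual_norm \<Omega> (\<mu> n) \<le> ereal c" for n by auto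
  obtain \<nu> where "\<forall>n. \<nu> n \<in> radon_measures \<Omega> \<and>
      distr_eq \<Omega> (\<lambda>\<phi>. diag (t n *\<^sub>R b) *v nabla_N (measure_distr \<Omega> (w n)) \<phi>) (measure_distr \<Omega> (\<nu> n)) \<and>
      dual_norm \<Omega> (\<nu> n) \<le> ereal c"
    using radon_norm_sequence_lessD[OF second] ..
  then have \<nu>: 
      "distr_eq \<Omega> (\<lambda>\<phi>. diag (t n *\<^sub>R b) *v nabla_N (measure_distr \<Omega> (w n)) \<phi>) (measure_distr \<Omega> (\<nu> n))"
      "dual_norm \<Omega> (\<nu> n) \<le> ereal c" for n by auto
  obtain r \<mu>' where r\<mu>: "strict_mono (r :: nat \<Rightarrow> nat) \<and> \<mu>' \<in> radon_measures \<Omega> \<and> dual_norm \<Omega> \<mu>' \<le> ereal c \<and>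
    (\<forall>f i. continuous_on UNIV f \<longrightarrow> bounded (range f) \<longrightarrow> (\<forall>x. x \<notin> \<Omega> \<longrightarrow> f x = 0) \<longrightarrow>
       (\<lambda>n. signed_integral \<Omega> (\<lambda>A. \<mu> (r n) A $ i) f) \<longlonglongrightarrow> signed_integral \<Omega> (\<lambda>A. \<mu>' A $ i) f)"
    using radon_measures_weak_compactness[where \<mu>=\<mu>, OF \<Omega>(1,3) \<mu>(1,3)] by (elim exE) (rule that)
  have r: "strict_mono r" and \<mu>': "\<mu>' \<in> radon_measures \<Omega>" "dual_norm \<Omega> \<mu>' \<le> ereal c"
    using r\<mu> by auto
  have conv: "(\<lambda>n. signed_integral \<Omega> (\<lambda>A. \<mu> (r n) A $ i) f) \<longlonglongrightarrow> signed_integral \<Omega> (\<lambda>A. \<mu>' A $ i) f"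
    if "continuous_on UNIV f" "bounded (range f)" "\<And>x. x \<notin> \<Omega> \<Longrightarrow> f x = 0" for f i
    using r\<mu> that by blast
  define T where "T \<phi> = grad \<Omega> v \<phi> - measure_distr \<Omega> \<mu>' \<phi>" for \<phi>
  have wT: "(\<lambda>n. measure_distr \<Omega> (w (r n)) \<phi>) \<longlonglongrightarrow> T \<phi>" if \<phi>: "\<phi> \<in> test_functions \<Omega>" for \<phi>
  proof -
    have eq: "measure_distr \<Omega> (w (r n)) \<phi> = grad \<Omega> (u (r n)) \<phi> - measure_distr \<Omega> (\<mu> (r n)) \<phi>" for n
    proof -
      have "grad \<Omega> (u (r n)) \<phi> - measure_distr \<Omega> (w (r n)) \<phi> = measure_distr \<Omega> (\<mu> (r n)) \<phi>"
        using \<mu>(2)[of "r n"] \<phi> unfolding distr_eq_def by blast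
      then show ?thesis by (simp add: algebra_simps)
    qed
    have "(\<lambda>n. grad \<Omega> (u n) \<phi>) \<longlonglongrightarrow> grad \<Omega> v \<phi>"
      by (rule vec_tendstoI, unfold grad_nth)
        (intro tendsto_minus regular_distr_convergence[OF u lim] test_functions_partial \<phi>)
    from LIMSEQ_subseq_LIMSEQ[OF this r]
    have g: "(\<lambda>n. grad \<Omega> (u (r n)) \<phi>) \<longlonglongrightarrow> grad \<Omega> v \<phi>" by (simp add: comp_def)
    obtain s where "\<And>x. \<bar>\<phi> x\<bar> \<le> s" by (rule test_functions_bounded[OF \<phi>]) (rule that)
    then have "bounded (range \<phi>)" by (auto simp: bounded_iff)
    then have "(\<lambda>n. measure_distr \<Omega> (\<mu> (r n)) \<phi>) \<longlonglongrightarrow> measure_distr \<Omega> \<mu>' \<phi>"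
      unfolding measure_distr_def
      by (intro vec_tendstoI) (simp add: conv test_functions_continuous[OF \<phi>] test_functions_outside[OF \<phi>])
    then show ?thesis unfolding eq T_def by (intro tendsto_diff g)
  qed
  \<comment> \<open>The penalty \<open>t n * \<bar>b $ i * nabla_N w \<phi> $ i\<bar>\<close> stays bounded while \<open>t n\<close> tends to infinity.\<close>
  have T0: "b $ i * nabla_N T \<phi> $ i = 0" if \<phi>: "\<phi> \<in> test_functions \<Omega>" for \<phi> i
  proof -
    obtain s where s: "0 < s" "\<And>x. \<bar>\<phi> x\<bar> \<le> s" by (rule test_functions_bounded[OF \<phi>]) (rule that)
    have N: "(\<lambda>n. b $ i * nabla_N (measure_distr \<Omega> (w (r n))) \<phi> $ i) \<longlonglongrightarrow> b $ i * nabla_N T \<phi> $ i"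
      by (intro tendsto_mult tendsto_const nabla_N_tendsto wT test_functions_partial \<phi>)
    have tb: "\<bar>t n * (b $ i * nabla_N (measure_distr \<Omega> (w n)) \<phi> $ i)\<bar> \<le> c * s" for n
    proof -
      have "diag (t n *\<^sub>R b) *v nabla_N (measure_distr \<Omega> (w n)) \<phi> = measure_distr \<Omega> (\<nu> n) \<phi>"
        using \<nu>(1)[of n] \<phi> unfolding distr_eq_def by blast
      then have "t n * (b $ i * nabla_N (measure_distr \<Omega> (w n)) \<phi> $ i) = measure_distr \<Omega> (\<nu> n) \<phi> $ i"
        using matrix_diag_mult[of "t n *\<^sub>R b" "nabla_N (measure_distr \<Omega> (w n)) \<phi>" i] by (simp add: mult.assoc)
      then show ?thesis using measure_distr_bound[OF \<Omega>(3) \<nu>(2) \<phi> s, of n i] by simp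
    qed
    have bd: "norm (b $ i * nabla_N (measure_distr \<Omega> (w n)) \<phi> $ i) \<le> c * s / t n" for n
      using t(1)[of n] tb[of n] by (simp add: abs_mult field_simps)
    have "filterlim (\<lambda>n. t (r n)) at_top sequentially"
      by (rule filterlim_compose[OF t(2) filterlim_subseq[OF r]])
    then have "(\<lambda>n. c * s / t (r n)) \<longlonglongrightarrow> 0"
      by (rule tendsto_divide_0[OF tendsto_const filterlim_at_top_imp_at_infinity])
    then have "(\<lambda>n. b $ i * nabla_N (measure_distr \<Omega> (w (r n))) \<phi> $ i) \<longlonglongrightarrow> 0"
      by (rule Lim_null_comparison[OF always_eventually[OF allI[OF bd]]])
    then show ?thesis using N LIMSEQ_unique by blast
  qed
  have "\<exists>b c. \<forall>\<phi>\<in>test_functions \<Omega>. T \<phi> $ k = (\<integral>x. (b + c \<bullet> x) * \<phi> x \<partial>lborel)" for k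
  proof (rule affine_functional[OF \<Omega>(1,2)])
    have sm: "signed_measure \<Omega> (\<lambda>A. \<mu>' A $ k)" using \<mu>'(1) by (simp add: radon_measures_iff)
    show "test_linear \<Omega> (\<lambda>\<phi>. T \<phi> $ k)"
      unfolding test_linear_def
    proof (intro ballI allI)
      fix f g a assume fg: "f \<in> test_functions \<Omega>" "g \<in> test_functions \<Omega>"
      show "T (\<lambda>x. f x + a * g x) $ k = T f $ k + a * T g $ k"
        using test_linearD[OF test_linear_partial[OF test_linear_regular_distr[OF u(2)]] fg, of k a]
          test_linearD[OF test_linear_signed_integral[OF sm] fg, of a]
        by (simp add: T_def grad_nth measure_distr_def algebra_simps)
    qed
    show "T (partial i (partial j \<psi>)) $ k = 0" if "\<psi> \<in> test_functions \<Omega>" for \<psi> i j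
      by (rule kernel_second_derivatives[OF b T0 that])
  qed
  then have "\<forall>k. \<exists>bc. \<forall>\<phi>\<in>test_functions \<Omega>. T \<phi> $ k = (\<integral>x. (fst bc + snd bc \<bullet> x) * \<phi> x \<partial>lborel)"
    by simp
  from choice[OF this] obtain bc where aff: "\<And>k \<phi>. \<phi> \<in> test_functions \<Omega> \<Longrightarrow> T \<phi> $ k = (\<integral>x. (fst (bc k) + snd (bc k) \<bullet> x) * \<phi> x \<partial>lborel)"
    by blast
  have "\<forall>k. \<exists>\<kappa>. signed_measure \<Omega> \<kappa> \<and> (\<forall>\<phi>\<in>test_functions \<Omega>. signed_integral \<Omega> \<kappa> \<phi> = (\<integral>x. (fst (bc k) + snd (bc k) \<bullet> x) * \<phi> x \<partial>lborel))"
    by (intro allI signed_measure_of_continuous_density[OF \<Omega>(1,3)] continuous_intros)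
  from choice[OF this] obtain \<kappa> where \<kappa>: "\<And>k. signed_measure \<Omega> (\<kappa> k)"
    "\<And>k \<phi>. \<phi> \<in> test_functions \<Omega> \<Longrightarrow> signed_integral \<Omega> (\<kappa> k) \<phi> = (\<integral>x. (fst (bc k) + snd (bc k) \<bullet> x) * \<phi> x \<partial>lborel)" by blast
  define w' :: "(real^2) set \<Rightarrow> real^2" where "w' A = (\<chi> k. \<kappa> k A)" for A
  have w': "w' \<in> radon_measures \<Omega>" using \<kappa>(1) by (simp add: radon_measures_iff w'_def)
  have w'T: "measure_distr \<Omega> w' \<phi> = T \<phi>" if "\<phi> \<in> test_functions \<Omega>" for \<phi>
    unfolding vec_eq_iff using that by (simp add: measure_distr_def w'_def \<kappa>(2) aff)
  have "distr_eq \<Omega> (\<lambda>\<phi>. diag b *v nabla_N (measure_distr \<Omega> w') \<phi>) (\<lambda>_. 0)"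
    unfolding distr_eq_def
  proof
    fix \<phi> assume \<phi>: "\<phi> \<in> test_functions \<Omega>"
    have "nabla_N (measure_distr \<Omega> w') \<phi> = nabla_N T \<phi>"
      by (intro nabla_N_cong w'T test_functions_partial \<phi>)
    then show "diag b *v nabla_N (measure_distr \<Omega> w') \<phi> = 0"
      by (simp add: vec_eq_iff matrix_diag_mult T0[OF \<phi>])
  qed
  moreover have "radon_norm \<Omega> (\<lambda>\<phi>. grad \<Omega> v \<phi> - measure_distr \<Omega> w' \<phi>) \<le> ereal c"
    by (rule radon_norm_le[OF \<mu>'(1) _ \<mu>'(2)]) (simp add: distr_eq_def w'T T_def)
  moreover have "\<exists>\<mu>\<in>radon_measures \<Omega>. distr_eq \<Omega> (grad \<Omega> v) (measure_distr \<Omega> \<mu>)"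
  proof (intro bexI)
    have s: "signed_measure \<Omega> (\<lambda>A. w' A $ k)" "signed_measure \<Omega> (\<lambda>A. \<mu>' A $ k)" for k
      using w' \<mu>'(1) by (auto simp: radon_measures_iff)
    show "(\<lambda>A. w' A + \<mu>' A) \<in> radon_measures \<Omega>"
      using s by (simp add: radon_measures_iff signed_measure_add)
    show "distr_eq \<Omega> (grad \<Omega> v) (measure_distr \<Omega> (\<lambda>A. w' A + \<mu>' A))"
      unfolding distr_eq_def
    proof
      fix \<phi> assume \<phi>: "\<phi> \<in> test_functions \<Omega>"
      obtain s' where s': "\<And>x. \<bar>\<phi> x\<bar> \<le> s'" by (rule test_functions_bounded[OF \<phi>]) (rule that)
      have "measure_distr \<Omega> (\<lambda>A. w' A + \<mu>' A) \<phi> = measure_distr \<Omega> w' \<phi> + measure_distr \<Omega> \<mu>' \<phi>"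
        using signed_integral_add[OF s test_functions_measurable[OF \<phi>] s'] by (simp add: measure_distr_def vec_eq_iff)
      then show "grad \<Omega> v \<phi> = measure_distr \<Omega> (\<lambda>A. w' A + \<mu>' A) \<phi>" by (simp add: w'T[OF \<phi>] T_def)
    qed
  qed
  ultimately show ?thesis using w' by blast
qed

lemma radon_norm_zero: 
  assumes "distr_eq \<Omega> T (\<lambda>_. 0 :: real^'d::finite)"
  shows "radon_norm \<Omega> T \<le> 0"
proof (rule radon_norm_le[of "\<lambda>_. 0"])
  show "(\<lambda>_. 0 :: real^'d) \<in> radon_measures \<Omega>" by (simp add: radon_measures_def)
  show "distr_eq \<Omega> T (measure_distr \<Omega> (\<lambda>_. 0))"
    using assms by (simp add: distr_eq_def measure_distr_def signed_integral_def vec_eq_iff)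
  show "dual_norm \<Omega> (\<lambda>_. 0 :: real^'d) \<le> 0"
    unfolding dual_norm_def by (rule SUP_least) (simp add: signed_integral_def)
qed

lemma R_functional_le_TV_functional:
  "R_functional \<Omega> (t *\<^sub>R b) u \<le> TV_functional \<Omega> (diag b) u"
  unfolding TV_functional_def
proof (rule INF_greatest)
  fix w assume "w \<in> {w \<in> radon_measures \<Omega>. distr_eq \<Omega> (\<lambda>\<phi>. diag b *v nabla_N (measure_distr \<Omega> w) \<phi>) (\<lambda>_. 0)}"
  then have w: "w \<in> radon_measures \<Omega>" and d: "distr_eq \<Omega> (\<lambda>\<phi>. diag b *v nabla_N (measure_distr \<Omega> w) \<phi>) (\<lambda>_. 0)" by auto
  have "distr_eq \<Omega> (\<lambda>\<phi>. diag (t *\<^sub>R b) *v nabla_N (measure_distr \<Omega> w) \<phi>) (\<lambda>_. 0)"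
    using d by (simp add: distr_eq_def vec_eq_iff matrix_diag_mult)
  then have z: "radon_norm \<Omega> (\<lambda>\<phi>. diag (t *\<^sub>R b) *v nabla_N (measure_distr \<Omega> w) \<phi>) \<le> 0"
    by (rule radon_norm_zero)
  have "R_functional \<Omega> (t *\<^sub>R b) u \<le> radon_norm \<Omega> (\<lambda>\<phi>. grad \<Omega> u \<phi> - measure_distr \<Omega> w \<phi>)
        + radon_norm \<Omega> (\<lambda>\<phi>. diag (t *\<^sub>R b) *v nabla_N (measure_distr \<Omega> w) \<phi>)"
    unfolding R_functional_def by (rule INF_lower[OF w])
  also have "\<dots> \<le> radon_norm \<Omega> (\<lambda>\<phi>. grad \<Omega> u \<phi> - measure_distr \<Omega> w \<phi>) + 0"
    by (rule add_left_mono[OF z])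
  finally show "R_functional \<Omega> (t *\<^sub>R b) u \<le> radon_norm \<Omega> (\<lambda>\<phi>. grad \<Omega> u \<phi> - measure_distr \<Omega> w \<phi>)" by simp
qed

lemma R_functional_lessD:
  assumes "R_functional \<Omega> b u < c"
  shows "\<exists>w. radon_norm \<Omega> (\<lambda>\<phi>. grad \<Omega> u \<phi> - measure_distr \<Omega> w \<phi>) < c \<and>
     radon_norm \<Omega> (\<lambda>\<phi>. diag b *v nabla_N (measure_distr \<Omega> w) \<phi>) < c"
proof -
  obtain w where w: "radon_norm \<Omega> (\<lambda>\<phi>. grad \<Omega> u \<phi> - measure_distr \<Omega> w \<phi>)
        + radon_norm \<Omega> (\<lambda>\<phi>. diag b *v nabla_N (measure_distr \<Omega> w) \<phi>) < c" (is "?x + ?y < c")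
    using assms unfolding R_functional_def INF_less_iff by blast
  have "?x \<le> ?x + ?y" "?y \<le> ?x + ?y"
    using add_increasing2[OF radon_norm_nonneg order_refl] add_increasing[OF radon_norm_nonneg order_refl] by blast+
  then show ?thesis using w by (intro exI[of _ w]) (auto intro: order_le_less_trans)
qed

theorem theorem3:
  fixes \<Omega> :: "(real^2) set" and \<beta> :: "real^4" and p :: real
  assumes "bounded_lipschitz_domain \<Omega>"
    and "\<And>i. 0 \<le> \<beta> $ i"
    and "card {i. \<beta> $ i = 0} \<le> 1"
    and "1 \<le> p" and "p < 2"
  shows "Gamma_converges_at_top (Lp p \<Omega>) (Lp_dist p \<Omega>)
           (\<lambda>t. extend_BV \<Omega> (R_functional \<Omega> (t *\<^sub>R (\<chi> i. sqrt (\<beta> $ i)))))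
           (extend_BV \<Omega> (TV_functional \<Omega> (diag (\<chi> i. sqrt (\<beta> $ i)))))"
proof -
  define b where "b = (\<chi> i. sqrt (\<beta> $ i))"
  have b: "card {i. b $ i = 0} \<le> 1" using assms(3) by (simp add: b_def)
  have \<Omega>: "open \<Omega>" "connected \<Omega>" "bounded \<Omega>"
    using assms(1) by (auto simp: bounded_lipschitz_domain_def)
  have liminf: "extend_BV \<Omega> (TV_functional \<Omega> (diag b)) v \<le> liminf (\<lambda>n. extend_BV \<Omega> (R_functional \<Omega> (t n *\<^sub>R b)) (u n))"
    if t: "\<And>n. 0 < t n" "filterlim t at_top sequentially" and v: "v \<in> Lp p \<Omega>" and u: "range u \<subseteq> Lp p \<Omega>"
      and d: "(\<lambda>n. Lp_dist p \<Omega> (u n) v) \<longlonglongrightarrow> 0" for t :: "nat \<Rightarrow> real" and u v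
  proof (rule ccontr)
    let ?F = "\<lambda>n. extend_BV \<Omega> (R_functional \<Omega> (t n *\<^sub>R b)) (u n)"
    assume "\<not> ?thesis"
    then have "liminf ?F < extend_BV \<Omega> (TV_functional \<Omega> (diag b)) v" by (simp add: not_le)
    then obtain c where c: "liminf ?F < ereal c" "ereal c < extend_BV \<Omega> (TV_functional \<Omega> (diag b)) v"
      using ereal_dense2 by blast
    \<comment> \<open>A real level \<open>c\<close> strictly in between is undercut infinitely often, and a subsequence can be passed to.\<close>
    have "infinite {n. ?F n < ereal c}"
    proof
      assume "finite {n. ?F n < ereal c}"
      then have "\<forall>\<^sub>F n in sequentially. ereal c \<le> ?F n"
        by (simp add: eventually_cofinite not_le flip: cofinite_eq_sequentially)
      then have "ereal c \<le> liminf ?F" by (rule Liminf_bounded)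
      then show False using c(1) by simp
    qed
    from infinite_enumerate[OF this] obtain s :: "nat \<Rightarrow> nat"
      where s: "strict_mono s" "\<And>n. ?F (s n) < ereal c" by auto
    have R: "R_functional \<Omega> (t (s n) *\<^sub>R b) (u (s n)) < ereal c" for n
      using s(2)[of n] by (auto simp: extend_BV_def split: if_splits)
    have "\<forall>n. \<exists>w. radon_norm \<Omega> (\<lambda>\<phi>. grad \<Omega> (u (s n)) \<phi> - measure_distr \<Omega> w \<phi>) < ereal c \<and>
       radon_norm \<Omega> (\<lambda>\<phi>. diag (t (s n) *\<^sub>R b) *v nabla_N (measure_distr \<Omega> w) \<phi>) < ereal c"
      by (intro allI R_functional_lessD R)
    from choice[OF this] obtain w where w: "\<And>n. radon_norm \<Omega> (\<lambda>\<phi>. grad \<Omega> (u (s n)) \<phi> - measure_distr \<Omega> (w n) \<phi>) < ereal c"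
       "\<And>n. radon_norm \<Omega> (\<lambda>\<phi>. diag (t (s n) *\<^sub>R b) *v nabla_N (measure_distr \<Omega> (w n)) \<phi>) < ereal c"
      by blast
    have uL: "u n \<in> Lp p \<Omega>" for n using u by blast
    have L1: "(\<lambda>n. \<integral>x. \<bar>u (s n) x - v x\<bar> \<partial>(lebesgue_on \<Omega>)) \<longlonglongrightarrow> 0"
      using LIMSEQ_subseq_LIMSEQ[OF Lp_convergence_imp_L1[OF \<Omega>(1,3) assms(4) uL v d] s(1)] by (simp add: comp_def)
    have ts: "filterlim (\<lambda>n. t (s n)) at_top sequentially"
      by (rule filterlim_compose[OF t(2) filterlim_subseq[OF s(1)]])
    obtain w' \<mu> where w': "w' \<in> radon_measures \<Omega>" "distr_eq \<Omega> (\<lambda>\<phi>. diag b *v nabla_N (measure_distr \<Omega> w') \<phi>) (\<lambda>_. 0)"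
       "radon_norm \<Omega> (\<lambda>\<phi>. grad \<Omega> v \<phi> - measure_distr \<Omega> w' \<phi>) \<le> ereal c"
       "\<mu> \<in> radon_measures \<Omega>" "distr_eq \<Omega> (grad \<Omega> v) (measure_distr \<Omega> \<mu>)"
      using limit_of_decompositions[OF \<Omega> b, of "\<lambda>n. t (s n)" "\<lambda>n. u (s n)" v w c, OF t(1) ts
          Lp_integrable[OF \<Omega>(1,3) assms(4) uL] Lp_integrable[OF \<Omega>(1,3) assms(4) v] L1 w] by blast
    have "v \<in> Lp 1 \<Omega>"
      using Lp_integrable[OF \<Omega>(1,3) assms(4) v] by (auto simp: Lp_def)
    then have "v \<in> BV \<Omega>" using w'(4,5) by (auto simp: BV_def)
    moreover have "TV_functional \<Omega> (diag b) v \<le> ereal c"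
      unfolding TV_functional_def using w'(1-3) by (intro INF_lower2[of w']) auto
    ultimately show False using c(2) by (simp add: extend_BV_def)
  qed
  have le: "extend_BV \<Omega> (R_functional \<Omega> (t *\<^sub>R b)) u \<le> extend_BV \<Omega> (TV_functional \<Omega> (diag b)) u" for t u
    by (simp add: extend_BV_def R_functional_le_TV_functional)
  have limsup: "\<exists>y. range y \<subseteq> Lp p \<Omega> \<and> (\<lambda>n. Lp_dist p \<Omega> (y n) u) \<longlonglongrightarrow> 0 \<and>
      limsup (\<lambda>n. extend_BV \<Omega> (R_functional \<Omega> (t n *\<^sub>R b)) (y n)) \<le> extend_BV \<Omega> (TV_functional \<Omega> (diag b)) u"
    if "u \<in> Lp p \<Omega>" for t :: "nat \<Rightarrow> real" and u
    by (intro exI[of _ "\<lambda>_. u"] conjI Limsup_bounded always_eventually allI le)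
      (use that in \<open>auto simp: Lp_dist_def\<close>)
  show ?thesis
    unfolding Gamma_converges_at_top_def Gamma_converges_seq_def b_def[symmetric]
  proof (intro allI impI ballI conjI)
  qed (auto intro: liminf limsup)
qed

end
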